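(* Let $\pi\in S_n$ be a vexillary permutation. With respect to any diagonal term order, the initial ideal of $I_\pi$ is the Stanley–Reisner ideal of the subword complex $\Gamma_\pi$; that is, $\mathrm{in}\,I_\pi$ is the ideal of $\mathbb k[\mathbf z]$ generated by the monomials $\prod_{(p,q)\in F}z_{pq}$ for all $F\subseteq\mu(\pi)$ that are not faces of $\Gamma_\pi$.
   Context: Let $\mathbb k$ be a field and $\mathbb k[\mathbf z]$ the polynomial ring in the entries of $\mathbf z=(z_{ij})_{i,j=1}^n$; $\mathbf z_{p\times q}$ is the northwest $p\times q$ submatrix. For $\pi\in S_n$, $r^\pi_{pq}=\#\{i\le p:\pi(i)\le q\}$ and $I_\pi$ is generated by all minors of size $1+r^\pi_{pq}$ in $\mathbf z_{p\times q}$, over all $p,q$. A term order is diagonal if the leading term of every minor of $\mathbf z$ is its diagonal term. $D(\pi)=\{(p,q):\pi(p)>q,\ \pi^{-1}(q)>p\}$, $\mathcal Ess(\pi)=\{(p,q)\in D(\pi):(p+1,q),(p,q+1)\notin D(\pi)\}$. $\pi$ is vexillary if there are no $a<b<c<d$ with $\pi(b)<\pi(a)<\pi(d)<\pi(c)$; $\lambda(\pi)$ is the partition whose parts are the numbers of boxes in the rows of $D(\pi)$. For a word $Q=(s_{i_1},\dots,s_{i_t})$ of simple reflections in $S_m$ and $\rho\in S_m$, the subword complex $\Delta(Q,\rho)$ has as vertices the letters of $Q$ and as faces the sets $Q\setminus P$ where the subword $P$ has a subsequence whose ordered product is a reduced expression for $\rho$. For vexillary $\pi$ with last descent $k$, let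 $\mu(\pi)=(\mu_1\ge\dots\ge\mu_k>0)$ be the smallest Ferrers shape (English notation) containing $D(\pi)$, i.e. the union of the northwest $p\times q$ rectangles over $(p,q)\in\mathcal Ess(\pi)$, identified with its set of boxes. Fill box $(p,q)$ of $\mu(\pi)$ with $s_{k-p+q}$ and read each row right to left, from the bottom row to the top row, to get the word $Q$; its letters are identified with the boxes of $\mu(\pi)$, hence with variables $z_{pq}$. Let $\tilde\pi$ (in a sufficiently large $S_N$) be the Grassmannian permutation (exactly one descent) with descent at $k$ determined by $\mathcal Ess(\tilde\pi)=\{(k,k-p+q):(p,q)\in\mathcal Ess(\pi)\}$ and $r^{\tilde\pi}_{k,k-p+q}=k-p+r^\pi_{pq}$ (equivalently $\lambda(\tilde\pi)=\lambda(\pi)$). Set $\Gamma_\pi=\Delta(Q,\tilde\pi)$. (If $\pi$ is the identity, take $k=0$, $\mu(\pi)$ and $Q$ empty, $\tilde\pi$ the identity.) *)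

theory Defs
  imports
    "HOL-Library.Poly_Mapping"
    "HOL-Library.Sublist"
    "HOL-Combinatorics.Permutations"
    "HOL-Algebra.Ideal"
    "Jordan_Normal_Form.Determinant"
begin

section \<open>The polynomial ring in the entries of a generic square matrix\<close>

text \<open>A monomial is its exponent vector, so the product of monomials is addition and the
  monomial 1 is 0. The product of \<^typ>\<open>_ \<Rightarrow>\<^sub>0 _\<close> is convolution, i.e.
  multiplication of polynomials.\<close>

type_synonym monom = "(nat \<times> nat) \<Rightarrow>\<^sub>0 nat"
type_synonym 'k mpol = "monom \<Rightarrow>\<^sub>0 'k"

definition monoms :: "nat \<Rightarrow> monom set" where
  "monoms n = {m. Poly_Mapping.keys m \<subseteq> {1..n} \<times> {1..n}}"

definition zvar :: "nat \<times> nat \<Rightarrow> 'k::field mpol" where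
  "zvar x = Poly_Mapping.single (Poly_Mapping.single x 1) 1"

definition zring :: "nat \<Rightarrow> 'k::field mpol ring" where
  "zring n = \<lparr>carrier = {f. Poly_Mapping.keys f \<subseteq> monoms n},
     monoid.mult = (*), one = 1, ring.zero = 0, add = (+)\<rparr>"

lemma monoms_add: "s \<in> monoms n \<Longrightarrow> t \<in> monoms n \<Longrightarrow> s + t \<in> monoms n"
  using Poly_Mapping.keys_add[of s t] by (auto simp: monoms_def)

lemma cring_zring: "cring (zring n :: 'k::field mpol ring)"
proof (rule cringI)
  show "abelian_group (zring n :: 'k mpol ring)"
  proof (rule abelian_groupI)
    fix f g :: "'k mpol"
    assume "f \<in> carrier (zring n)" "g \<in> carrier (zring n)"
    then show "f \<oplus>\<^bsub>zring n\<^esub> g \<in> carrier (zring n)"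
      using Poly_Mapping.keys_add[of f g] by (auto simp: zring_def)
  next
    fix f :: "'k mpol"
    assume "f \<in> carrier (zring n)"
    then show "\<exists>g\<in>carrier (zring n). g \<oplus>\<^bsub>zring n\<^esub> f = \<zero>\<^bsub>zring n\<^esub>"
      by (intro bexI[of _ "- f"]) (auto simp: zring_def)
  qed (auto simp: zring_def add_ac)
  show "comm_monoid (zring n :: 'k mpol ring)"
  proof (rule comm_monoidI)
    fix f g :: "'k mpol"
    assume "f \<in> carrier (zring n)" "g \<in> carrier (zring n)"
    then show "f \<otimes>\<^bsub>zring n\<^esub> g \<in> carrier (zring n)"
      using Poly_Mapping.keys_mult[of f g] monoms_add[of _ n] by (fastforce simp: zring_def)
  qed (auto simp: zring_def mult_ac monoms_def)
qed (auto simp: zring_def algebra_simps)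

section \<open>Term orders and initial ideals\<close>

definition term_order :: "nat \<Rightarrow> (monom \<times> monom) set \<Rightarrow> bool" where
  "term_order n r \<longleftrightarrow> linear_order_on (monoms n) r \<and>
     (\<forall>s\<in>monoms n. (0, s) \<in> r) \<and>
     (\<forall>s\<in>monoms n. \<forall>t\<in>monoms n. \<forall>u\<in>monoms n. (s, t) \<in> r \<longrightarrow> (s + u, t + u) \<in> r)"

definition leading_monom :: "(monom \<times> monom) set \<Rightarrow> 'k::field mpol \<Rightarrow> monom" where
  "leading_monom r f = (THE m. m \<in> Poly_Mapping.keys f \<and> (\<forall>m'\<in>Poly_Mapping.keys f. (m', m) \<in> r))"

definition leading_term :: "(monom \<times> monom) set \<Rightarrow> 'k::field mpol \<Rightarrow> 'k mpol" where
  "leading_term r f =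
     Poly_Mapping.single (leading_monom r f) (Poly_Mapping.lookup f (leading_monom r f))"

definition initial_ideal :: "nat \<Rightarrow> (monom \<times> monom) set \<Rightarrow> 'k::field mpol set \<Rightarrow> 'k mpol set" where
  "initial_ideal n r I = Idl\<^bsub>zring n\<^esub> {leading_term r f | f. f \<in> I \<and> f \<noteq> 0}"

section \<open>Minors\<close>

text \<open>The row and column indices \<open>a i\<close>, \<open>b i\<close> are 1-based; only their position \<open>i < s\<close> is
  0-based, as in \<^const>\<open>mat\<close>.\<close>

definition minor :: "nat \<Rightarrow> (nat \<Rightarrow> nat) \<Rightarrow> (nat \<Rightarrow> nat) \<Rightarrow> 'k::field mpol" where
  "minor s a b = det (mat s s (\<lambda>(i, j). zvar (a i, b j)))"

definition diagonal_term :: "nat \<Rightarrow> (nat \<Rightarrow> nat) \<Rightarrow> (nat \<Rightarrow> nat) \<Rightarrow> 'k::field mpol" where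
  "diagonal_term s a b = (\<Prod>i<s. zvar (a i, b i))"

definition index_seq :: "nat \<Rightarrow> nat \<Rightarrow> (nat \<Rightarrow> nat) \<Rightarrow> bool" where
  "index_seq s p a \<longleftrightarrow> strict_mono_on {..<s} a \<and> a ` {..<s} \<subseteq> {1..p}"

definition nw_minors :: "nat \<Rightarrow> nat \<Rightarrow> nat \<Rightarrow> 'k::field mpol set" where
  "nw_minors s p q = {minor s a b | a b. index_seq s p a \<and> index_seq s q b}"

text \<open>The coefficient field is an argument because leading terms of minors live over it.\<close>

definition diagonal_term_order :: "'k::field itself \<Rightarrow> nat \<Rightarrow> (monom \<times> monom) set \<Rightarrow> bool" where
  "diagonal_term_order _ n r \<longleftrightarrow> term_order n r \<and>
     (\<forall>s a b. index_seq s n a \<and> index_seq s n b \<longrightarrow>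
        leading_term r (minor s a b :: 'k mpol) = diagonal_term s a b)"

section \<open>Permutations\<close>

text \<open>An element of $S_n$ is a function on \<^typ>\<open>nat\<close> that permutes \<open>{1..n}\<close>
  and fixes 0 and all \<open>i > n\<close>. None of the sets below gains elements from these extra fixed
  points, so the definitions need not mention \<open>n\<close>.\<close>

definition rank_fn :: "(nat \<Rightarrow> nat) \<Rightarrow> nat \<Rightarrow> nat \<Rightarrow> nat" where
  "rank_fn \<pi> p q = card {i \<in> {1..p}. \<pi> i \<le> q}"

definition schubert_ideal :: "nat \<Rightarrow> (nat \<Rightarrow> nat) \<Rightarrow> 'k::field mpol set" where
  "schubert_ideal n \<pi> =
     Idl\<^bsub>zring n\<^esub> (\<Union>p\<in>{1..n}. \<Union>q\<in>{1..n}. nw_minors (1 + rank_fn \<pi> p q) p q)"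

definition diagram :: "(nat \<Rightarrow> nat) \<Rightarrow> (nat \<times> nat) set" where
  "diagram \<pi> = {(p, q). \<pi> p > q \<and> inv_into UNIV \<pi> q > p}"

definition ess :: "(nat \<Rightarrow> nat) \<Rightarrow> (nat \<times> nat) set" where
  "ess \<pi> = {(p, q) \<in> diagram \<pi>. (p + 1, q) \<notin> diagram \<pi> \<and> (p, q + 1) \<notin> diagram \<pi>}"

definition vexillary :: "(nat \<Rightarrow> nat) \<Rightarrow> bool" where
  "vexillary \<pi> \<longleftrightarrow>
     \<not> (\<exists>a b c d. a < b \<and> b < c \<and> c < d \<and> \<pi> b < \<pi> a \<and> \<pi> a < \<pi> d \<and> \<pi> d < \<pi> c)"

definition descents :: "(nat \<Rightarrow> nat) \<Rightarrow> nat set" where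
  "descents \<pi> = {i. \<pi> i > \<pi> (i + 1)}"

text \<open>The identity has last descent 0 by convention.\<close>

definition last_descent :: "(nat \<Rightarrow> nat) \<Rightarrow> nat" where
  "last_descent \<pi> = Max (insert 0 (descents \<pi>))"

section \<open>Subword complexes\<close>

text \<open>A word is the list of the indices of its simple reflections. Its product is the composite
  of functions, the last letter acting first; hence the reduced expressions of a permutation
  with a descent at \<open>k\<close> include one that ends in \<open>k\<close>.\<close>

definition word_prod :: "nat list \<Rightarrow> nat \<Rightarrow> nat" where
  "word_prod R = foldr (\<lambda>i f. Transposition.transpose i (i + 1) \<circ> f) R id"

definition reduced_expression :: "nat list \<Rightarrow> (nat \<Rightarrow> nat) \<Rightarrow> bool" where
  "reduced_expression R \<rho> \<longleftrightarrow> set R \<subseteq> {1..} \<and> word_prod R = \<rho> \<and>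
     (\<forall>R'. set R' \<subseteq> {1..} \<and> word_prod R' = \<rho> \<longrightarrow> length R \<le> length R')"

text \<open>The vertices, i.e. the letters of \<open>Q\<close>, are represented by their positions in \<open>Q\<close>.\<close>

definition subword_complex :: "nat list \<Rightarrow> (nat \<Rightarrow> nat) \<Rightarrow> nat set set" where
  "subword_complex Q \<rho> = {{..<length Q} - P | P. P \<subseteq> {..<length Q} \<and>
     (\<exists>R. subseq R (nths Q P) \<and> reduced_expression R \<rho>)}"

section \<open>The complex of a vexillary permutation\<close>

definition shape :: "(nat \<Rightarrow> nat) \<Rightarrow> (nat \<times> nat) set" where
  "shape \<pi> = (\<Union>(p, q)\<in>ess \<pi>. {1..p} \<times> {1..q})"

definition shape_row :: "(nat \<Rightarrow> nat) \<Rightarrow> nat \<Rightarrow> nat" where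
  "shape_row \<pi> p = card {q. (p, q) \<in> shape \<pi>}"

text \<open>The boxes in reading order: bottom row to top row, each row right to left.\<close>

definition reading_boxes :: "(nat \<Rightarrow> nat) \<Rightarrow> (nat \<times> nat) list" where
  "reading_boxes \<pi> =
     [(p, q). p \<leftarrow> rev [1..<last_descent \<pi> + 1], q \<leftarrow> rev [1..<shape_row \<pi> p + 1]]"

text \<open>The subtractions do not truncate: boxes of the diagram, hence of the shape, lie in rows
  \<open>p \<le> last_descent \<pi>\<close>.\<close>

definition reading_word :: "(nat \<Rightarrow> nat) \<Rightarrow> nat list" where
  "reading_word \<pi> = map (\<lambda>(p, q). last_descent \<pi> - p + q) (reading_boxes \<pi>)"

definition is_grassmannian_of :: "(nat \<Rightarrow> nat) \<Rightarrow> (nat \<Rightarrow> nat) \<Rightarrow> bool" where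
  "is_grassmannian_of \<pi> \<rho> \<longleftrightarrow> (let k = last_descent \<pi> in
     (\<exists>N. \<rho> permutes {1..N}) \<and> descents \<rho> = {k} \<and>
     ess \<rho> = (\<lambda>(p, q). (k, k - p + q)) ` ess \<pi> \<and>
     (\<forall>(p, q)\<in>ess \<pi>. rank_fn \<rho> k (k - p + q) = k - p + rank_fn \<pi> p q))"

definition grassmannian_of :: "(nat \<Rightarrow> nat) \<Rightarrow> nat \<Rightarrow> nat" where
  "grassmannian_of \<pi> = (if \<pi> = id then id else (THE \<rho>. is_grassmannian_of \<pi> \<rho>))"

text \<open>The position \<open>i\<close> of a letter of the reading word is identified with the \<open>i\<close>-th box.\<close>

definition Gamma_complex :: "(nat \<Rightarrow> nat) \<Rightarrow> (nat \<times> nat) set set" where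
  "Gamma_complex \<pi> = (\<lambda>F. (!) (reading_boxes \<pi>) ` F) `
     subword_complex (reading_word \<pi>) (grassmannian_of \<pi>)"

definition stanley_reisner_ideal ::
  "nat \<Rightarrow> (nat \<times> nat) set \<Rightarrow> (nat \<times> nat) set set \<Rightarrow> 'k::field mpol set" where
  "stanley_reisner_ideal n V \<Delta> = Idl\<^bsub>zring n\<^esub> {\<Prod>x\<in>F. zvar x | F. F \<subseteq> V \<and> F \<notin> \<Delta>}"

end

theory Submission
  imports Defs
begin

text \<open>Every face condition is expressed through the length \<open>lc F p q\<close> of a longest chain of
  \<open>F\<close>, strictly increasing in rows and columns, in the northwest \<open>p \<times> q\<close> rectangle: \<open>F\<close> is a
  face iff \<open>lc F p q \<le> rank_fn \<pi> p q\<close> for all essential \<open>(p, q)\<close>. To see this, let the letters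
  of the word outside \<open>F\<close> act on \<open>{1..k}\<close> by the 0-Hecke action. The numbers of particles in
  initial segments are then governed by \<open>lc\<close>, and comparing them with those of the Grassmannian
  permutation decides whether the word contains a reduced expression.

  A nonface contains such a chain of length \<open>rank_fn \<pi> p q + 1\<close>, so its monomial is divisible by
  the diagonal term of a generator. Conversely, let the support of a monomial contain no such
  chain. Its level sets by height are antichains. A sum over \<open>s\<close> of generic matrices of rank 1,
  the one for level \<open>s\<close> truncated to 0 on the essential rectangles of rank less than \<open>s\<close>,
  satisfies all the rank conditions, since \<open>\<pi>\<close> is vexillary. Among the monomials with given row
  and column sums, the one supported on an antichain is the smallest for every diagonal term
  order. Hence, when this matrix is substituted into a polynomial with that leading monomial, some
  coefficient equals the leading coefficient, and so the polynomial is not in the ideal.\<close>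

section \<open>Sets of positive integers under adjacent transpositions\<close>

text \<open>The hard inclusion is that of the initial ideal in the Stanley-Reisner ideal: nothing is
  known beforehand about Groebner bases, degrees or multiplicities. It is settled by a single test
  point. The entries of the test matrix are polynomials in fresh indeterminates, so no field is too
  small, and the decisive term occurs in the expansion with integer coefficient 1, so no
  characteristic is special.

  The particle counts obey the recursion of longest chains because reading the word from its end
  adds the boxes of the shape one at a time, and each box moves one vertex of the boundary path.
  Vexillarity acts through one fact, that no essential box lies strictly northwest of another:
  essential boxes therefore lie on the outer boundary of the shape, where the counts are known; they
  are linearly ordered from southwest to northeast, which makes the Grassmannian data consistent;
  and any two of their rectangles meet in full rows or full columns of either one.\<close>

definition cnt :: "nat set \<Rightarrow> nat \<Rightarrow> nat" where
  "cnt A c = card (A \<inter> {1..c})"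

lemma cnt_0 [simp]: "cnt A 0 = 0"
  by (simp add: cnt_def)

lemma cnt_Suc: "cnt A (Suc c) = cnt A c + (if Suc c \<in> A then 1 else 0)"
proof -
  have "{1..Suc c} = insert (Suc c) {1..c}" by auto
  then show ?thesis by (simp add: cnt_def Int_insert_right)
qed

lemma cnt_mono: "c \<le> d \<Longrightarrow> cnt A c \<le> cnt A d"
  by (auto simp: cnt_def intro!: card_mono)

lemma cnt_le_card: "finite A \<Longrightarrow> cnt A c \<le> card A"
  by (auto simp: cnt_def intro!: card_mono)

lemma cnt_eq_card: "finite A \<Longrightarrow> A \<subseteq> {1..c} \<Longrightarrow> cnt A c = card A"
  by (simp add: cnt_def inf.absorb1)

lemma cnt_inject:
  assumes "A \<subseteq> {1..}" "B \<subseteq> {1..}" "\<And>c. cnt A c = cnt B c"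
  shows "A = B"
proof -
  have "Suc c \<in> A \<longleftrightarrow> Suc c \<in> B" for c
    using assms(3)[of c] assms(3)[of "Suc c"] by (auto simp: cnt_Suc split: if_splits)
  moreover have "0 \<notin> A" "0 \<notin> B" using assms by auto
  ultimately show ?thesis by (metis not0_implies_Suc subsetI subset_antisym)
qed

text \<open>The 0-Hecke action of the transposition of \<open>i\<close> and \<open>i + 1\<close>.\<close>

definition hop :: "nat \<Rightarrow> nat set \<Rightarrow> nat set" where
  "hop i A = (if i \<in> A \<and> Suc i \<notin> A then insert (Suc i) (A - {i}) else A)"

lemma card_hop:
  assumes "finite A"
  shows "finite (hop i A)" "card (hop i A) = card A"
  using assms card_Suc_Diff1[of A i] by (auto simp: hop_def)

text \<open>Only the prefix that ends at \<open>i\<close> separates the two sites. The lost particle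
  is added on the left because natural subtraction truncates.\<close>

lemma cnt_hop:
  assumes "1 \<le> i"
  shows "cnt (hop i A) c + (if c = i \<and> i \<in> A \<and> Suc i \<notin> A then 1 else 0) = cnt A c"
proof (cases "i \<in> A \<and> Suc i \<notin> A")
  case True
  define X where "X = insert (Suc i) (A - {i})"
  have "cnt X c + (if c = i then 1 else 0) = cnt A c"
  proof (induction c)
    case (Suc c)
    have X: "Suc c \<in> X \<longleftrightarrow> c = i \<or> Suc c \<in> A \<and> Suc c \<noteq> i" by (auto simp: X_def)
    consider "c = i" | "Suc c = i" | "c \<noteq> i" "Suc c \<noteq> i" by blast
    then show ?case
    proof cases
      case 1
      then have "Suc c \<in> X" "Suc c \<notin> A" "Suc c \<noteq> i" using X True by auto
      then show ?thesis using Suc 1 unfolding cnt_Suc by simp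
    next
      case 2
      then have "Suc c \<notin> X" "Suc c \<in> A" "c \<noteq> i" using X True by auto
      then show ?thesis using Suc 2 unfolding cnt_Suc by simp
    next
      case 3
      then have "Suc c \<in> X \<longleftrightarrow> Suc c \<in> A" using X by auto
      then show ?thesis using Suc 3 unfolding cnt_Suc by simp
    qed
  qed (use assms in simp)
  then have "cnt (insert (Suc i) (A - {i})) c + (if c = i then 1 else 0) = cnt A c"
    unfolding X_def .
  then show ?thesis using True by (simp add: hop_def)
qed (auto simp: hop_def)

lemma cnt_hop_le: "1 \<le> i \<Longrightarrow> cnt (hop i A) c \<le> cnt A c"
  using cnt_hop[of i A c] by linarith

lemma mem_transpose_image:
  "x \<in> Transposition.transpose i j ` A \<longleftrightarrow> Transposition.transpose i j x \<in> A"
  by (metis (no_types, lifting) image_iff transpose_involutory)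

lemma cnt_transpose_image:
  assumes "1 \<le> i"
  shows "cnt (Transposition.transpose i (Suc i) ` A) c
    = (if c = i then cnt A (i - 1) + (if Suc i \<in> A then 1 else 0) else cnt A c)"
  using assms
proof (induction c)
  case (Suc c)
  then show ?case
    by (cases "c = i"; cases i)
       (auto simp: cnt_Suc mem_transpose_image transpose_def split: if_splits)
qed simp

text \<open>At \<open>c = i\<close> the hop leaves the maximum of \<open>cnt A (i - 1)\<close> and
  \<open>cnt A (i + 1) - 1\<close>, which is monotone in the prefix counts, and the count of the
  transposed \<open>B\<close> is at least the same expression for \<open>B\<close>. No other prefix
  count changes.\<close>

lemma cnt_hop_le_transpose:
  assumes "1 \<le> i" and le: "\<And>c. cnt A c \<le> cnt B c"
  shows "cnt (hop i A) c \<le> cnt (Transposition.transpose i (Suc i) ` B) c"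
proof (cases "c = i")
  case True
  obtain j where j: "i = Suc j" using assms(1) by (cases i) auto
  have "cnt (Transposition.transpose i (Suc i) ` B) i = cnt B j + (if Suc i \<in> B then 1 else 0)"
    using cnt_transpose_image[OF assms(1), of B i] j by simp
  moreover have "cnt (hop i A) i + (if i \<in> A \<and> Suc i \<notin> A then 1 else 0)
      = cnt A j + (if i \<in> A then 1 else 0)"
    using cnt_hop[OF assms(1), of A i] by (simp add: j cnt_Suc)
  moreover have "cnt A j \<le> cnt B j" using le .
  moreover have "cnt A j + (if i \<in> A then 1 else 0) + (if Suc i \<in> A then 1 else 0)
      \<le> cnt B j + (if i \<in> B then 1 else 0) + (if Suc i \<in> B then 1 else 0)"
    using le[of "Suc (Suc j)"] by (simp add: j cnt_Suc)
  ultimately show ?thesis unfolding True by (auto split: if_splits)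
next
  case False
  then show ?thesis using cnt_hop[OF assms(1), of A c] le[of c] assms(1)
    by (simp add: cnt_transpose_image)
qed

section \<open>Ordinary products of subwords against the 0-Hecke product of the word\<close>

lemma word_prod_Nil [simp]: "word_prod [] = id"
  by (simp add: word_prod_def)

lemma word_prod_Cons [simp]:
  "word_prod (i # R) = Transposition.transpose i (Suc i) \<circ> word_prod R"
  by (simp add: word_prod_def)

lemma cnt_hops_le:
  assumes "set w \<subseteq> {1..}"
  shows "cnt (foldr hop w A) c \<le> cnt A c"
  using assms
proof (induction w)
  case (Cons i w)
  then have "cnt (hop i (foldr hop w A)) c \<le> cnt (foldr hop w A) c"
    by (intro cnt_hop_le) auto
  then show ?case using Cons by simp
qed simp

text \<open>A letter left out of the subword can only lower the counts on the 0-Hecke side, and a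
  letter kept is handled by \<open>cnt_hop_le_transpose\<close>. So the 0-Hecke result of the whole
  word bounds every subword from below.\<close>

lemma cnt_hops_le_word_prod:
  assumes "subseq R w" "set w \<subseteq> {1..}"
  shows "cnt (foldr hop w A) c \<le> cnt (word_prod R ` A) c"
  using assms
proof (induction arbitrary: c rule: list_emb.induct)
  case (list_emb_Nil ys)
  then show ?case using cnt_hops_le by simp
next
  case (list_emb_Cons xs ys y)
  have "cnt (foldr hop (y # ys) A) c \<le> cnt (foldr hop ys A) c"
    using list_emb_Cons.prems by (simp add: cnt_hop_le)
  also have "\<dots> \<le> cnt (word_prod xs ` A) c" using list_emb_Cons by simp
  finally show ?case .
next
  case (list_emb_Cons2 x y xs ys)
  have "cnt (hop y (foldr hop ys A)) c \<le> cnt (Transposition.transpose y (Suc y) ` word_prod xs ` A) c"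
    using list_emb_Cons2 by (intro cnt_hop_le_transpose) auto
  then show ?case using list_emb_Cons2.hyps by (simp add: image_comp)
qed

text \<open>Each letter of such a word raises the sum of the occupied sites by 1, whereas a letter
  of an arbitrary word raises it by at most 1; so these words are reduced.\<close>

inductive hopping :: "nat \<Rightarrow> nat list \<Rightarrow> nat set \<Rightarrow> bool" for k where
  Nil: "hopping k [] {1..k}"
| Cons: "hopping k R B \<Longrightarrow> 1 \<le> i \<Longrightarrow> i \<in> B \<Longrightarrow> Suc i \<notin> B \<Longrightarrow>
    hopping k (i # R) (insert (Suc i) (B - {i}))"

lemma hopping_Cons':
  assumes "hopping k R (insert i (B - {Suc i}))" "1 \<le> i" "i \<notin> B" "Suc i \<in> B"
  shows "hopping k (i # R) B"
proof -
  have "insert (Suc i) (insert i (B - {Suc i}) - {i}) = B" using assms by auto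
  then show ?thesis using hopping.Cons[OF assms(1,2)] by auto
qed

text \<open>Greedy choice from the front of the word: the letter \<open>i\<close> is skipped when
  the counts produced by the remaining letters already lie below those of \<open>B\<close>.
  Otherwise they are too large at \<open>i\<close> only, which forces \<open>i\<close> vacant and
  \<open>Suc i\<close> occupied in \<open>B\<close>; the letter is used, and the induction continues
  with that particle of \<open>B\<close> moved back.\<close>

lemma hopping_subseq:
  assumes "set w \<subseteq> {1..}" "B \<subseteq> {1..}" "finite B" "card B = k"
    and "\<And>c. cnt (foldr hop w {1..k}) c \<le> cnt B c"
  shows "\<exists>R. subseq R w \<and> hopping k R B"
  using assms
proof (induction w arbitrary: B)
  case Nil
  have "cnt {1..k} k = k" by (simp add: cnt_def)
  then have "k \<le> card (B \<inter> {1..k})" using Nil(5)[of k] by (simp add: cnt_def)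
  moreover have "card (B \<inter> {1..k}) \<le> card B" using Nil by (intro card_mono) auto
  ultimately have "card (B \<inter> {1..k}) = card B" using Nil by simp
  then have "B \<inter> {1..k} = B" "B \<inter> {1..k} = {1..k}"
    using Nil card_subset_eq[of B "B \<inter> {1..k}"] card_subset_eq[of "{1..k}" "B \<inter> {1..k}"] by auto
  then have "B = {1..k}" by simp
  then show ?case using hopping.Nil by auto
next
  case (Cons i w)
  let ?A = "foldr hop w {1..k}"
  have i: "1 \<le> i" using Cons by auto
  obtain j where j: "i = Suc j" using i by (cases i) auto
  have hop: "cnt (hop i ?A) c + (if c = i \<and> i \<in> ?A \<and> Suc i \<notin> ?A then 1 else 0) = cnt ?A c" for c
    using cnt_hop[OF i] .
  have le: "cnt (hop i ?A) c \<le> cnt B c" for c using Cons(6) by simp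
  show ?case
  proof (cases "\<forall>c. cnt ?A c \<le> cnt B c")
    case True
    have "\<exists>R. subseq R w \<and> hopping k R B"
      using Cons.prems True by (intro Cons.IH) simp_all
    then show ?thesis by blast
  next
    case False
    then obtain c where c: "cnt ?A c > cnt B c" by (meson not_le)
    with le[of c] hop[of c] have m: "c = i" "i \<in> ?A" "Suc i \<notin> ?A"
      by (auto split: if_splits)
    have 1: "cnt B i = cnt ?A j" using c le[of i] hop[of i] m by (auto simp: j cnt_Suc split: if_splits)
    have "cnt ?A j \<le> cnt B j" using le[of j] hop[of j] by (auto simp: j)
    then have iB: "i \<notin> B" using 1 by (auto simp: j cnt_Suc split: if_splits)
    have "cnt (hop i ?A) (Suc i) = cnt ?A j + 1" using hop[of "Suc i"] m by (auto simp: j cnt_Suc)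
    then have i1B: "Suc i \<in> B" using le[of "Suc i"] 1 by (auto simp: cnt_Suc split: if_splits)
    let ?B = "insert i (B - {Suc i})"
    have hopB: "hop i ?B = B" using iB i1B by (auto simp: hop_def)
    have "cnt ?A c \<le> cnt ?B c" for c
      using cnt_hop[OF i, of ?B c] le[of c] hop[of c] unfolding hopB by (auto split: if_splits)
    moreover have "card ?B = k" using Cons(5) iB i1B
      by (metis Cons.prems(3) DiffD1 card.insert_remove card_insert_disjoint finite_Diff insert_Diff insert_Diff_single)
    ultimately obtain R where "subseq R w" "hopping k R ?B"
      using Cons.IH[of ?B] Cons.prems i by auto
    then show ?thesis using hopping_Cons'[OF _ i iB i1B] by (intro exI[of _ "i # R"]) auto
  qed
qed

lemma hopping_word:
  assumes "hopping k R B"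
  shows "set R \<subseteq> {1..}" "word_prod R ` {1..k} = B" "strict_mono_on {1..k} (word_prod R)"
    "strict_mono_on {k<..} (word_prod R)" "\<Sum>B = \<Sum>{1..k} + length R"
    "finite B" "B \<subseteq> {1..}" "card B = k"
proof -
  \<comment> \<open>The last conjunct carries the induction: a hop exchanges a value in
    \<open>B\<close> with a value outside, hence never two values of the same block, and both blocks
    stay increasing.\<close>
  have "set R \<subseteq> {1..} \<and> word_prod R ` {1..k} = B \<and> strict_mono_on {1..k} (word_prod R) \<and>
    strict_mono_on {k<..} (word_prod R) \<and> \<Sum>B = \<Sum>{1..k} + length R \<and> finite B \<and> B \<subseteq> {1..} \<and> card B = k
    \<and> word_prod R ` {k<..} \<inter> B = {}"
    using assms
  proof (induction rule: hopping.induct)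
    case Nil
    then show ?case by (auto simp: strict_mono_on_def)
  next
    case (Cons R B i)
    let ?s = "Transposition.transpose i (Suc i)"
    have im: "?s ` B = insert (Suc i) (B - {i})"
    proof (rule Set.set_eqI)
      fix x show "x \<in> ?s ` B \<longleftrightarrow> x \<in> insert (Suc i) (B - {i})"
        using Cons by (auto simp: mem_transpose_image transpose_def)
    qed
    have mono: "strict_mono_on S (?s \<circ> word_prod R)"
      if "strict_mono_on S (word_prod R)" "\<not> (i \<in> word_prod R ` S \<and> Suc i \<in> word_prod R ` S)" for S
    proof (rule strict_mono_onI)
      fix x y assume xy: "x \<in> S" "y \<in> S" "x < y"
      then have "word_prod R x < word_prod R y" using that(1) by (auto dest: strict_mono_onD)
      moreover have "\<not> (word_prod R x = i \<and> word_prod R y = Suc i)" using that(2) xy by (metis imageI)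
      ultimately show "(?s \<circ> word_prod R) x < (?s \<circ> word_prod R) y"
        by (auto simp: transpose_def)
    qed
    have "\<Sum>B = i + \<Sum>(B - {i})" using Cons.IH Cons.hyps by (intro sum.remove) auto
    then have sm: "\<Sum>(insert (Suc i) (B - {i})) = \<Sum>{1..k} + length (i # R)"
      using Cons by simp
    have disj: "?s ` word_prod R ` {k<..} \<inter> ?s ` B = {}"
      using Cons.IH by (metis image_Int inj_swap image_empty inj_transpose)
    have card: "card (insert (Suc i) (B - {i})) = k"
      using Cons im by (metis card_image inj_on_subset inj_transpose subset_UNIV)
    have m: "strict_mono_on {1..k} (?s \<circ> word_prod R)" "strict_mono_on {k<..} (?s \<circ> word_prod R)"
      using Cons by (intro mono; blast)+
    have im1: "(?s \<circ> word_prod R) ` {1..k} = insert (Suc i) (B - {i})"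
      using Cons.IH im by (metis image_comp)
    have dj: "(?s \<circ> word_prod R) ` {k<..} \<inter> insert (Suc i) (B - {i}) = {}"
      using disj im by (metis image_comp)
    show ?case unfolding word_prod_Cons
      by (intro conjI m im1 dj sm card) (use Cons in auto)
  qed
  then show "set R \<subseteq> {1..}" "word_prod R ` {1..k} = B" "strict_mono_on {1..k} (word_prod R)"
    "strict_mono_on {k<..} (word_prod R)" "\<Sum>B = \<Sum>{1..k} + length R"
    "finite B" "B \<subseteq> {1..}" "card B = k" by auto
qed

text \<open>Induction on the sum of the sites: a particle with a vacant positive site just before it
  is moved back, and when there is none \<open>B\<close> is the initial segment
  \<open>{1..k}\<close>.\<close>

lemma hopping_exists:
  assumes "finite B" "B \<subseteq> {1..}" "card B = k"
  shows "\<exists>R. hopping k R B"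
  using assms
proof (induction "\<Sum>B" arbitrary: B rule: less_induct)
  case less
  show ?case
  proof (cases "\<exists>i\<ge>1. i \<notin> B \<and> Suc i \<in> B")
    case True
    then obtain i where i: "i \<ge> 1" "i \<notin> B" "Suc i \<in> B" by auto
    let ?B = "insert i (B - {Suc i})"
    have "card ?B = k" using less i
      by (metis DiffD1 card.insert_remove card_insert_disjoint finite_Diff insert_Diff insert_Diff_single)
    moreover have "\<Sum>B = (Suc i) + \<Sum>(B - {Suc i})" using less i by (intro sum.remove) auto
    then have "\<Sum>?B < \<Sum>B" using less i by simp
    ultimately obtain R where "hopping k R ?B" using less(1)[of ?B] less(2,3) i by auto
    then show ?thesis using hopping_Cons' i by blast
  next
    case False
    have down: "j \<in> B" if "b \<in> B" "1 \<le> j" "j \<le> b" for b j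
      using that(3,1,2)
    proof (induction j rule: inc_induct)
      case (step m)
      then show ?case using False by (metis Suc_leI le_Suc_eq)
    qed
    have "B = {1..k}"
    proof (cases "B = {}")
      case True
      then show ?thesis using less by simp
    next
      case ne: False
      have "B = {1..Max B}" using down[of "Max B"] Max_in[OF less(2) ne] less(2,3) by auto
      then show ?thesis using less(4) by (metis card_atLeastAtMost diff_Suc_1)
    qed
    then show ?thesis using hopping.Nil by auto
  qed
qed

lemma bij_word_prod: "bij (word_prod R)"
proof (induction R)
  case (Cons i R)
  then show ?case unfolding word_prod_Cons by (intro bij_comp) auto
qed (simp only: word_prod_Nil bij_id)

lemma word_prod_permutes:
  assumes "set R \<subseteq> {1..m}"
  shows "word_prod R permutes {1..m + 1}"
  using assms
proof (induction R)
  case (Cons i R)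
  then have "Transposition.transpose i (Suc i) permutes {1..m + 1}"
    by (intro permutes_swap_id) auto
  then show ?case using Cons by (auto intro: permutes_compose simp del: o_apply)
qed (auto simp: permutes_id[unfolded id_def] id_def)

lemma sum_word_prod_image_le:
  assumes "finite A"
  shows "\<Sum>(word_prod R ` A) \<le> \<Sum>A + length R"
proof (induction R)
  case (Cons i R)
  let ?s = "Transposition.transpose i (Suc i)" and ?B = "word_prod R ` A"
  have fin: "finite ?B" using assms by simp
  have "\<Sum>(?s ` ?B) = (\<Sum>x\<in>?B. ?s x)"
    by (subst sum.reindex) (auto intro: inj_on_subset[OF inj_transpose])
  also have "\<dots> \<le> (\<Sum>x\<in>?B. x + (if x = i then 1 else 0))"
    by (intro sum_mono) (auto simp: transpose_def)
  also have "\<dots> \<le> \<Sum>?B + 1"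
    using fin by (simp add: sum.distrib)
  finally show ?case using Cons by (simp add: image_comp)
qed simp

lemma hopping_reduced_expression:
  assumes "hopping k R B"
  shows "reduced_expression R (word_prod R)"
  unfolding reduced_expression_def
proof (intro conjI allI impI)
  fix R' assume R': "set R' \<subseteq> {1..} \<and> word_prod R' = word_prod R"
  have "\<Sum>{1..k} + length R = \<Sum>(word_prod R' ` {1..k})"
    using hopping_word[OF assms] R' by simp
  also have "\<dots> \<le> \<Sum>{1..k} + length R'" by (rule sum_word_prod_image_le) simp
  finally show "length R \<le> length R'" by simp
qed (use hopping_word[OF assms] in auto)

text \<open>At the first disagreement the smaller value must be attained by the other function at an
  earlier point, where both functions agree; strict monotonicity excludes this.\<close>

lemma strict_mono_on_image_eq:
  fixes f g :: "nat \<Rightarrow> nat"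
  assumes "strict_mono_on S f" "strict_mono_on S g" "f ` S = g ` S" "x \<in> S"
  shows "f x = g x"
  using assms(4)
proof (induction x rule: less_induct)
  case (less x)
  have aux: "\<not> u x < v x" if u: "strict_mono_on S u" and v: "strict_mono_on S v"
    and im: "u ` S = v ` S" and eq: "\<And>y. y < x \<Longrightarrow> y \<in> S \<Longrightarrow> u y = v y" for u v :: "nat \<Rightarrow> nat"
  proof
    assume lt: "u x < v x"
    obtain y where y: "y \<in> S" "u x = v y" using im less(2) by (metis image_iff)
    then have "y < x" using lt v less(2)
      by (metis linorder_less_linear order.asym strict_mono_onD)
    then have "u y = u x" using eq y by simp
    then show False using \<open>y < x\<close> u y(1) less(2) by (metis less_irrefl strict_mono_onD)
  qed
  show ?case using aux[of f g] aux[of g f] assms less by (metis linorder_neqE_nat)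
qed

text \<open>As 0 is fixed, both send the positions above \<open>k\<close> onto the same complement,
  so each block is the increasing enumeration of a known set.\<close>

lemma grassmannian_unique:
  fixes \<rho> \<sigma> :: "nat \<Rightarrow> nat"
  assumes "bij \<rho>" "bij \<sigma>" "\<rho> 0 = 0" "\<sigma> 0 = 0"
    and "strict_mono_on {1..k} \<rho>" "strict_mono_on {1..k} \<sigma>"
    and "strict_mono_on {k<..} \<rho>" "strict_mono_on {k<..} \<sigma>"
    and im: "\<rho> ` {1..k} = \<sigma> ` {1..k}"
  shows "\<rho> = \<sigma>"
proof
  fix x
  have co: "{k<..} = UNIV - {0} - {1..k}"
    by (rule Set.set_eqI) auto
  have "f ` {k<..} = UNIV - {0} - f ` {1..k}" if "bij f" "f 0 = 0" for f :: "nat \<Rightarrow> nat"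
    unfolding co using that
    by (simp add: bij_is_inj bij_is_surj image_set_diff)
  then have im2: "\<rho> ` {k<..} = \<sigma> ` {k<..}" using assms by simp
  consider "x = 0" | "x \<in> {1..k}" | "x \<in> {k<..}" by force
  then show "\<rho> x = \<sigma> x"
  proof cases
    case 2
    show ?thesis by (rule strict_mono_on_image_eq[OF assms(5,6) im 2])
  next
    case 3
    show ?thesis by (rule strict_mono_on_image_eq[OF assms(7,8) im2 3])
  qed (use assms in simp)
qed

section \<open>Longest chains\<close>

text \<open>The length of a longest sequence in \<open>F\<close> within the northwest \<open>p \<times> q\<close> rectangle that
  increases strictly in both coordinates.\<close>

fun lc :: "(nat \<times> nat) set \<Rightarrow> nat \<Rightarrow> nat \<Rightarrow> nat" where
  "lc F 0 q = 0"
| "lc F (Suc p) 0 = 0"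
| "lc F (Suc p) (Suc q) = max (max (lc F p (Suc q)) (lc F (Suc p) q))
     (if (Suc p, Suc q) \<in> F then Suc (lc F p q) else 0)"

lemma lc_0_right [simp]: "lc F p 0 = 0"
  by (cases p) auto

lemma lc_Suc_left_ge: "lc F p q \<le> lc F (Suc p) q"
  by (cases q) auto

lemma lc_Suc_right_ge: "lc F p q \<le> lc F p (Suc q)"
  by (cases p) auto

lemma lc_mono: "p \<le> p' \<Longrightarrow> q \<le> q' \<Longrightarrow> lc F p q \<le> lc F p' q'"
  by (rule order.trans[of _ "lc F p' q"])
     (blast intro: lift_Suc_mono_le[of "\<lambda>p. lc F p q"] lift_Suc_mono_le[of "lc F p'"]
        lc_Suc_left_ge lc_Suc_right_ge)+

lemma lc_Suc_left_le: "lc F (Suc p) q \<le> Suc (lc F p q)"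
proof (induction q)
  case (Suc q)
  then show ?case using lc_Suc_right_ge[of F p q] by simp
qed simp

lemma lc_Suc_right_le: "lc F p (Suc q) \<le> Suc (lc F p q)"
proof (induction p)
  case (Suc p)
  then show ?case using lc_Suc_left_ge[of F p q] by simp
qed simp

lemma lc_cong:
  assumes "F \<inter> {1..p} \<times> {1..q} = G \<inter> {1..p} \<times> {1..q}"
  shows "lc F p q = lc G p q"
  using assms
proof (induction F p q rule: lc.induct)
  case (3 F p q)
  have "(Suc p, Suc q) \<in> F \<longleftrightarrow> (Suc p, Suc q) \<in> G"
    using "3.prems" unfolding set_eq_iff by (auto dest: spec[of _ "Suc p"])
  moreover have "F \<inter> {1..p'} \<times> {1..q'} = G \<inter> {1..p'} \<times> {1..q'}"
    if "p' \<le> Suc p" "q' \<le> Suc q" for p' q'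
  proof -
    have "{1..p'} \<times> {1..q'} \<subseteq> {1..Suc p} \<times> {1..Suc q}" using that by auto
    then show ?thesis using "3.prems" by blast
  qed
  ultimately show ?case using "3.IH" by simp
qed auto

section \<open>Longest chains as index sequences of minors\<close>

lemma index_seq_mono: "index_seq s p a \<Longrightarrow> p \<le> p' \<Longrightarrow> index_seq s p' a"
  by (force simp: index_seq_def)

lemma index_seq_extend:
  assumes "index_seq s p a"
  shows "index_seq (Suc s) (Suc p) (a(s := Suc p))"
proof -
  have lt: "a i < Suc p" "1 \<le> a i" if "i < s" for i using assms that by (force simp: index_seq_def)+
  have "strict_mono_on {..<Suc s} (a(s := Suc p))"
  proof (rule strict_mono_onI)
    fix i j assume ij: "i \<in> {..<Suc s}" "j \<in> {..<Suc s}" "i < j"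
    have "a i < a j" if "j < s" using assms ij that
      by (auto simp: index_seq_def strict_mono_on_def)
    then show "(a(s := Suc p)) i < (a(s := Suc p)) j" using ij lt(1)[of i] by auto
  qed
  then show ?thesis using lt by (fastforce simp: index_seq_def less_Suc_eq)
qed

text \<open>Two branches of the recursion ignore the last row or column, the third appends the
  corner. The chain is returned as a pair of index sequences because it becomes the diagonal of a
  minor.\<close>

lemma lc_chain:
  assumes "s \<le> lc F p q"
  shows "\<exists>a b. index_seq s p a \<and> index_seq s q b \<and> (\<forall>i<s. (a i, b i) \<in> F)"
  using assms
proof (induction F p q arbitrary: s rule: lc.induct)
  case (3 F p q)
  consider "s \<le> lc F p (Suc q)" | "s \<le> lc F (Suc p) q"
    | "(Suc p, Suc q) \<in> F" "s \<le> Suc (lc F p q)"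
    using "3.prems" by (auto simp: le_max_iff_disj split: if_splits)
  then show ?case
  proof cases
    case 1
    then show ?thesis using "3.IH"(1) index_seq_mono[of s p _ "Suc p"] by fastforce
  next
    case 2
    then show ?thesis using "3.IH"(2) index_seq_mono[of s q _ "Suc q"] by fastforce
  next
    case c: 3
    show ?thesis
    proof (cases s)
      case 0
      then show ?thesis by (auto simp: index_seq_def strict_mono_on_def)
    next
      case (Suc t)
      then obtain a b where "index_seq t p a" "index_seq t q b" "\<forall>i<t. (a i, b i) \<in> F"
        using "3.IH"(3)[of t] c by auto
      then have "index_seq s (Suc p) (a(t := Suc p)) \<and> index_seq s (Suc q) (b(t := Suc q)) \<and>
          (\<forall>i<s. ((a(t := Suc p)) i, (b(t := Suc q)) i) \<in> F)"
        using c by (simp add: Suc index_seq_extend less_Suc_eq)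
      then show ?thesis by blast
    qed
  qed
qed (auto simp: index_seq_def strict_mono_on_def)

section \<open>The particle process on a Ferrers shape\<close>

definition ferrers :: "(nat \<times> nat) set \<Rightarrow> bool" where
  "ferrers D \<longleftrightarrow> D \<subseteq> {1..} \<times> {1..} \<and> (\<forall>(p, q)\<in>D. {1..p} \<times> {1..q} \<subseteq> D)"

lemma ferrersD:
  "ferrers D \<Longrightarrow> (p, q) \<in> D \<Longrightarrow> 1 \<le> p' \<Longrightarrow> p' \<le> p \<Longrightarrow> 1 \<le> q' \<Longrightarrow> q' \<le> q \<Longrightarrow> (p', q') \<in> D"
  by (fastforce simp: ferrers_def)

text \<open>The sites are the steps of the boundary path of \<open>D\<close> that starts in the southwest at
  \<open>(k, 0)\<close>; \<open>k - x + y\<close> of them precede the vertex \<open>(x, y)\<close>.\<close>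

definition boundary_count :: "nat \<Rightarrow> (nat \<times> nat) set \<Rightarrow> (nat \<times> nat) set \<Rightarrow> nat set \<Rightarrow> bool" where
  "boundary_count k F D A \<longleftrightarrow> (\<forall>x y. x \<le> k \<and> (x = 0 \<or> y = 0 \<or> (x, y) \<in> D) \<and>
     (Suc x, Suc y) \<notin> D \<longrightarrow> cnt A (k - x + y) = k - x + lc F x y)"

text \<open>The path of the empty shape goes north from \<open>(k, 0)\<close> to the origin and then
  east; the particles are its north steps.\<close>

lemma boundary_count_empty: "boundary_count k F {} {1..k}"
proof -
  have "cnt {1..k} (k + y) = k" for y by (subst cnt_eq_card) auto
  moreover have "cnt {1..k} (k - x) = k - x" for x
  proof -
    have "{1..k} \<inter> {1..k - x} = {1..k - x}" by auto
    then show ?thesis by (simp add: cnt_def)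
  qed
  ultimately show ?thesis by (auto simp: boundary_count_def)
qed

text \<open>The new box moves one vertex of the path from \<open>(x, y)\<close> to
  \<open>(Suc x, Suc y)\<close>. Both have the same site index, so a single prefix count changes. A
  hop replaces it by the larger of the previous count and the next count minus 1, which is the
  recursion of \<open>lc\<close> for a box outside \<open>F\<close>; without a hop it stays, which
  is the recursion for a box in \<open>F\<close>.\<close>

lemma boundary_count_insert:
  assumes inv: "boundary_count k F D A" and D: "ferrers D" and D': "ferrers (insert (Suc x, Suc y) D)"
    and new: "(Suc x, Suc y) \<notin> D" and k: "Suc x \<le> k"
    and A': "A' = (if (Suc x, Suc y) \<in> F then A else hop (k - x + y) A)"
  shows "boundary_count k F (insert (Suc x, Suc y) D) A'"
proof -
  define c where "c = k - Suc x + y"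
  have c: "k - x + y = Suc c" using k by (simp add: c_def)
  have in_D: "(x', y') \<in> D" if "1 \<le> x'" "x' \<le> Suc x" "1 \<le> y'" "y' \<le> Suc y" "(x', y') \<noteq> (Suc x, Suc y)" for x' y'
    using ferrersD[OF D', of "Suc x" "Suc y" x' y'] that by auto
  have out_D: "(x', y') \<notin> D" if "Suc x \<le> x'" "Suc y \<le> y'" for x' y'
    using ferrersD[OF D, of x' y' "Suc x" "Suc y"] that new by auto
  let ?m = "lc F x y"
  have inv': "cnt A (k - x' + y') = k - x' + lc F x' y'"
    if "x' \<le> k" "x' = 0 \<or> y' = 0 \<or> (x', y') \<in> D" "(Suc x', Suc y') \<notin> D" for x' y'
    using inv that by (auto simp: boundary_count_def)
  \<comment> \<open>The northwest, northeast and southwest corners of the new box are vertices of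
    the old path.\<close>
  have cond: "x = 0 \<or> y = 0 \<or> (x, y) \<in> D" "x = 0 \<or> (x, Suc y) \<in> D" "y = 0 \<or> (Suc x, y) \<in> D"
    using in_D[of x y] in_D[of x "Suc y"] in_D[of "Suc x" y] by (auto simp: Suc_le_eq)
  have n0: "cnt A (Suc c) = k - x + ?m"
    using inv'[of x y] cond new k c by simp
  have n1: "cnt A (Suc (Suc c)) = k - x + lc F x (Suc y)"
    using inv'[of x "Suc y"] cond out_D[of "Suc x" "Suc (Suc y)"] k c by simp
  have n2: "cnt A c = k - Suc x + lc F (Suc x) y"
    using inv'[of "Suc x" y] cond out_D[of "Suc (Suc x)" "Suc y"] k unfolding c_def by simp
  have s0: "cnt A (Suc c) = cnt A c + (if Suc c \<in> A then 1 else 0)" by (rule cnt_Suc)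
  have s1: "cnt A (Suc (Suc c)) = cnt A (Suc c) + (if Suc (Suc c) \<in> A then 1 else 0)" by (rule cnt_Suc)
  have h: "cnt (hop (Suc c) A) d + (if d = Suc c \<and> Suc c \<in> A \<and> Suc (Suc c) \<notin> A then 1 else 0) = cnt A d" for d
    by (rule cnt_hop) simp
  have kx: "k - x = Suc (k - Suc x)" using k by simp
  have l: "?m \<le> lc F (Suc x) y" "lc F (Suc x) y \<le> Suc ?m" "?m \<le> lc F x (Suc y)" "lc F x (Suc y) \<le> Suc ?m"
    by (rule lc_Suc_left_ge lc_Suc_left_le lc_Suc_right_ge lc_Suc_right_le)+
  have main: "cnt A' (Suc c) = k - Suc x + lc F (Suc x) (Suc y)"
  proof (cases "(Suc x, Suc y) \<in> F")
    case True
    \<comment> \<open>Both neighbouring values exceed \<open>?m\<close> by at most 1, so the corner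
      attains the maximum.\<close>
    then have "lc F (Suc x) (Suc y) = Suc ?m" using l by simp
    then show ?thesis using True n0 kx A' by simp
  next
    case False
    then have L: "lc F (Suc x) (Suc y) = max (lc F x (Suc y)) (lc F (Suc x) y)" by simp
    have "A' = hop (Suc c) A" using A' False c by simp
    then show ?thesis using h[of "Suc c"] s0 s1 l unfolding n0 n1 n2 L kx
      by (auto split: if_splits)
  qed
  have other: "cnt A' d = cnt A d" if "d \<noteq> Suc c" for d
    using h[of d] that A' c by auto
  show ?thesis unfolding boundary_count_def
  proof (intro allI impI)
    fix x' y'
    assume v: "x' \<le> k \<and> (x' = 0 \<or> y' = 0 \<or> (x', y') \<in> insert (Suc x, Suc y) D) \<and>
      (Suc x', Suc y') \<notin> insert (Suc x, Suc y) D"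
    show "cnt A' (k - x' + y') = k - x' + lc F x' y'"
    proof (cases "(x', y') = (Suc x, Suc y)")
      case True
      then show ?thesis using main c k by (simp add: c_def)
    next
      case ne: False
      \<comment> \<open>A vertex with this site index lies on the diagonal through
        \<open>(x, y)\<close>: weakly northwest of \<open>(x, y)\<close> its next box is in the new
        shape, and further southeast it is outside the shape.\<close>
      have "k - x' + y' \<noteq> Suc c"
      proof
        assume "k - x' + y' = Suc c"
        then have d: "x + y' = x' + y" using v k unfolding c_def by linarith
        show False
        proof (cases "x' \<le> x")
          case True
          then show ?thesis using v d in_D[of "Suc x'" "Suc y'"] by auto
        next
          case False
          then have "Suc x \<le> x'" "Suc y \<le> y'" using d by auto
          then show ?thesis using v ne out_D by auto
        qed
      qed
      then show ?thesis using other inv'[of x' y'] v ne by auto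
    qed
  qed
qed

text \<open>\<open>foldr\<close> applies the last letter first, so the boxes are added from the end
  of \<open>L\<close>. The order condition says that no box precedes one weakly southeast of it;
  hence every suffix of \<open>L\<close> is again a Ferrers shape.\<close>

lemma boundary_count_foldr:
  assumes "ferrers (set L)" "sorted_wrt (\<lambda>(p, q) (p', q'). \<not> (p \<le> p' \<and> q \<le> q')) L"
    and "fst ` set L \<subseteq> {..k}"
  shows "boundary_count k F (set L)
    (foldr hop (map (\<lambda>(p, q). k - p + q) (filter (\<lambda>b. b \<notin> F) L)) {1..k})"
  using assms
proof (induction L)
  case Nil
  then show ?case using boundary_count_empty by simp
next
  case (Cons b L)
  obtain p q where b: "b = (p, q)" by (cases b)
  have "p \<ge> 1" "q \<ge> 1" using Cons.prems(1) by (auto simp: ferrers_def b)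
  then obtain x y where xy: "p = Suc x" "q = Suc y" by (metis not0_implies_Suc not_one_le_zero)
  have nle: "\<not> (p \<le> p' \<and> q \<le> q')" if "(p', q') \<in> set L" for p' q'
    using Cons.prems(2) that by (auto simp: b)
  then have new: "(Suc x, Suc y) \<notin> set L" by (auto simp: xy)
  have "(p2, q2) \<in> set L"
    if "(p1, q1) \<in> set L" "1 \<le> p2" "p2 \<le> p1" "1 \<le> q2" "q2 \<le> q1" for p1 q1 p2 q2
    using ferrersD[OF Cons.prems(1), of p1 q1 p2 q2] nle[of p1 q1] that by (auto simp: b)
  moreover have "set L \<subseteq> {1..} \<times> {1..}" using Cons.prems(1) by (auto simp: ferrers_def)
  ultimately have fL: "ferrers (set L)" by (auto simp: ferrers_def)
  let ?A = "foldr hop (map (\<lambda>(p, q). k - p + q) (filter (\<lambda>b. b \<notin> F) L)) {1..k}"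
  have IH: "boundary_count k F (set L) ?A" using Cons fL by auto
  have k: "Suc x \<le> k" using Cons.prems(3) by (auto simp: b xy)
  have "foldr hop (map (\<lambda>(p, q). k - p + q) (filter (\<lambda>b. b \<notin> F) (b # L))) {1..k}
      = (if (Suc x, Suc y) \<in> F then ?A else hop (k - x + y) ?A)"
    using k by (auto simp: b xy Suc_diff_Suc)
  from boundary_count_insert[OF IH fL _ new k this] show ?case
    using Cons.prems(1) by (simp add: b xy)
qed

lemma reading_order:
  fixes f :: "nat \<Rightarrow> nat"
  defines "L k \<equiv> [(p, q). p \<leftarrow> rev [1..<k + 1], q \<leftarrow> rev [1..<f p + 1]]"
  shows "set (L k) = {(p, q). p \<in> {1..k} \<and> q \<in> {1..f p}}"
    and "sorted_wrt (\<lambda>(p, q) (p', q'). \<not> (p \<le> p' \<and> q \<le> q')) (L k)"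
proof -
  show set: "set (L k) = {(p, q). p \<in> {1..k} \<and> q \<in> {1..f p}}" for k
    by (auto simp: L_def image_iff)
  have row: "sorted_wrt (\<lambda>(p, q) (p', q'). \<not> (p \<le> p' \<and> q \<le> q')) (map (Pair p) (rev [1..<m + 1]))" for p m :: nat
    by (induction m) (auto simp: sorted_wrt_append)
  show "sorted_wrt (\<lambda>(p, q) (p', q'). \<not> (p \<le> p' \<and> q \<le> q')) (L k)"
  proof (induction k)
    case (Suc k)
    have "L (Suc k) = map (Pair (Suc k)) (rev [1..<f (Suc k) + 1]) @ L k" by (simp add: L_def)
    then show ?case using Suc row[of "Suc k" "f (Suc k)"] set[of k] by (auto simp: sorted_wrt_append)
  qed (simp add: L_def)
qed

section \<open>Essential sets\<close>

text \<open>Inversion transposes the picture; statements about columns are obtained from those about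
  rows in this way.\<close>

lemma bij_diagram_inv:
  assumes "bij \<pi>"
  shows "(q, p) \<in> diagram (inv_into UNIV \<pi>) \<longleftrightarrow> (p, q) \<in> diagram \<pi>"
  using assms by (auto simp: diagram_def inv_inv_eq)

lemma bij_ess_inv:
  assumes "bij \<pi>"
  shows "(q, p) \<in> ess (inv_into UNIV \<pi>) \<longleftrightarrow> (p, q) \<in> ess \<pi>"
  using bij_diagram_inv[OF assms] by (auto simp: ess_def)

lemma rank_fn_row: "rank_fn \<pi> p q + card {i \<in> {1..p}. q < \<pi> i} = p"
proof -
  have "card {i \<in> {1..p}. \<pi> i \<le> q} + card {i \<in> {1..p}. q < \<pi> i}
      = card ({i \<in> {1..p}. \<pi> i \<le> q} \<union> {i \<in> {1..p}. q < \<pi> i})"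
    by (rule card_Un_disjoint[symmetric]) auto
  also have "{i \<in> {1..p}. \<pi> i \<le> q} \<union> {i \<in> {1..p}. q < \<pi> i} = {1..p}" by auto
  finally show ?thesis by (simp add: rank_fn_def)
qed

lemma rank_fn_inv:
  assumes "bij \<pi>" "\<pi> 0 = 0"
  shows "rank_fn (inv_into UNIV \<pi>) q p = rank_fn \<pi> p q"
proof -
  have [simp]: "inv_into UNIV \<pi> (\<pi> i) = i" "\<pi> (inv_into UNIV \<pi> i) = i" for i
    using assms(1) by (simp_all add: bij_is_inj bij_is_surj surj_f_inv_f)
  have pos: "1 \<le> \<pi> i \<longleftrightarrow> 1 \<le> i" for i
    using assms(2) by (metis \<open>\<And>i. inv_into UNIV \<pi> (\<pi> i) = i\<close> less_one not_le)
  have "bij_betw \<pi> {i \<in> {1..p}. \<pi> i \<le> q} {j \<in> {1..q}. inv_into UNIV \<pi> j \<le> p}"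
  proof (rule bij_betwI[where g = "inv_into UNIV \<pi>"])
    show "inv_into UNIV \<pi> \<in> {j \<in> {1..q}. inv_into UNIV \<pi> j \<le> p} \<rightarrow> {i \<in> {1..p}. \<pi> i \<le> q}"
      using pos[of "inv_into UNIV \<pi> _"] by auto
  qed (use pos in auto)
  then show ?thesis by (simp add: rank_fn_def bij_betw_same_card)
qed

lemma ess_diagram: "(p, q) \<in> ess \<pi> \<Longrightarrow> (p, q) \<in> diagram \<pi>"
  by (simp add: ess_def)

lemma diagram_pos:
  assumes "\<pi> 0 = 0" "(p, q) \<in> diagram \<pi>" "bij \<pi>"
  shows "1 \<le> p" "1 \<le> q"
proof -
  have "inv_into UNIV \<pi> 0 = 0" using assms by (metis bij_inv_eq_iff)
  then show "1 \<le> p" "1 \<le> q" using assms by (auto simp: diagram_def Suc_le_eq intro!: gr0I)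
qed

lemma ess_rank_less:
  assumes "(p, q) \<in> ess \<pi>" "bij \<pi>" "\<pi> 0 = 0"
  shows "rank_fn \<pi> p q < p" "rank_fn \<pi> p q < q"
proof -
  have *: "rank_fn \<sigma> x y < x" if "(x, y) \<in> ess \<sigma>" "1 \<le> x" for \<sigma> x y
  proof -
    have "x \<in> {i \<in> {1..x}. y < \<sigma> i}" using that by (auto simp: ess_def diagram_def)
    then have "card {i \<in> {1..x}. y < \<sigma> i} > 0" by (auto simp: card_gt_0_iff)
    then show ?thesis using rank_fn_row[of \<sigma> x y] by linarith
  qed
  have pos: "1 \<le> p" "1 \<le> q" using diagram_pos[OF assms(3) ess_diagram[OF assms(1)] assms(2)] by auto
  show "rank_fn \<pi> p q < p" using *[OF assms(1) pos(1)] .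
  show "rank_fn \<pi> p q < q" using *[of q p "inv_into UNIV \<pi>"] assms pos
    by (simp add: bij_ess_inv rank_fn_inv)
qed

lemma ess_corank_less:
  assumes e: "(p, q) \<in> ess \<pi>" and e': "(p', q') \<in> ess \<pi>" and ne: "(p, q) \<noteq> (p', q')"
    and le: "p' \<le> p" "q \<le> q'" and bij: "bij \<pi>" and 0: "\<pi> 0 = 0"
  shows "card {i \<in> {1..p'}. q' < \<pi> i} < card {i \<in> {1..p}. q < \<pi> i}"
proof (rule psubset_card_mono)
  show "finite {i \<in> {1..p}. q < \<pi> i}" by simp
  have "1 \<le> p" using diagram_pos[OF 0 ess_diagram[OF e] bij] by simp
  \<comment> \<open>The witness is row \<open>p\<close> if \<open>p' < p\<close>. In a common row it
    is the row of the value \<open>q + 1\<close>, which is among the first \<open>p\<close> rows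
    because \<open>(p, q + 1)\<close> is not in the diagram.\<close>
  have "\<exists>i\<in>{1..p}. q < \<pi> i \<and> \<not> (i \<le> p' \<and> q' < \<pi> i)"
  proof (cases "p' = p")
    case False
    then show ?thesis using e le \<open>1 \<le> p\<close> by (intro bexI[of _ p]) (auto simp: ess_def diagram_def)
  next
    case True
    then have "q < q'" using ne le by auto
    then have "\<pi> p > q + 1" using e' True by (auto simp: ess_def diagram_def)
    then have "inv_into UNIV \<pi> (q + 1) \<le> p" using e by (auto simp: ess_def diagram_def)
    moreover have f: "\<pi> (inv_into UNIV \<pi> (q + 1)) = q + 1" using bij by (simp add: bij_is_surj surj_f_inv_f)
    moreover have "inv_into UNIV \<pi> (q + 1) \<noteq> 0"
    proof
      assume "inv_into UNIV \<pi> (q + 1) = 0"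
      then show False using f 0 by simp
    qed
    ultimately show ?thesis using \<open>q < q'\<close> by (intro bexI[of _ "inv_into UNIV \<pi> (q + 1)"]) auto
  qed
  then obtain i where "i \<in> {1..p}" "q < \<pi> i" "\<not> (i \<le> p' \<and> q' < \<pi> i)" by blast
  then have "i \<in> {i \<in> {1..p}. q < \<pi> i}" "i \<notin> {i \<in> {1..p'}. q' < \<pi> i}" by simp_all
  moreover have "{i \<in> {1..p'}. q' < \<pi> i} \<subseteq> {i \<in> {1..p}. q < \<pi> i}" using le by auto
  ultimately show "{i \<in> {1..p'}. q' < \<pi> i} \<subset> {i \<in> {1..p}. q < \<pi> i}" by blast
qed

text \<open>With \<open>r\<close> the rank at \<open>(p, q)\<close>, the Grassmannian permutation
  will have \<open>k - p + r\<close> occupied and \<open>q - r\<close> vacant sites up to the site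
  of this box. Both numbers grow strictly from southwest to northeast.\<close>

lemma ess_ranks_strict:
  assumes e: "(p, q) \<in> ess \<pi>" and e': "(p', q') \<in> ess \<pi>" and ne: "(p, q) \<noteq> (p', q')"
    and le: "p' \<le> p" "q \<le> q'" and bij: "bij \<pi>" and 0: "\<pi> 0 = 0"
  shows "p' + rank_fn \<pi> p q < p + rank_fn \<pi> p' q'"
    and "q + rank_fn \<pi> p' q' < q' + rank_fn \<pi> p q"
proof -
  show "p' + rank_fn \<pi> p q < p + rank_fn \<pi> p' q'"
    using ess_corank_less[OF assms] rank_fn_row[of \<pi> p q] rank_fn_row[of \<pi> p' q'] by linarith
  have "inv_into UNIV \<pi> 0 = 0" using bij 0 by (metis bij_inv_eq_iff)
  then have "card {i \<in> {1..q}. p < inv_into UNIV \<pi> i} < card {i \<in> {1..q'}. p' < inv_into UNIV \<pi> i}"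
    using assms by (intro ess_corank_less) (auto simp: bij_ess_inv bij_imp_bij_inv)
  then show "q + rank_fn \<pi> p' q' < q' + rank_fn \<pi> p q"
    using rank_fn_row[of "inv_into UNIV \<pi>" q p] rank_fn_row[of "inv_into UNIV \<pi>" q' p'] rank_fn_inv[OF bij 0] by simp
qed

text \<open>Two such boxes give the forbidden pattern at the position of \<open>q + 1\<close>, at
  \<open>p + 1\<close>, at \<open>p'\<close> and at the position of \<open>q'\<close>. The first is
  at most \<open>p\<close>, and \<open>\<pi> (p + 1)\<close> is at most \<open>q\<close>, because
  the neighbours of \<open>(p, q)\<close> are outside the diagram.\<close>

lemma vexillary_ess:
  assumes "vexillary \<pi>" "bij \<pi>" "(p, q) \<in> ess \<pi>" "(p', q') \<in> ess \<pi>"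
  shows "\<not> (p < p' \<and> q < q')"
proof
  assume lt: "p < p' \<and> q < q'"
  have inv: "\<pi> (inv_into UNIV \<pi> i) = i" "inv_into UNIV \<pi> (\<pi> i) = i" for i
    using assms(2) by (simp_all add: bij_is_surj surj_f_inv_f bij_is_inj)
  have d: "\<pi> p > q" "inv_into UNIV \<pi> q > p" "\<pi> p' > q'" "inv_into UNIV \<pi> q' > p'"
    using assms(3,4) by (auto simp: ess_def diagram_def)
  have b: "\<pi> (p + 1) \<le> q"
  proof (cases "inv_into UNIV \<pi> q = p + 1")
    case True
    then show ?thesis using inv(1)[of q] by simp
  next
    case False
    then show ?thesis using assms(3) d by (auto simp: ess_def diagram_def)
  qed
  have a: "inv_into UNIV \<pi> (q + 1) \<le> p"
  proof (cases "\<pi> p = q + 1")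
    case True
    then show ?thesis using inv(2)[of p] by simp
  next
    case False
    then show ?thesis using assms(3) d by (auto simp: ess_def diagram_def)
  qed
  have "inv_into UNIV \<pi> (q + 1) \<noteq> inv_into UNIV \<pi> q'" using a d lt by linarith
  then have "q + 1 < q'" using lt by (metis Suc_eq_plus1 Suc_leI nat_less_le)
  moreover have "p + 1 \<noteq> p'" using b d lt by auto
  ultimately have "inv_into UNIV \<pi> (q + 1) < p + 1 \<and> p + 1 < p' \<and> p' < inv_into UNIV \<pi> q' \<and>
      \<pi> (p + 1) < \<pi> (inv_into UNIV \<pi> (q + 1)) \<and> \<pi> (inv_into UNIV \<pi> (q + 1)) < \<pi> (inv_into UNIV \<pi> q') \<and>
      \<pi> (inv_into UNIV \<pi> q') < \<pi> p'"
    using a b d lt by (simp add: inv)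
  then show False using assms(1) unfolding vexillary_def by blast
qed

section \<open>Extent of the diagram\<close>

lemma finite_descents:
  assumes "\<pi> permutes {1..n}"
  shows "finite (descents \<pi>)"
proof (rule finite_subset)
  show "descents \<pi> \<subseteq> {..n}"
    using permutes_not_in[OF assms] by (auto simp: descents_def) (metis Suc_leD atLeastAtMost_iff lessI not_le order.asym)
qed simp

lemma diagram_le_last_descent:
  assumes "\<pi> permutes {1..n}" "(p, q) \<in> diagram \<pi>"
  shows "p \<le> last_descent \<pi>"
proof (rule ccontr)
  assume "\<not> p \<le> last_descent \<pi>"
  have nd: "i \<notin> descents \<pi>" if "p \<le> i" for i
  proof
    assume "i \<in> descents \<pi>"
    then have "i \<le> last_descent \<pi>"
      unfolding last_descent_def using finite_descents[OF assms(1)] by (intro Max_ge) auto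
    then show False using \<open>\<not> p \<le> last_descent \<pi>\<close> that by simp
  qed
  have step: "\<pi> i \<le> \<pi> (Suc i)" if "p \<le> i" for i using nd[OF that] by (simp add: descents_def)
  have "\<pi> p \<le> \<pi> i" if "p \<le> i" for i
    using that by (induction i rule: dec_induct) (auto intro: order.trans step)
  then have "\<pi> p \<le> \<pi> (inv_into UNIV \<pi> q)" using assms(2) by (auto simp: diagram_def)
  also have "\<pi> (inv_into UNIV \<pi> q) = q" using assms(1) by (simp add: permutes_inverses)
  finally show False using assms(2) by (auto simp: diagram_def)
qed

lemma diagram_subset:
  assumes "\<pi> permutes {1..n}"
  shows "diagram \<pi> \<subseteq> {1..n} \<times> {1..n}"
proof -
  have 0: "\<pi> 0 = 0" using assms by (simp add: permutes_not_in)
  have row: "p \<le> n" if "\<sigma> permutes {1..n}" "(p, q) \<in> diagram \<sigma>" for \<sigma> p q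
  proof (rule ccontr)
    assume "\<not> p \<le> n"
    then have "\<sigma> p = p" using that(1) by (simp add: permutes_not_in)
    then have "q < p" "p < inv_into UNIV \<sigma> q" using that(2) by (auto simp: diagram_def)
    have "inv_into UNIV \<sigma> q \<notin> {1..n}" using \<open>p < inv_into UNIV \<sigma> q\<close> \<open>\<not> p \<le> n\<close> by auto
    then have fixed: "\<sigma> (inv_into UNIV \<sigma> q) = inv_into UNIV \<sigma> q" by (rule permutes_not_in[OF that(1)])
    have "q = inv_into UNIV \<sigma> q"
      by (rule trans[OF permutes_inverses(1)[OF that(1), symmetric] fixed])
    then show False using \<open>q < p\<close> \<open>p < inv_into UNIV \<sigma> q\<close> by simp
  qed
  have "q \<le> n" if "(p, q) \<in> diagram \<pi>" for p q
    using row[of "inv_into UNIV \<pi>" q p] that bij_diagram_inv[OF permutes_bij[OF assms]] permutes_inv[OF assms] by simp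
  then have "p \<in> {1..n} \<and> q \<in> {1..n}" if "(p, q) \<in> diagram \<pi>" for p q
    using row[OF assms that] diagram_pos[OF 0 that permutes_bij[OF assms]] that by simp
  then show ?thesis by auto
qed

lemma finite_ess: "\<pi> permutes {1..n} \<Longrightarrow> finite (ess \<pi>)"
  using finite_subset[OF diagram_subset[of \<pi> n]] by (auto simp: ess_def intro: finite_subset[of _ "diagram \<pi>"])

text \<open>A descent at \<open>k\<close> puts the box \<open>(k, \<pi> (k + 1))\<close> into the
  diagram, and a box with the largest coordinate sum has no lower or right neighbour. Without
  descents the permutation would be an increasing bijection.\<close>

lemma ess_nonempty:
  assumes "\<pi> permutes {1..n}" "\<pi> \<noteq> id"
  shows "ess \<pi> \<noteq> {}"
proof -
  have "descents \<pi> \<noteq> {}"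
  proof
    assume "descents \<pi> = {}"
    then have "\<pi> i \<le> \<pi> (Suc i)" for i by (auto simp: descents_def set_eq_iff not_less)
    moreover have "\<pi> i \<noteq> \<pi> (Suc i)" for i using permutes_inj[OF assms(1)] by (auto dest: injD)
    ultimately have "\<pi> i < \<pi> (Suc i)" for i by (metis le_neq_implies_less)
    then have "strict_mono_on UNIV \<pi>" by (simp add: strict_mono_Suc_iff)
    then have "\<pi> i = id i" for i
      using permutes_surj[OF assms(1)] by (intro strict_mono_on_image_eq[of UNIV]) (auto simp: strict_mono_on_def)
    then show False using assms(2) by auto
  qed
  then obtain k where "\<pi> (k + 1) < \<pi> k" by (auto simp: descents_def)
  then have "(k, \<pi> (k + 1)) \<in> diagram \<pi>"
    using permutes_inverses(2)[OF assms(1), of "k + 1"] unfolding diagram_def by auto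
  have fin: "finite (diagram \<pi>)" using diagram_subset[OF assms(1)] by (rule finite_subset) simp
  let ?S = "(\<lambda>y. fst y + snd y) ` diagram \<pi>"
  have "Max ?S \<in> ?S"
    using fin \<open>(k, \<pi> (k + 1)) \<in> diagram \<pi>\<close> by (intro Max_in) auto
  then obtain x where x: "x \<in> diagram \<pi>" "fst x + snd x = Max ?S" by auto
  have max: "fst y + snd y \<le> fst x + snd x" if "y \<in> diagram \<pi>" for y
    unfolding x(2) using fin that by (intro Max_ge) auto
  have "(fst x + 1, snd x) \<notin> diagram \<pi>" "(fst x, snd x + 1) \<notin> diagram \<pi>" using max[of "(fst x + 1, snd x)"] max[of "(fst x, snd x + 1)"] by auto
  then have "x \<in> ess \<pi>" using x(1) by (cases x) (simp add: ess_def)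
  then show ?thesis by auto
qed

section \<open>Grassmannian permutations\<close>

lemma rank_fn_eq_cnt:
  assumes "inj \<rho>" "\<rho> 0 = 0"
  shows "rank_fn \<rho> k c = cnt (\<rho> ` {1..k}) c"
proof -
  have "\<rho> i \<noteq> 0" if "i \<in> {1..k}" for i
    using injD[OF assms(1), of i 0] that assms(2) by auto
  then have "\<rho> i \<in> {1..c} \<longleftrightarrow> \<rho> i \<le> c" if "i \<in> {1..k}" for i
    using that by (simp add: Suc_le_eq)
  then have "\<rho> ` {i \<in> {1..k}. \<rho> i \<le> c} = \<rho> ` {1..k} \<inter> {1..c}" by blast
  moreover have "card (\<rho> ` {i \<in> {1..k}. \<rho> i \<le> c}) = card {i \<in> {1..k}. \<rho> i \<le> c}"
    by (rule card_image) (rule inj_on_subset[OF assms(1)], simp)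
  ultimately show ?thesis by (simp add: rank_fn_def cnt_def)
qed

text \<open>At an occupied site \<open>cnt B\<close> rises as fast as possible. At a vacant site it
  is constant up to the end of the gap, where it is controlled by a corner; if the gap never ends,
  it equals \<open>k\<close>.\<close>

lemma cnt_le_at_corners:
  assumes A: "finite A" "card A = k" and B: "finite B" "card B = k" "B \<subseteq> {1..}"
    and le: "\<And>c. 1 \<le> c \<Longrightarrow> c \<notin> B \<Longrightarrow> Suc c \<in> B \<Longrightarrow> cnt A c \<le> cnt B c"
  shows "cnt A c \<le> cnt B c"
proof (induction c)
  case (Suc c)
  show ?case
  proof (cases "Suc c \<in> B")
    case True
    then show ?thesis using Suc by (simp add: cnt_Suc)
  next
    case notin: False
    show ?thesis
    proof (cases "\<exists>e>Suc c. e \<in> B")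
      case False
      then have "x \<le> Suc c" if "x \<in> B" for x using that by (meson not_less)
      then have "B \<subseteq> {1..Suc c}" using B(3) by auto
      then have "cnt B (Suc c) = k" using cnt_eq_card B by metis
      then show ?thesis using cnt_le_card[OF A(1), of "Suc c"] A by simp
    next
      case True
      define e where "e = (LEAST e. e > Suc c \<and> e \<in> B)"
      have e: "e > Suc c" "e \<in> B" using LeastI_ex[OF True] by (auto simp: e_def)
      have gap: "d \<notin> B" if "Suc c \<le> d" "d < e" for d
        using not_less_Least[of d "\<lambda>e. e > Suc c \<and> e \<in> B"] that notin
        by (cases "d = Suc c") (auto simp: e_def)
      obtain f where f: "e = Suc f" using e by (cases e) auto
      have "cnt B f = cnt B (Suc c)"
      proof -
        have "cnt B d = cnt B (Suc c)" if "Suc c \<le> d" "d < e" for d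
          using that
        proof (induction d rule: dec_induct)
          case (step d)
          then have "Suc d \<notin> B" by (intro gap) auto
          then show ?case using step unfolding cnt_Suc[of B d] by simp
        qed simp
        from this[of f] show ?thesis using e f by simp
      qed
      moreover have "cnt A f \<le> cnt B f" using le[of f] gap[of f] e f by simp
      moreover have "cnt A (Suc c) \<le> cnt A f" using e f by (intro cnt_mono) simp
      ultimately show ?thesis by simp
    qed
  qed
qed simp

text \<open>The counting function of \<open>B\<close> is the largest function with increments 0 and 1 that is
  bounded by \<open>k\<close> and by the values prescribed at the corners.\<close>

lemma exists_set_with_corners:
  fixes pos val :: "'e \<Rightarrow> nat"
  assumes fin: "finite E"
    and small: "\<And>e. e \<in> E \<Longrightarrow> val e < pos e" "\<And>e. e \<in> E \<Longrightarrow> val e < k"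
    and sep: "\<And>e e'. e \<in> E \<Longrightarrow> e' \<in> E \<Longrightarrow> pos e < pos e' \<Longrightarrow>
      val e < val e' \<and> val e' + pos e < val e + pos e'"
    and inj: "\<And>e e'. e \<in> E \<Longrightarrow> e' \<in> E \<Longrightarrow> pos e = pos e' \<Longrightarrow> val e = val e'"
  shows "\<exists>B. finite B \<and> B \<subseteq> {1..} \<and> card B = k \<and> (\<forall>e\<in>E. cnt B (pos e) = val e) \<and>
    (\<forall>c\<ge>1. c \<notin> B \<and> Suc c \<in> B \<longleftrightarrow> c \<in> pos ` E)"
proof -
  \<comment> \<open>The difference is natural, so the bound of \<open>e\<close> is constant up to
    \<open>pos e\<close> and has slope 1 afterwards: exactly what a bound at \<open>pos e\<close>
    implies for a counting function at other sites.\<close>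
  define G where "G c = insert c (insert k ((\<lambda>e. val e + (c - pos e)) ` E))" for c
  define N where "N c = Min (G c)" for c
  define B where "B = {Suc c | c. N c < N (Suc c)}"
  have G: "finite (G c)" "G c \<noteq> {}" for c using fin by (auto simp: G_def)
  have ge: "x \<le> N c \<longleftrightarrow> x \<le> c \<and> x \<le> k \<and> (\<forall>e\<in>E. x \<le> val e + (c - pos e))" for x c
    unfolding N_def Min_ge_iff[OF G] by (auto simp: G_def)
  have at: "N c = c \<or> N c = k \<or> (\<exists>e\<in>E. N c = val e + (c - pos e))" for c
    using Min_in[OF G, of c] unfolding N_def[symmetric] by (auto simp: G_def)
  have le: "N c \<le> c" "N c \<le> k" "\<And>e. e \<in> E \<Longrightarrow> N c \<le> val e + (c - pos e)" for c
    using ge[of "N c" c] by auto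
  have mono: "N c \<le> N (Suc c)" for c
  proof -
    have "N c \<le> val e + (Suc c - pos e)" if "e \<in> E" for e using le(3)[OF that, of c] by linarith
    then show ?thesis using le(1,2)[of c] by (subst ge) auto
  qed
  have lip: "N (Suc c) \<le> Suc (N c)" for c
    using at[of c]
  proof (elim disjE bexE)
    fix e assume "e \<in> E" "N c = val e + (c - pos e)"
    then show ?thesis using le(3)[of e "Suc c"] by linarith
  qed (use le(1,2)[of "Suc c"] in auto)
  have mem: "Suc c \<in> B \<longleftrightarrow> N c < N (Suc c)" for c by (auto simp: B_def)
  have cnt: "cnt B c = N c" for c
  proof (induction c)
    case 0
    then show ?case using le(1)[of 0] by simp
  next
    case (Suc c)
    then show ?case using mono[of c] lip[of c] mem[of c] by (auto simp: cnt_Suc)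
  qed
  have large: "N c = k" if "c \<ge> k + \<Sum>(pos ` E)" for c
  proof (rule antisym)
    have "k \<le> val e + (c - pos e)" if "e \<in> E" for e
    proof -
      have "pos e \<le> \<Sum>(pos ` E)" using that fin by (intro member_le_sum) auto
      then show ?thesis using \<open>c \<ge> k + \<Sum>(pos ` E)\<close> by linarith
    qed
    then show "k \<le> N c" using that by (subst ge) auto
  qed (rule le)
  let ?M = "k + \<Sum>(pos ` E)"
  have B: "B \<subseteq> {1..?M}"
  proof
    fix b assume "b \<in> B"
    then obtain c where c: "b = Suc c" "N c < N (Suc c)" by (auto simp: B_def)
    then have "c < ?M" using large[of c] large[of "Suc c"] by (metis le_SucI less_irrefl not_le)
    then show "b \<in> {1..?M}" using c by auto
  qed
  then have finB: "finite B" by (rule finite_subset) simp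
  have cardB: "card B = k" using cnt_eq_card[OF finB B] cnt[of ?M] large[of ?M] by simp
  have N_pos: "N (pos e) = val e" and N_pos1: "N (pos e - 1) = val e" and N_pos2: "N (Suc (pos e)) = Suc (val e)"
    if e: "e \<in> E" for e
  proof -
    \<comment> \<open>By separation, the bound of each corner leaves room for \<open>val e\<close>
      already at \<open>pos e - 1\<close> and for \<open>Suc (val e)\<close> right after
      \<open>pos e\<close>. So \<open>pos e\<close> will be vacant and its successor
      occupied.\<close>
    have cmp: "val e \<le> val d + ((pos e - 1) - pos d) \<and> Suc (val e) \<le> val d + (Suc (pos e) - pos d)"
      if "d \<in> E" for d
      using sep[OF that e] sep[OF e that] inj[OF e that] by (cases "pos d" "pos e" rule: linorder_cases) auto
    have "val e \<le> N (pos e - 1)" using cmp small[OF e] by (subst ge) auto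
    moreover have "N (pos e - 1) \<le> N (pos e)" using mono[of "pos e - 1"] small[OF e] by auto
    moreover have "N (pos e) \<le> val e" using le(3)[OF e, of "pos e"] by simp
    ultimately show N: "N (pos e) = val e" "N (pos e - 1) = val e" by auto
    have "Suc (val e) \<le> N (Suc (pos e))" using cmp small[OF e] by (subst ge) (auto simp: Suc_le_eq)
    then show "N (Suc (pos e)) = Suc (val e)" using lip[of "pos e"] N by simp
  qed
  have "c \<notin> B \<and> Suc c \<in> B \<longleftrightarrow> c \<in> pos ` E" if c1: "1 \<le> c" for c
  proof
    assume "c \<notin> B \<and> Suc c \<in> B"
    moreover obtain b where b: "c = Suc b" using c1 by (cases c) auto
    ultimately have flat: "N b = N c" and step: "N (Suc c) = Suc (N c)"
      using mem[of b] mem[of c] mono[of b] mono[of c] lip[of c] by auto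
    \<comment> \<open>A flat step followed by a rise rules out the bounds \<open>c\<close> and
      \<open>k\<close> as active, and the bound of \<open>e\<close> bends only at
      \<open>pos e\<close>.\<close>
    have "N c \<noteq> c" using le(1)[of b] flat b by simp
    moreover have "N c \<noteq> k" using le(2)[of "Suc c"] step by simp
    ultimately obtain e where e: "e \<in> E" "N c = val e + (c - pos e)" using at[of c] by auto
    then have "c \<le> pos e" using le(3)[OF e(1), of b] flat b by linarith
    moreover have "pos e \<le> c" using le(3)[OF e(1), of "Suc c"] e(2) step by linarith
    ultimately show "c \<in> pos ` E" using e(1) by auto
  next
    assume "c \<in> pos ` E"
    then obtain e where e: "e \<in> E" "c = pos e" by auto
    obtain b where b: "c = Suc b" using c1 by (cases c) auto
    have "N b = val e" using N_pos1[OF e(1)] unfolding e(2)[symmetric] b by simp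
    moreover have "N c = val e" "N (Suc c) = Suc (val e)"
      using N_pos[OF e(1)] N_pos2[OF e(1)] unfolding e(2) by simp_all
    ultimately show "c \<notin> B \<and> Suc c \<in> B" using mem[of b] mem[of c] b by simp
  qed
  moreover have "\<forall>e\<in>E. cnt B (pos e) = val e" using N_pos cnt by simp
  moreover have "B \<subseteq> {1..}" using B by auto
  ultimately show ?thesis using finB cardB by blast
qed

lemma strict_mono_on_sites:
  fixes \<rho> :: "nat \<Rightarrow> nat"
  assumes "inj \<rho>" "\<rho> 0 = 0" "descents \<rho> = {k}"
  shows "strict_mono_on {1..k} \<rho>" "strict_mono_on {k<..} \<rho>"
proof -
  have step: "\<rho> i < \<rho> (Suc i)" if "i \<noteq> k" for i
  proof -
    have "i \<notin> descents \<rho>" using assms(3) that by simp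
    then have "\<rho> i \<le> \<rho> (Suc i)" by (simp add: descents_def not_less)
    then show ?thesis using injD[OF assms(1), of i "Suc i"] by (cases "\<rho> i = \<rho> (Suc i)") auto
  qed
  have lt: "\<rho> i < \<rho> j" if "i < j" "j \<le> k \<or> k < i" for i j
    using that
  proof (induction j)
    case (Suc j)
    then have "j \<noteq> k" by auto
    then show ?case using Suc step[of j] by (cases "i = j") (auto intro: less_trans)
  qed simp
  show "strict_mono_on {1..k} \<rho>" "strict_mono_on {k<..} \<rho>"
    by (auto intro!: strict_mono_onI lt)
qed

text \<open>A column of the diagram is a value taken after position \<open>k\<close>; as the first
  \<open>k\<close> values increase, its boxes continue down to row \<open>k\<close>. There a box
  ends its horizontal run exactly if the next value is among the first \<open>k\<close>.\<close>

lemma grassmannian_ess: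
  assumes bij: "bij \<rho>" and 0: "\<rho> 0 = 0" and k: "1 \<le> k"
    and mono: "strict_mono_on {1..k} \<rho>" "strict_mono_on {k<..} \<rho>"
  shows "ess \<rho> = {(k, c) | c. 1 \<le> c \<and> c \<notin> \<rho> ` {1..k} \<and> Suc c \<in> \<rho> ` {1..k}}"
proof -
  let ?i = "inv_into UNIV \<rho>"
  have inv: "\<rho> (?i x) = x" "?i (\<rho> x) = x" for x
    using bij by (simp_all add: bij_is_surj surj_f_inv_f bij_is_inj)
  have i0: "?i x = 0 \<longleftrightarrow> x = 0" for x using inv 0 by metis
  have img: "x \<in> \<rho> ` {1..k} \<longleftrightarrow> 1 \<le> x \<and> ?i x \<le> k" for x
  proof
    assume "x \<in> \<rho> ` {1..k}"
    then obtain j where "j \<in> {1..k}" "x = \<rho> j" by blast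
    then show "1 \<le> x \<and> ?i x \<le> k" using inv(2)[of j] i0[of x] by (auto simp: Suc_le_eq)
  next
    assume x: "1 \<le> x \<and> ?i x \<le> k"
    then have "?i x \<in> {1..k}" using i0[of x] by (auto simp: Suc_le_eq)
    then show "x \<in> \<rho> ` {1..k}" using inv(1)[of x] by (metis image_eqI)
  qed
  have lo: "\<rho> i < \<rho> j" if "1 \<le> i" "i < j" "j \<le> k" for i j
    using that by (intro strict_mono_onD[OF mono(1)]) auto
  have hi: "\<rho> i < \<rho> j" if "k < i" "i < j" for i j
    using that by (intro strict_mono_onD[OF mono(2)]) auto
  have diag: "(p, q) \<in> diagram \<rho> \<longleftrightarrow> 1 \<le> p \<and> p \<le> k \<and> 1 \<le> q \<and> k < ?i q \<and> q < \<rho> p" for p q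
  proof
    assume d: "(p, q) \<in> diagram \<rho>"
    then have d': "q < \<rho> p" "p < ?i q" by (auto simp: diagram_def)
    have pos: "1 \<le> p" "1 \<le> q" using diagram_pos[OF 0 d bij] .
    have "p \<le> k" using hi[of p "?i q"] d' inv(1)[of q] by (metis not_le order.asym)
    moreover have "k < ?i q" using lo[of p "?i q"] d' inv(1)[of q] pos by (metis not_le order.asym)
    ultimately show "1 \<le> p \<and> p \<le> k \<and> 1 \<le> q \<and> k < ?i q \<and> q < \<rho> p" using d' pos by blast
  qed (auto simp: diagram_def)
  show ?thesis
  proof (intro Set.set_eqI iffI)
    fix x assume x: "x \<in> ess \<rho>"
    obtain p q where pq: "x = (p, q)" by (cases x)
    have d: "1 \<le> p" "p \<le> k" "1 \<le> q" "k < ?i q" "q < \<rho> p"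
      using x diag[of p q] by (auto simp: pq ess_def)
    have n1: "(p + 1, q) \<notin> diagram \<rho>" and n2: "(p, q + 1) \<notin> diagram \<rho>" using x by (auto simp: pq ess_def)
    have pk: "p = k"
    proof (rule ccontr)
      assume "p \<noteq> k"
      then show False using n1 diag[of "p + 1" q] d lo[of p "p + 1"] by auto
    qed
    have "?i (Suc q) \<le> k"
    proof (cases "\<rho> p = Suc q")
      case True
      then show ?thesis using inv(2)[of p] d by simp
    next
      case False
      then show ?thesis using n2 diag[of p "q + 1"] d by auto
    qed
    then show "x \<in> {(k, c) | c. 1 \<le> c \<and> c \<notin> \<rho> ` {1..k} \<and> Suc c \<in> \<rho> ` {1..k}}"
      using d pk img[of q] img[of "Suc q"] unfolding pq by simp
  next
    fix x assume "x \<in> {(k, c) | c. 1 \<le> c \<and> c \<notin> \<rho> ` {1..k} \<and> Suc c \<in> \<rho> ` {1..k}}"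
    then obtain c where c: "x = (k, c)" "1 \<le> c" "k < ?i c" "?i (Suc c) \<le> k"
      unfolding img by auto
    have "Suc c \<le> \<rho> k"
    proof (cases "?i (Suc c) = k")
      case True
      then show ?thesis using inv(1)[of "Suc c"] by simp
    next
      case False
      then have "\<rho> (?i (Suc c)) < \<rho> k" using c i0[of "Suc c"] by (intro lo) (auto simp: Suc_le_eq)
      then show ?thesis using inv(1)[of "Suc c"] by simp
    qed
    then show "x \<in> ess \<rho>" using c k diag by (auto simp: ess_def)
  qed
qed

lemma is_grassmannian_ofD:
  assumes "is_grassmannian_of \<pi> \<rho>"
  shows "bij \<rho>" "\<rho> 0 = 0" "descents \<rho> = {last_descent \<pi>}"
    "ess \<rho> = (\<lambda>(p, q). (last_descent \<pi>, last_descent \<pi> - p + q)) ` ess \<pi>"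
    "(p, q) \<in> ess \<pi> \<Longrightarrow> rank_fn \<rho> (last_descent \<pi>) (last_descent \<pi> - p + q) = last_descent \<pi> - p + rank_fn \<pi> p q"
    "1 \<le> last_descent \<pi>"
proof -
  obtain N where N: "\<rho> permutes {1..N}"
    using assms unfolding is_grassmannian_of_def Let_def by (elim conjE exE)
  show "bij \<rho>" "\<rho> 0 = 0" using N by (simp_all add: permutes_bij permutes_not_in)
  have all: "descents \<rho> = {last_descent \<pi>} \<and>
      ess \<rho> = (\<lambda>(p, q). (last_descent \<pi>, last_descent \<pi> - p + q)) ` ess \<pi> \<and>
      (\<forall>(p, q)\<in>ess \<pi>. rank_fn \<rho> (last_descent \<pi>) (last_descent \<pi> - p + q) = last_descent \<pi> - p + rank_fn \<pi> p q)"
    using assms unfolding is_grassmannian_of_def Let_def by (elim conjE) (intro conjI)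
  from all show d: "descents \<rho> = {last_descent \<pi>}" by (elim conjE)
  from all show "ess \<rho> = (\<lambda>(p, q). (last_descent \<pi>, last_descent \<pi> - p + q)) ` ess \<pi>" by (elim conjE)
  from all show "rank_fn \<rho> (last_descent \<pi>) (last_descent \<pi> - p + q) = last_descent \<pi> - p + rank_fn \<pi> p q"
    if "(p, q) \<in> ess \<pi>" using that by (elim conjE) (drule bspec, assumption, simp)
  have "0 \<notin> descents \<rho>" using \<open>\<rho> 0 = 0\<close> by (simp add: descents_def)
  then show "1 \<le> last_descent \<pi>" unfolding d by (cases "last_descent \<pi>") auto
qed

lemma is_grassmannian_of_corners:
  assumes "is_grassmannian_of \<pi> \<rho>" "1 \<le> c" "c \<notin> \<rho> ` {1..last_descent \<pi>}"
    "Suc c \<in> \<rho> ` {1..last_descent \<pi>}"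
  shows "\<exists>(p, q)\<in>ess \<pi>. c = last_descent \<pi> - p + q"
proof -
  note g = is_grassmannian_ofD[OF assms(1)]
  note mono = strict_mono_on_sites[OF bij_is_inj[OF g(1)] g(2,3)]
  have "(last_descent \<pi>, c) \<in> ess \<rho>"
    unfolding grassmannian_ess[OF g(1,2,6) mono] using assms by blast
  then show ?thesis unfolding g(4) by auto
qed

lemma image_sites:
  fixes \<rho> :: "nat \<Rightarrow> nat"
  assumes "bij \<rho>" "\<rho> 0 = 0"
  shows "finite (\<rho> ` {1..k})" "card (\<rho> ` {1..k}) = k" "\<rho> ` {1..k} \<subseteq> {1..}"
proof -
  show "finite (\<rho> ` {1..k})" by simp
  show "card (\<rho> ` {1..k}) = k"
    using card_image[OF inj_on_subset[OF bij_is_inj[OF assms(1)]], of "{1..k}"] by simp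
  show "\<rho> ` {1..k} \<subseteq> {1..}"
  proof
    fix y assume "y \<in> \<rho> ` {1..k}"
    then obtain i where i: "i \<in> {1..k}" "y = \<rho> i" by blast
    then have "\<rho> i \<noteq> \<rho> 0" using injD[OF bij_is_inj[OF assms(1)], of i 0] by auto
    then have "1 \<le> \<rho> i" using assms(2) by linarith
    then show "y \<in> {1..}" using i by simp
  qed
qed

text \<open>The corners of either value set come from \<open>ess \<pi>\<close>, where the prescribed
  ranks fix the counts, so each counting function bounds the other. The definite description in
  \<open>grassmannian_of\<close> relies on this.\<close>

lemma is_grassmannian_of_unique:
  assumes "is_grassmannian_of \<pi> \<rho>" "is_grassmannian_of \<pi> \<sigma>"
  shows "\<rho> = \<sigma>"
proof -
  let ?k = "last_descent \<pi>"
  note g = is_grassmannian_ofD[OF assms(1)] and h = is_grassmannian_ofD[OF assms(2)]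
  have le: "cnt (\<tau> ` {1..?k}) c \<le> cnt (\<upsilon> ` {1..?k}) c"
    if t: "is_grassmannian_of \<pi> \<tau>" and u: "is_grassmannian_of \<pi> \<upsilon>" for \<tau> \<upsilon> c
  proof (rule cnt_le_at_corners)
    note t' = is_grassmannian_ofD[OF t] and u' = is_grassmannian_ofD[OF u]
    note ts = image_sites[OF t'(1,2)] and us = image_sites[OF u'(1,2)]
    show "finite (\<tau> ` {1..?k})" "card (\<tau> ` {1..?k}) = ?k" by (rule ts)+
    show "finite (\<upsilon> ` {1..?k})" "card (\<upsilon> ` {1..?k}) = ?k" "\<upsilon> ` {1..?k} \<subseteq> {1..}" by (rule us)+
    fix c assume "1 \<le> c" "c \<notin> \<upsilon> ` {1..?k}" "Suc c \<in> \<upsilon> ` {1..?k}"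
    then obtain p q where pq: "(p, q) \<in> ess \<pi>" "c = ?k - p + q"
      using is_grassmannian_of_corners[OF u] by blast
    have "rank_fn \<tau> ?k c = rank_fn \<upsilon> ?k c" using t'(5)[OF pq(1)] u'(5)[OF pq(1)] pq(2) by simp
    then show "cnt (\<tau> ` {1..?k}) c \<le> cnt (\<upsilon> ` {1..?k}) c"
      using rank_fn_eq_cnt[OF bij_is_inj[OF t'(1)] t'(2)] rank_fn_eq_cnt[OF bij_is_inj[OF u'(1)] u'(2)] by simp
  qed
  have "\<rho> ` {1..?k} = \<sigma> ` {1..?k}"
    using le[OF assms] le[OF assms(2,1)]
    by (intro cnt_inject image_sites(3) g h antisym)
  then show ?thesis
    by (intro grassmannian_unique[of \<rho> \<sigma> ?k] g h strict_mono_on_sites[OF bij_is_inj])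
qed

text \<open>Any two essential boxes are comparable from southwest to northeast, and their strict
  rank inequalities are the separation condition for the corners of a set \<open>B\<close>. The
  product of a hopping word that ends in \<open>B\<close> is the permutation.\<close>

lemma is_grassmannian_of_exists:
  assumes \<pi>: "\<pi> permutes {1..n}" and vex: "vexillary \<pi>" and nid: "\<pi> \<noteq> id"
  shows "\<exists>\<rho>. is_grassmannian_of \<pi> \<rho>"
proof -
  define k where "k = last_descent \<pi>"
  define pos where "pos = (\<lambda>(p, q). k - p + q)"
  define val where "val = (\<lambda>(p, q). k - p + rank_fn \<pi> p q)"
  have bij: "bij \<pi>" and 0: "\<pi> 0 = 0" using \<pi> by (simp_all add: permutes_bij permutes_not_in)
  have le_k: "p \<le> k" if "(p, q) \<in> ess \<pi>" for p q
    using diagram_le_last_descent[OF \<pi> ess_diagram[OF that]] by (simp add: k_def)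
  have small: "val e < pos e \<and> val e < k" if "e \<in> ess \<pi>" for e
  proof -
    obtain p q where e: "e = (p, q)" by (cases e)
    then show ?thesis using ess_rank_less[OF _ bij 0, of p q] le_k[of p q] that by (auto simp: val_def pos_def)
  qed
  have sep: "(pos (p, q) < pos (p', q') \<and> val (p, q) < val (p', q') \<and>
        val (p', q') + pos (p, q) < val (p, q) + pos (p', q'))"
    if t: "(p, q) \<in> ess \<pi>" "(p', q') \<in> ess \<pi>" "(p, q) \<noteq> (p', q')" "p' \<le> p" "q \<le> q'" for p q p' q'
  proof -
    obtain a where a: "k = p + a" using le_k[OF t(1)] le_Suc_ex by blast
    obtain b where b: "k = p' + b" using le_k[OF t(2)] le_Suc_ex by blast
    have "k - p = a" "k - p' = b" using a b by auto
    moreover have "p' < p \<or> q < q'" using t(3-5) by auto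
    ultimately show ?thesis
      using ess_ranks_strict[OF t bij 0] t(4,5) a b
      unfolding val_def pos_def prod.case by (intro conjI; linarith)
  qed
  have cmp: "p' \<le> p \<and> q \<le> q' \<or> p \<le> p' \<and> q' \<le> q"
    if "(p, q) \<in> ess \<pi>" "(p', q') \<in> ess \<pi>" for p q p' q'
    using vexillary_ess[OF vex bij that] vexillary_ess[OF vex bij that(2,1)] by linarith
  have sep': "e = e' \<or> (pos e < pos e' \<and> val e < val e' \<and> val e' + pos e < val e + pos e') \<or>
      (pos e' < pos e \<and> val e' < val e \<and> val e + pos e' < val e' + pos e)"
    if "e \<in> ess \<pi>" "e' \<in> ess \<pi>" for e e'
  proof -
    obtain p q p' q' where e: "e = (p, q)" "e' = (p', q')" by (cases e; cases e')
    show ?thesis using cmp[of p q p' q'] sep[of p q p' q'] sep[of p' q' p q] that unfolding e by blast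
  qed
  have "\<exists>B. finite B \<and> B \<subseteq> {1..} \<and> card B = k \<and> (\<forall>e\<in>ess \<pi>. cnt B (pos e) = val e) \<and>
      (\<forall>c\<ge>1. c \<notin> B \<and> Suc c \<in> B \<longleftrightarrow> c \<in> pos ` ess \<pi>)"
  proof (rule exists_set_with_corners)
    show "finite (ess \<pi>)" by (rule finite_ess[OF \<pi>])
    show "val e < pos e" "val e < k" if "e \<in> ess \<pi>" for e using small[OF that] by auto
    fix e e' assume e: "e \<in> ess \<pi>" "e' \<in> ess \<pi>"
    show "val e < val e' \<and> val e' + pos e < val e + pos e'" if "pos e < pos e'"
      using sep'[OF e] that by auto
    show "val e = val e'" if "pos e = pos e'" using sep'[OF e] that by auto
  qed
  then obtain B where B: "finite B" "B \<subseteq> {1..}" "card B = k"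
    and cntB: "\<And>e. e \<in> ess \<pi> \<Longrightarrow> cnt B (pos e) = val e"
    and corner: "\<And>c. 1 \<le> c \<Longrightarrow> c \<notin> B \<and> Suc c \<in> B \<longleftrightarrow> c \<in> pos ` ess \<pi>" by blast
  obtain R where R: "hopping k R B" using hopping_exists[OF B] by blast
  define \<rho> where "\<rho> = word_prod R"
  note w = hopping_word[OF R, folded \<rho>_def]
  obtain m where "set R \<subseteq> {1..m}"
  proof -
    have "set R \<subseteq> {1..Max (insert 0 (set R))}" using w(1) by auto
    then show ?thesis by (rule that)
  qed
  then have perm: "\<rho> permutes {1..m + 1}" unfolding \<rho>_def by (rule word_prod_permutes)
  have bij\<rho>: "bij \<rho>" and \<rho>0: "\<rho> 0 = 0" using perm by (simp_all add: permutes_bij permutes_not_in)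
  obtain e where e: "e \<in> ess \<pi>" using ess_nonempty[OF \<pi> nid] by blast
  have pos1: "1 \<le> pos e'" if "e' \<in> ess \<pi>" for e' using small[OF that] by linarith
  have k1: "1 \<le> k" using small[OF e] by linarith
  have ess: "ess \<rho> = {(k, c) | c. 1 \<le> c \<and> c \<notin> B \<and> Suc c \<in> B}"
    using grassmannian_ess[OF bij\<rho> \<rho>0 k1 w(3,4)] unfolding w(2) .
  have "descents \<rho> = {k}"
  proof (intro equalityI subsetI)
    fix i assume "i \<in> descents \<rho>"
    then have gt: "\<rho> (Suc i) < \<rho> i" by (simp add: descents_def)
    then have "1 \<le> i" using \<rho>0 by (cases i) auto
    have "\<not> i < k" using strict_mono_onD[OF w(3), of i "Suc i"] gt \<open>1 \<le> i\<close> by auto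
    moreover have "\<not> k < i" using strict_mono_onD[OF w(4), of i "Suc i"] gt by auto
    ultimately show "i \<in> {k}" by simp
  next
    fix i assume "i \<in> {k}"
    \<comment> \<open>Any essential box yields the descent: its column is a value below
      \<open>\<rho> k\<close> taken after position \<open>k\<close>, and
      \<open>\<rho> (Suc k)\<close> is the least of those values.\<close>
    have "(k, pos e) \<in> ess \<rho>" unfolding ess using corner[OF pos1[OF e]] pos1[OF e] e by blast
    then have d: "pos e < \<rho> k" "k < inv_into UNIV \<rho> (pos e)" by (auto simp: ess_def diagram_def)
    have "\<rho> (Suc k) \<le> \<rho> (inv_into UNIV \<rho> (pos e))"
    proof (cases "inv_into UNIV \<rho> (pos e) = Suc k")
      case False
      then show ?thesis using strict_mono_onD[OF w(4), of "Suc k" "inv_into UNIV \<rho> (pos e)"] d by simp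
    qed simp
    also have "\<rho> (inv_into UNIV \<rho> (pos e)) = pos e" using bij\<rho> by (simp add: bij_is_surj surj_f_inv_f)
    finally show "i \<in> descents \<rho>" using d \<open>i \<in> {k}\<close> by (simp add: descents_def)
  qed
  moreover have "ess \<rho> = (\<lambda>(p, q). (k, k - p + q)) ` ess \<pi>"
  proof -
    have "ess \<rho> = Pair k ` {c. 1 \<le> c \<and> c \<notin> B \<and> Suc c \<in> B}" unfolding ess by blast
    also have "{c. 1 \<le> c \<and> c \<notin> B \<and> Suc c \<in> B} = pos ` ess \<pi>" using corner pos1 by blast
    also have "Pair k ` pos ` ess \<pi> = (\<lambda>(p, q). (k, k - p + q)) ` ess \<pi>"
      unfolding image_image pos_def by (rule image_cong) auto
    finally show ?thesis .
  qed
  moreover have "\<forall>(p, q)\<in>ess \<pi>. rank_fn \<rho> k (k - p + q) = k - p + rank_fn \<pi> p q"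
  proof safe
    fix p q assume "(p, q) \<in> ess \<pi>"
    then have "cnt B (k - p + q) = k - p + rank_fn \<pi> p q" using cntB[of "(p, q)"] by (simp add: pos_def val_def)
    then show "rank_fn \<rho> k (k - p + q) = k - p + rank_fn \<pi> p q"
      using rank_fn_eq_cnt[OF bij_is_inj[OF bij\<rho>] \<rho>0, of k] w(2) by simp
  qed
  ultimately have "is_grassmannian_of \<pi> \<rho>"
    using perm unfolding is_grassmannian_of_def Let_def k_def by blast
  then show ?thesis by blast
qed

lemma grassmannian_of:
  assumes "\<pi> permutes {1..n}" "vexillary \<pi>" "\<pi> \<noteq> id"
  shows "is_grassmannian_of \<pi> (grassmannian_of \<pi>)"
proof -
  obtain \<rho> where "is_grassmannian_of \<pi> \<rho>" using is_grassmannian_of_exists[OF assms] by blast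
  then show ?thesis unfolding grassmannian_of_def using assms(3) is_grassmannian_of_unique
    by (simp, intro theI[of "is_grassmannian_of \<pi>" \<rho>]) blast+
qed

section \<open>The faces of the subword complex\<close>

lemma shape_ferrers:
  assumes "\<pi> permutes {1..n}"
  shows "ferrers (shape \<pi>)" "shape \<pi> \<subseteq> {1..n} \<times> {1..n}"
proof -
  show "ferrers (shape \<pi>)" by (force simp: ferrers_def shape_def)
  have "{1..p} \<times> {1..q} \<subseteq> {1..n} \<times> {1..n}" if "(p, q) \<in> ess \<pi>" for p q
    using diagram_subset[OF assms] ess_diagram[OF that] by fastforce
  then show "shape \<pi> \<subseteq> {1..n} \<times> {1..n}" unfolding shape_def by blast
qed

text \<open>Each row of a Ferrers shape is an initial segment and hence determined by its
  cardinality; so the list built from row lengths enumerates the shape.\<close>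

lemma shape_row:
  assumes "\<pi> permutes {1..n}"
  shows "(p, q) \<in> shape \<pi> \<longleftrightarrow> p \<in> {1..last_descent \<pi>} \<and> q \<in> {1..shape_row \<pi> p}"
proof -
  let ?S = "{q. (p, q) \<in> shape \<pi>}"
  note f = shape_ferrers[OF assms]
  have fin: "finite ?S" by (rule finite_subset[of _ "{1..n}"]) (use f(2) in auto)
  have "?S = {1..card ?S}"
  proof (cases "?S = {}")
    case False
    define M where "M = Max ?S"
    have mem: "(p, M) \<in> shape \<pi>" using Max_in[OF fin False] unfolding M_def by simp
    have "1 \<le> p" using mem f(2) by auto
    then have down: "(p, j) \<in> shape \<pi>" if "1 \<le> j" "j \<le> M" for j
      using that by (intro ferrersD[OF f(1) mem] order.refl)
    have up: "1 \<le> j" "j \<le> M" if "(p, j) \<in> shape \<pi>" for j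
    proof -
      show "1 \<le> j" using that f(2) by auto
      show "j \<le> M" unfolding M_def by (rule Max_ge[OF fin]) (use that in simp)
    qed
    have eq: "?S = {1..M}" using down up by (intro Set.set_eqI) (metis atLeastAtMost_iff mem_Collect_eq)
    then have "card ?S = M" by simp
    then show ?thesis using eq by simp
  qed simp
  then have S: "(p, q) \<in> shape \<pi> \<longleftrightarrow> q \<in> {1..shape_row \<pi> p}"
    unfolding shape_row_def by blast
  have "p \<in> {1..last_descent \<pi>}" if "(p, q) \<in> shape \<pi>"
  proof -
    obtain p' q' where e: "(p', q') \<in> ess \<pi>" "p \<in> {1..p'}" using \<open>(p, q) \<in> shape \<pi>\<close> by (auto simp: shape_def)
    then show ?thesis using diagram_le_last_descent[OF assms ess_diagram[OF e(1)]] by simp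
  qed
  then show ?thesis using S by blast
qed

lemma reading_boxes:
  assumes "\<pi> permutes {1..n}"
  shows "set (reading_boxes \<pi>) = shape \<pi>" "distinct (reading_boxes \<pi>)"
    "sorted_wrt (\<lambda>(p, q) (p', q'). \<not> (p \<le> p' \<and> q \<le> q')) (reading_boxes \<pi>)"
proof -
  show "set (reading_boxes \<pi>) = shape \<pi>"
    unfolding reading_boxes_def reading_order(1) using shape_row[OF assms] by auto
  show s: "sorted_wrt (\<lambda>(p, q) (p', q'). \<not> (p \<le> p' \<and> q \<le> q')) (reading_boxes \<pi>)"
    unfolding reading_boxes_def by (rule reading_order(2))
  show "distinct (reading_boxes \<pi>)"
    unfolding distinct_conv_nth
  proof (intro allI impI)
    have ne: "reading_boxes \<pi> ! i \<noteq> reading_boxes \<pi> ! j" if "i < j" "j < length (reading_boxes \<pi>)" for i j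
      using sorted_wrt_nth_less[OF s that] by (auto split: prod.splits)
    fix i j assume "i < length (reading_boxes \<pi>)" "j < length (reading_boxes \<pi>)" "i \<noteq> j"
    then show "reading_boxes \<pi> ! i \<noteq> reading_boxes \<pi> ! j" using ne[of i j] ne[of j i] by (cases i j rule: linorder_cases) auto
  qed
qed

text \<open>The boxes are distinct, so \<open>F\<close> determines the set of omitted positions, and
  the existential over vertex sets collapses to the word read off the complement of
  \<open>F\<close>.\<close>

lemma mem_Gamma_complex:
  assumes \<pi>: "\<pi> permutes {1..n}" and F: "F \<subseteq> shape \<pi>"
  shows "F \<in> Gamma_complex \<pi> \<longleftrightarrow> (\<exists>R. subseq R (map (\<lambda>(p, q). last_descent \<pi> - p + q)
      (filter (\<lambda>b. b \<notin> F) (reading_boxes \<pi>))) \<and> reduced_expression R (grassmannian_of \<pi>))"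
proof -
  let ?L = "reading_boxes \<pi>" and ?f = "\<lambda>(p, q). last_descent \<pi> - p + q"
  let ?P = "{i. i < length ?L \<and> ?L ! i \<notin> F}"
  have len: "length (reading_word \<pi>) = length ?L" by (simp add: reading_word_def)
  have nths: "nths (reading_word \<pi>) ?P = map ?f (filter (\<lambda>b. b \<notin> F) ?L)"
    by (simp add: reading_word_def nths_map filter_eq_nths)
  have im: "(!) ?L ` ({..<length ?L} - ?P) = F"
  proof -
    have "F \<subseteq> set ?L" using F reading_boxes(1)[OF \<pi>] by simp
    then have "x \<in> (!) ?L ` ({..<length ?L} - ?P)" if "x \<in> F" for x
    proof -
      obtain i where "i < length ?L" "?L ! i = x" using \<open>F \<subseteq> set ?L\<close> \<open>x \<in> F\<close> by (meson in_set_conv_nth subsetD)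
      then show ?thesis using that by (intro image_eqI[of _ _ i]) auto
    qed
    then show ?thesis by auto
  qed
  have P: "P = ?P" if "P \<subseteq> {..<length ?L}" "F = (!) ?L ` ({..<length ?L} - P)" for P
  proof (intro Set.set_eqI iffI)
    fix i assume i: "i \<in> P"
    have "?L ! i \<noteq> ?L ! j" if "j \<in> {..<length ?L} - P" for j
      using nth_eq_iff_index_eq[OF reading_boxes(2)[OF \<pi>], of i j] that i \<open>P \<subseteq> _\<close> by auto
    then show "i \<in> ?P" using i that by auto
  next
    fix i assume "i \<in> ?P"
    then show "i \<in> P" unfolding \<open>F = _\<close> by auto
  qed
  have "F \<in> Gamma_complex \<pi> \<longleftrightarrow> (\<exists>P\<subseteq>{..<length ?L}. F = (!) ?L ` ({..<length ?L} - P) \<and>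
      (\<exists>R. subseq R (nths (reading_word \<pi>) P) \<and> reduced_expression R (grassmannian_of \<pi>)))"
  proof -
    have "X \<in> f ` {g P | P. P \<subseteq> S \<and> c P} \<longleftrightarrow> (\<exists>P\<subseteq>S. X = f (g P) \<and> c P)"
      for X :: "(nat \<times> nat) set" and f and g :: "nat set \<Rightarrow> nat set" and c S by blast
    from this[of F "\<lambda>F. (!) ?L ` F" "\<lambda>P. {..<length ?L} - P" "{..<length ?L}"
        "\<lambda>P. \<exists>R. subseq R (nths (reading_word \<pi>) P) \<and> reduced_expression R (grassmannian_of \<pi>)"]
    show ?thesis unfolding Gamma_complex_def subword_complex_def len .
  qed
  also have "\<dots> \<longleftrightarrow> (\<exists>R. subseq R (nths (reading_word \<pi>) ?P) \<and> reduced_expression R (grassmannian_of \<pi>))"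
  proof
    assume "\<exists>P\<subseteq>{..<length ?L}. F = (!) ?L ` ({..<length ?L} - P) \<and>
      (\<exists>R. subseq R (nths (reading_word \<pi>) P) \<and> reduced_expression R (grassmannian_of \<pi>))"
    then obtain P R where "P \<subseteq> {..<length ?L}" "F = (!) ?L ` ({..<length ?L} - P)"
      and R: "subseq R (nths (reading_word \<pi>) P)" "reduced_expression R (grassmannian_of \<pi>)"
      by (elim exE conjE)
    then have "P = ?P" by (intro P)
    with R show "\<exists>R. subseq R (nths (reading_word \<pi>) ?P) \<and> reduced_expression R (grassmannian_of \<pi>)"
      by (intro exI[of _ R]) simp
  next
    assume "\<exists>R. subseq R (nths (reading_word \<pi>) ?P) \<and> reduced_expression R (grassmannian_of \<pi>)"
    then show "\<exists>P\<subseteq>{..<length ?L}. F = (!) ?L ` ({..<length ?L} - P) \<and>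
      (\<exists>R. subseq R (nths (reading_word \<pi>) P) \<and> reduced_expression R (grassmannian_of \<pi>))"
      by (intro exI[of _ ?P] conjI im[symmetric]) auto
  qed
  finally show ?thesis unfolding nths .
qed

text \<open>The sites of the essential boxes are vertices of the boundary path and include all
  corners of the Grassmannian value set. Comparing counts there decides the comparison everywhere,
  and the common offset \<open>k - p\<close> cancels.\<close>

lemma face_iff:
  assumes \<pi>: "\<pi> permutes {1..n}" and vex: "vexillary \<pi>" and F: "F \<subseteq> shape \<pi>"
  shows "F \<in> Gamma_complex \<pi> \<longleftrightarrow> (\<forall>(p, q)\<in>ess \<pi>. lc F p q \<le> rank_fn \<pi> p q)"
proof -
  define k where "k = last_descent \<pi>"
  define w where "w = map (\<lambda>(p, q). k - p + q) (filter (\<lambda>b. b \<notin> F) (reading_boxes \<pi>))"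
  let ?\<rho> = "grassmannian_of \<pi>" and ?A = "foldr hop w {1..k}"
  have bij: "bij \<pi>" using \<pi> by (rule permutes_bij)
  have \<Gamma>: "F \<in> Gamma_complex \<pi> \<longleftrightarrow> (\<exists>R. subseq R w \<and> reduced_expression R ?\<rho>)"
    unfolding w_def k_def by (rule mem_Gamma_complex[OF \<pi> F])
  have w: "set w \<subseteq> {1..}"
  proof
    fix i assume "i \<in> set w"
    then obtain p q where "(p, q) \<in> shape \<pi>" "i = k - p + q"
      using reading_boxes(1)[OF \<pi>] by (auto simp: w_def)
    then show "i \<in> {1..}" using shape_ferrers(2)[OF \<pi>] by auto
  qed
  have cntA: "cnt ?A (k - p + q) = k - p + lc F p q" if e: "(p, q) \<in> ess \<pi>" for p q
  proof -
    have "boundary_count k F (shape \<pi>) ?A"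
      using boundary_count_foldr[of "reading_boxes \<pi>" k F] reading_boxes[OF \<pi>] shape_ferrers(1)[OF \<pi>] shape_row[OF \<pi>]
      unfolding w_def k_def by force
    moreover have "(p, q) \<in> shape \<pi>"
      using e diagram_subset[OF \<pi>] ess_diagram[OF e] by (force simp: shape_def)
    \<comment> \<open>Here vexillarity places the essential box on the boundary path.\<close>
    moreover have "(Suc p, Suc q) \<notin> shape \<pi>"
    proof
      assume "(Suc p, Suc q) \<in> shape \<pi>"
      then obtain p' q' where "(p', q') \<in> ess \<pi>" "Suc p \<le> p'" "Suc q \<le> q'" by (auto simp: shape_def)
      then show False using vexillary_ess[OF vex bij e, of p' q'] by simp
    qed
    moreover have "p \<le> k" using diagram_le_last_descent[OF \<pi> ess_diagram[OF e]] by (simp add: k_def)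
    ultimately show ?thesis unfolding boundary_count_def by blast
  qed
  show ?thesis
  proof (cases "\<pi> = id")
    case True
    have "diagram \<pi> = {}" unfolding True by (auto simp: diagram_def inv_id[unfolded id_def] id_def)
    then have "ess \<pi> = {}" by (auto simp: ess_def)
    moreover have "reduced_expression [] ?\<rho>"
      using True by (simp add: reduced_expression_def grassmannian_of_def)
    ultimately show ?thesis unfolding \<Gamma> by (auto intro!: exI[of _ "[]"])
  next
    case False
    note g = grassmannian_of[OF \<pi> vex False]
    note g' = is_grassmannian_ofD[OF g, folded k_def]
    note sites = image_sites[OF g'(1,2)]
    have rank: "cnt (?\<rho> ` {1..k}) (k - p + q) = k - p + rank_fn \<pi> p q" if "(p, q) \<in> ess \<pi>" for p q
      using g'(5)[OF that] rank_fn_eq_cnt[OF bij_is_inj[OF g'(1)] g'(2), of k "k - p + q"] by simp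
    show ?thesis
    proof
      assume "F \<in> Gamma_complex \<pi>"
      then obtain R where R: "subseq R w" "word_prod R = ?\<rho>" unfolding \<Gamma> reduced_expression_def by blast
      show "\<forall>(p, q)\<in>ess \<pi>. lc F p q \<le> rank_fn \<pi> p q"
      proof safe
        fix p q assume e: "(p, q) \<in> ess \<pi>"
        show "lc F p q \<le> rank_fn \<pi> p q"
          using cnt_hops_le_word_prod[OF R(1) w, of "{1..k}" "k - p + q"] unfolding cntA[OF e] R(2) rank[OF e] by simp
      qed
    next
      assume le: "\<forall>(p, q)\<in>ess \<pi>. lc F p q \<le> rank_fn \<pi> p q"
      have A: "finite ?A" "card ?A = k"
      proof -
        have "finite (foldr hop v {1..k}) \<and> card (foldr hop v {1..k}) = k" for v
          by (induction v) (simp_all add: card_hop)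
        then show "finite ?A" "card ?A = k" by auto
      qed
      have "cnt ?A c \<le> cnt (?\<rho> ` {1..k}) c" for c
      proof (rule cnt_le_at_corners[OF A sites])
        fix c assume "1 \<le> c" "c \<notin> ?\<rho> ` {1..k}" "Suc c \<in> ?\<rho> ` {1..k}"
        then obtain p q where e: "(p, q) \<in> ess \<pi>" "c = k - p + q"
          using is_grassmannian_of_corners[OF g, folded k_def] by blast
        have "lc F p q \<le> rank_fn \<pi> p q" using le e(1) by blast
        then show "cnt ?A c \<le> cnt (?\<rho> ` {1..k}) c" unfolding e(2) cntA[OF e(1)] rank[OF e(1)] by simp
      qed
      then obtain R where R: "subseq R w" "hopping k R (?\<rho> ` {1..k})"
        using hopping_subseq[OF w sites(3,1,2)] by blast
      note h = hopping_word[OF R(2)]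
      have "word_prod R 0 = 0"
      proof -
        have "set R \<subseteq> {1..Max (insert 0 (set R))}" using h(1) by auto
        from word_prod_permutes[OF this] show ?thesis by (simp add: permutes_not_in)
      qed
      then have "word_prod R = ?\<rho>"
        by (intro grassmannian_unique[OF bij_word_prod g'(1) _ g'(2) h(3) _ h(4) _ h(2)]
            strict_mono_on_sites[OF bij_is_inj[OF g'(1)] g'(2,3)])
      then have "reduced_expression R ?\<rho>" using hopping_reduced_expression[OF R(2)] by simp
      then show "F \<in> Gamma_complex \<pi>" unfolding \<Gamma> using R(1) by blast
    qed
  qed
qed

section \<open>Evaluation of polynomials\<close>

definition meval :: "(nat \<times> nat \<Rightarrow> 'r::comm_ring_1) \<Rightarrow> monom \<Rightarrow> 'r" where
  "meval x m = (\<Prod>v\<in>Poly_Mapping.keys m. x v ^ Poly_Mapping.lookup m v)"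

text \<open>The coefficient map is a parameter because the target will be a polynomial ring in other
  indeterminates, with the field embedded as constants.\<close>

definition peval :: "('k::field \<Rightarrow> 'r::comm_ring_1) \<Rightarrow> (nat \<times> nat \<Rightarrow> 'r) \<Rightarrow> 'k mpol \<Rightarrow> 'r" where
  "peval C x f = (\<Sum>m\<in>Poly_Mapping.keys f. C (Poly_Mapping.lookup f m) * meval x m)"

lemma meval_superset:
  assumes "finite S" "Poly_Mapping.keys m \<subseteq> S"
  shows "meval x m = (\<Prod>v\<in>S. x v ^ Poly_Mapping.lookup m v)"
  unfolding meval_def using assms
  by (intro prod.mono_neutral_left) (auto simp: in_keys_iff)

lemma meval_0 [simp]: "meval x 0 = 1"
  by (simp add: meval_def)

lemma meval_single [simp]: "meval x (Poly_Mapping.single v k) = x v ^ k"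
  by (simp add: meval_def)

lemma meval_add: "meval x (m + m') = meval x m * meval x m'"
proof -
  let ?S = "Poly_Mapping.keys m \<union> Poly_Mapping.keys m'"
  have "meval x (m + m') = (\<Prod>v\<in>?S. x v ^ Poly_Mapping.lookup (m + m') v)"
    by (rule meval_superset) (auto dest: subsetD[OF Poly_Mapping.keys_add])
  also have "\<dots> = (\<Prod>v\<in>?S. x v ^ Poly_Mapping.lookup m v) * (\<Prod>v\<in>?S. x v ^ Poly_Mapping.lookup m' v)"
    by (simp add: lookup_add power_add prod.distrib)
  also have "\<dots> = meval x m * meval x m'"
    by (simp add: meval_superset[of ?S m] meval_superset[of ?S m'])
  finally show ?thesis .
qed

lemma poly_mapping_sum_single:
  "f = (\<Sum>m\<in>Poly_Mapping.keys f. Poly_Mapping.single m (Poly_Mapping.lookup f m))"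
proof (rule poly_mapping_eqI)
  fix m
  have "(\<Sum>k\<in>Poly_Mapping.keys f. Poly_Mapping.lookup (Poly_Mapping.single k (Poly_Mapping.lookup f k)) m)
      = (\<Sum>k\<in>Poly_Mapping.keys f. if k = m then Poly_Mapping.lookup f m else 0)"
    by (rule sum.cong) (auto simp: lookup_single)
  then show "Poly_Mapping.lookup f m = Poly_Mapping.lookup
      (\<Sum>m\<in>Poly_Mapping.keys f. Poly_Mapping.single m (Poly_Mapping.lookup f m)) m"
    by (simp add: lookup_sum in_keys_iff)
qed

context
  fixes C :: "'k::field \<Rightarrow> 'r::comm_ring_1" and x :: "nat \<times> nat \<Rightarrow> 'r"
  assumes C: "C 0 = 0" "C 1 = 1" "\<And>c d. C (c + d) = C c + C d" "\<And>c d. C (c * d) = C c * C d"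
begin

lemma peval_superset:
  assumes "finite S" "Poly_Mapping.keys f \<subseteq> S"
  shows "peval C x f = (\<Sum>m\<in>S. C (Poly_Mapping.lookup f m) * meval x m)"
  unfolding peval_def using assms
  by (intro sum.mono_neutral_left) (auto simp: in_keys_iff C)

lemma peval_0: "peval C x 0 = 0"
  by (simp add: peval_def)

lemma peval_add: "peval C x (f + g) = peval C x f + peval C x g"
proof -
  let ?S = "Poly_Mapping.keys f \<union> Poly_Mapping.keys g"
  have "peval C x (f + g) = (\<Sum>m\<in>?S. C (Poly_Mapping.lookup (f + g) m) * meval x m)"
    by (rule peval_superset) (auto dest: subsetD[OF Poly_Mapping.keys_add])
  also have "\<dots> = peval C x f + peval C x g"
    by (simp add: lookup_add C algebra_simps sum.distrib peval_superset[of ?S f] peval_superset[of ?S g])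
  finally show ?thesis .
qed

lemma peval_sum: "peval C x (\<Sum>i\<in>I. f i) = (\<Sum>i\<in>I. peval C x (f i))"
  by (induction I rule: infinite_finite_induct) (simp_all add: peval_0 peval_add)

lemma peval_single: "peval C x (Poly_Mapping.single m c) = C c * meval x m"
  by (simp add: peval_def C)

lemma peval_mult: "peval C x (f * g) = peval C x f * peval C x g"
proof -
  have "f * g = (\<Sum>m\<in>Poly_Mapping.keys f. \<Sum>m'\<in>Poly_Mapping.keys g.
      Poly_Mapping.single (m + m') (Poly_Mapping.lookup f m * Poly_Mapping.lookup g m'))"
    by (subst poly_mapping_sum_single[of f], subst poly_mapping_sum_single[of g])
       (simp only: sum_product mult_single)
  then have "peval C x (f * g) = (\<Sum>m\<in>Poly_Mapping.keys f. \<Sum>m'\<in>Poly_Mapping.keys g.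
      (C (Poly_Mapping.lookup f m) * meval x m) * (C (Poly_Mapping.lookup g m') * meval x m'))"
    by (simp add: peval_sum peval_single meval_add C mult_ac)
  also have "\<dots> = peval C x f * peval C x g" by (simp only: peval_def sum_product)
  finally show ?thesis .
qed

lemma peval_one: "peval C x 1 = 1"
  by (simp flip: single_one add: peval_single C)

lemma peval_hom: "comm_ring_hom (peval C x)"
  by unfold_locales (simp_all add: peval_0 peval_one peval_add peval_mult)

lemma peval_zvar: "peval C x (zvar v) = x v"
  by (simp add: zvar_def peval_single C)

lemma peval_minor: "peval C x (minor s a b) = det (mat s s (\<lambda>(i, j). x (a i, b j)))"
proof -
  interpret comm_ring_hom "peval C x" by (rule peval_hom)
  have "map_mat (peval C x) (mat s s (\<lambda>(i, j). zvar (a i, b j))) = mat s s (\<lambda>(i, j). x (a i, b j))"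
    by (rule eq_matI) (auto simp: peval_zvar)
  then show ?thesis unfolding minor_def by (metis hom_det)
qed

end

section \<open>Vanishing of minors\<close>

text \<open>The factors are enlarged to square matrices so that the determinant is multiplicative;
  column \<open>r\<close> of the left factor is zero.\<close>

lemma det_sum_of_products:
  fixes A B :: "nat \<Rightarrow> nat \<Rightarrow> 'r::comm_ring_1"
  assumes "r < s"
  shows "det (mat s s (\<lambda>(i, j). \<Sum>t<r. A i t * B t j)) = 0"
proof -
  define A' where "A' = mat s s (\<lambda>(i, t). if t < r then A i t else 0)"
  define B' where "B' = mat s s (\<lambda>(t, j). B t j)"
  have A': "A' \<in> carrier_mat s s" and B': "B' \<in> carrier_mat s s" by (auto simp: A'_def B'_def)
  have "mat s s (\<lambda>(i, j). \<Sum>t<r. A i t * B t j) = A' * B'"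
  proof (rule eq_matI)
    fix i j assume "i < dim_row (A' * B')" "j < dim_col (A' * B')"
    then have ij: "i < s" "j < s" by (auto simp: A'_def B'_def)
    then have "(A' * B') $$ (i, j) = (\<Sum>t = 0..<s. (if t < r then A i t else 0) * B t j)"
      by (simp add: A'_def B'_def scalar_prod_def)
    also have "\<dots> = (\<Sum>t<r. A i t * B t j)"
      using assms by (intro sum.mono_neutral_cong_right) auto
    finally show "mat s s (\<lambda>(i, j). \<Sum>t<r. A i t * B t j) $$ (i, j) = (A' * B') $$ (i, j)"
      using ij by simp
  qed (auto simp: A'_def B'_def)
  moreover have "det A' = 0"
    by (subst laplace_expansion_column[OF A' assms]) (use assms in \<open>auto simp: A'_def intro!: sum.neutral\<close>)
  ultimately show ?thesis using det_mult[OF A' B'] by simp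
qed

text \<open>Rank over a commutative ring, expressed by minors of the size that the generators of the
  ideal have.\<close>

definition rank_le :: "(nat \<times> nat \<Rightarrow> 'r::comm_ring_1) \<Rightarrow> nat \<Rightarrow> nat \<Rightarrow> nat \<Rightarrow> bool" where
  "rank_le x p q r \<longleftrightarrow> (\<forall>a b. index_seq (Suc r) p a \<and> index_seq (Suc r) q b \<longrightarrow>
     det (mat (Suc r) (Suc r) (\<lambda>(i, j). x (a i, b j))) = 0)"

lemma index_seq_le: "index_seq s p a \<Longrightarrow> s \<le> p"
proof -
  assume a: "index_seq s p a"
  then have "inj_on a {..<s}" by (auto simp: index_seq_def dest: strict_mono_on_imp_inj_on)
  then have "card {..<s} \<le> card {1..p}" using a by (intro card_inj_on_le) (auto simp: index_seq_def)
  then show ?thesis by simp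
qed

lemma rank_le_mono: "rank_le x p q r \<Longrightarrow> p' \<le> p \<Longrightarrow> q' \<le> q \<Longrightarrow> rank_le x p' q' r"
  unfolding rank_le_def using index_seq_mono by blast

lemma rank_le_transpose:
  assumes "rank_le (x \<circ> prod.swap) q p r"
  shows "rank_le x p q r"
  unfolding rank_le_def
proof (intro allI impI)
  fix a b assume ab: "index_seq (Suc r) p a \<and> index_seq (Suc r) q b"
  let ?M = "mat (Suc r) (Suc r) (\<lambda>(i, j). x (a i, b j))"
  have "transpose_mat ?M = mat (Suc r) (Suc r) (\<lambda>(i, j). (x \<circ> prod.swap) (b i, a j))"
    by (rule eq_matI) auto
  then have "det (transpose_mat ?M) = 0" using assms ab by (simp add: rank_le_def)
  then show "det ?M = 0" by (subst (asm) det_transpose) auto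
qed

text \<open>Expansion along the last row: all earlier row indices are at most \<open>p\<close>, so
  the cofactors are, up to sign, minors of the smaller rectangle and vanish.\<close>

lemma rank_le_add_row:
  assumes "rank_le x p q r"
  shows "rank_le x (Suc p) q (Suc r)"
  unfolding rank_le_def
proof (intro allI impI)
  fix a b assume ab: "index_seq (Suc (Suc r)) (Suc p) a \<and> index_seq (Suc (Suc r)) q b"
  let ?M = "mat (Suc (Suc r)) (Suc (Suc r)) (\<lambda>(i, j). x (a i, b j))"
  have a: "a i < a j" if "i < j" "j < Suc (Suc r)" for i j
    using ab that by (auto simp: index_seq_def strict_mono_on_def)
  have b: "b i < b j" if "i < j" "j < Suc (Suc r)" for i j
    using ab that by (auto simp: index_seq_def strict_mono_on_def)
  have ra: "1 \<le> a i \<and> a i \<le> Suc p" if "i < Suc (Suc r)" for i using ab that by (force simp: index_seq_def)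
  have rb: "1 \<le> b i \<and> b i \<le> q" if "i < Suc (Suc r)" for i using ab that by (force simp: index_seq_def)
  have "a i \<le> p" if "i < Suc r" for i using a[of i "Suc r"] ra[of "Suc r"] that by simp
  then have a': "index_seq (Suc r) p a"
    using a ra by (auto simp: index_seq_def strict_mono_on_def)
  have "det (mat_delete ?M (Suc r) j) = 0" if j: "j < Suc (Suc r)" for j
  proof -
    define b' where "b' i = b (if i < j then i else Suc i)" for i
    have b': "index_seq (Suc r) q b'"
      using b rb by (auto simp: index_seq_def strict_mono_on_def b'_def)
    have "mat_delete ?M (Suc r) j = mat (Suc r) (Suc r) (\<lambda>(i, j). x (a i, b' j))"
      by (rule eq_matI) (auto simp: mat_delete_def b'_def)
    then show ?thesis using assms a' b' by (simp add: rank_le_def)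
  qed
  then show "det ?M = 0"
    by (subst laplace_expansion_row[of _ "Suc (Suc r)" "Suc r"]) (auto simp: cofactor_def intro!: sum.neutral)
qed

lemma rank_le_add_col:
  assumes "rank_le x p q r"
  shows "rank_le x p (Suc q) (Suc r)"
proof (rule rank_le_transpose, rule rank_le_add_row)
  show "rank_le (x \<circ> prod.swap) q p r"
    by (rule rank_le_transpose) (simp add: assms comp_def)
qed

section \<open>Term orders\<close>

locale term_ord =
  fixes n :: nat and r :: "(monom \<times> monom) set"
  assumes term_order: "term_order n r"
begin

lemma r_mem: "(s, t) \<in> r \<Longrightarrow> s \<in> monoms n \<and> t \<in> monoms n"
  using term_order by (auto simp: term_order_def linear_order_on_def partial_order_on_def preorder_on_def refl_on_def)

lemma r_refl: "s \<in> monoms n \<Longrightarrow> (s, s) \<in> r"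
  using term_order by (auto simp: term_order_def linear_order_on_def partial_order_on_def preorder_on_def refl_on_def)

lemma r_trans: "(s, t) \<in> r \<Longrightarrow> (t, u) \<in> r \<Longrightarrow> (s, u) \<in> r"
  using term_order unfolding term_order_def linear_order_on_def partial_order_on_def preorder_on_def
  by (blast dest: transD)

lemma r_antisym: "(s, t) \<in> r \<Longrightarrow> (t, s) \<in> r \<Longrightarrow> s = t"
  using term_order unfolding term_order_def linear_order_on_def partial_order_on_def
  by (blast dest: antisymD)

lemma r_total: "s \<in> monoms n \<Longrightarrow> t \<in> monoms n \<Longrightarrow> (s, t) \<in> r \<or> (t, s) \<in> r"
  using term_order r_refl[of s] by (cases "s = t") (auto simp: term_order_def linear_order_on_def total_on_def)

lemma r_add: "(s, t) \<in> r \<Longrightarrow> u \<in> monoms n \<Longrightarrow> (s + u, t + u) \<in> r"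
  using term_order r_mem[of s t] unfolding term_order_def by blast

lemma r_add_mono: "(s, t) \<in> r \<Longrightarrow> (s', t') \<in> r \<Longrightarrow> (s + s', t + t') \<in> r"
  using r_add[of s t s'] r_add[of s' t' t] r_mem r_trans by (metis add.commute)

lemma exists_min:
  assumes "finite S" "S \<noteq> {}" "S \<subseteq> monoms n"
  shows "\<exists>t\<in>S. \<forall>s\<in>S. (t, s) \<in> r"
  using assms
proof (induction S rule: finite_ne_induct)
  case (singleton s)
  then show ?case using r_refl by auto
next
  case (insert s S)
  then obtain t where t: "t \<in> S" "\<forall>u\<in>S. (t, u) \<in> r" by auto
  show ?case
  proof (cases "(t, s) \<in> r")
    case True
    then show ?thesis using t by auto
  next
    case False
    then have st: "(s, t) \<in> r" using r_total[of s t] insert.prems t by auto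
    have "(s, u) \<in> r" if "u \<in> insert s S" for u
      using that r_refl[of s] insert.prems r_trans[OF st, of u] t(2) by auto
    then show ?thesis by blast
  qed
qed

lemma exists_max:
  assumes "finite S" "S \<noteq> {}" "S \<subseteq> monoms n"
  shows "\<exists>t\<in>S. \<forall>s\<in>S. (s, t) \<in> r"
  using assms
proof (induction S rule: finite_ne_induct)
  case (singleton s)
  then show ?case using r_refl by auto
next
  case (insert s S)
  then obtain t where t: "t \<in> S" "\<forall>u\<in>S. (u, t) \<in> r" by auto
  show ?case
  proof (cases "(s, t) \<in> r")
    case True
    then show ?thesis using t by auto
  next
    case False
    then have ts: "(t, s) \<in> r" using r_total[of s t] insert.prems t by auto
    have "(u, s) \<in> r" if "u \<in> insert s S" for u
      using that r_refl[of s] insert.prems r_trans[OF _ ts, of u] t(2) by auto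
    then show ?thesis by blast
  qed
qed

lemma leading_monom:
  assumes "f \<noteq> 0" "Poly_Mapping.keys f \<subseteq> monoms n"
  shows "leading_monom r f \<in> Poly_Mapping.keys f"
    and "m \<in> Poly_Mapping.keys f \<Longrightarrow> (m, leading_monom r f) \<in> r"
proof -
  have "Poly_Mapping.keys f \<noteq> {}" using assms(1) by (metis keys_zero poly_mapping_eqI not_in_keys_iff_lookup_eq_zero empty_iff lookup_zero)
  then obtain t where t: "t \<in> Poly_Mapping.keys f \<and> (\<forall>s\<in>Poly_Mapping.keys f. (s, t) \<in> r)"
    using exists_max[of "Poly_Mapping.keys f"] assms by auto
  have "leading_monom r f \<in> Poly_Mapping.keys f \<and> (\<forall>s\<in>Poly_Mapping.keys f. (s, leading_monom r f) \<in> r)"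
    unfolding leading_monom_def by (rule theI[where a = t]) (use t r_antisym in blast)+
  then show "leading_monom r f \<in> Poly_Mapping.keys f"
    "m \<in> Poly_Mapping.keys f \<Longrightarrow> (m, leading_monom r f) \<in> r" by auto
qed

lemma sum_mem_monoms: "(\<And>s. s \<in> S \<Longrightarrow> f s \<in> monoms n) \<Longrightarrow> sum f S \<in> monoms n"
  by (induction S rule: infinite_finite_induct) (auto simp: monoms_add, auto simp: monoms_def)

lemma r_sum_mono:
  assumes "\<And>s. s \<in> S \<Longrightarrow> (f s, g s) \<in> r"
  shows "(sum f S, sum g S) \<in> r"
  using assms
proof (induction S rule: infinite_finite_induct)
  case (insert s S)
  then show ?case by (simp add: r_add_mono)
qed (auto intro!: r_refl simp: monoms_def)

text \<open>With all other terms replaced by the smaller ones, the two sides at \<open>s\<close> are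
  comparable in both directions, and addition of monomials cancels.\<close>

lemma r_sum_eq:
  assumes "finite S" "\<And>s. s \<in> S \<Longrightarrow> (f s, g s) \<in> r" "sum f S = sum g S" "s \<in> S"
  shows "f s = g s"
proof -
  let ?F = "sum f (S - {s})" and ?G = "sum g (S - {s})"
  have eq: "f s + ?F = g s + ?G" using assms by (simp flip: sum.remove)
  have F: "?F \<in> monoms n" using assms(2) r_mem by (intro sum_mem_monoms) blast
  have g: "g s \<in> monoms n" using assms(2,4) r_mem by blast
  have FG: "(?F, ?G) \<in> r" using assms by (intro r_sum_mono) auto
  have 1: "(f s + ?F, g s + ?F) \<in> r" using r_add[OF assms(2)[OF assms(4)] F] .
  have "(?F + g s, ?G + g s) \<in> r" using r_add[OF FG g] .
  then have "(g s + ?F, f s + ?F) \<in> r" unfolding eq by (simp add: add.commute)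
  then have "f s + ?F = g s + ?F" using 1 r_antisym by blast
  then show ?thesis by simp
qed

end

section \<open>Monomials with given row and column sums\<close>

definition rowsum :: "nat \<Rightarrow> monom \<Rightarrow> nat \<Rightarrow> nat" where
  "rowsum n T i = (\<Sum>j\<in>{1..n}. Poly_Mapping.lookup T (i, j))"

definition colsum :: "nat \<Rightarrow> monom \<Rightarrow> nat \<Rightarrow> nat" where
  "colsum n T j = (\<Sum>i\<in>{1..n}. Poly_Mapping.lookup T (i, j))"

lemma rowsum_add: "rowsum n (T + U) i = rowsum n T i + rowsum n U i"
  by (simp add: rowsum_def lookup_add sum.distrib)

lemma colsum_add: "colsum n (T + U) j = colsum n T j + colsum n U j"
  by (simp add: colsum_def lookup_add sum.distrib)

lemma rowsum_single: "v \<in> {1..n} \<times> {1..n} \<Longrightarrow> rowsum n (Poly_Mapping.single v c) i = (if i = fst v then c else 0)"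
  by (cases v) (auto simp: rowsum_def lookup_single when_def)

lemma colsum_single: "v \<in> {1..n} \<times> {1..n} \<Longrightarrow> colsum n (Poly_Mapping.single v c) j = (if j = snd v then c else 0)"
  by (cases v) (auto simp: colsum_def lookup_single when_def)

text \<open>Only strict comparison in both coordinates is excluded; cells of one row or one column
  may occur together.\<close>

definition antichain :: "(nat \<times> nat) set \<Rightarrow> bool" where
  "antichain S \<longleftrightarrow> (\<forall>(i, j)\<in>S. \<forall>(i', j')\<in>S. \<not> (i < i' \<and> j < j'))"

lemma sum_split_at:
  fixes f :: "nat \<Rightarrow> nat"
  assumes "k \<le> n"
  shows "(\<Sum>i\<in>{1..n}. f i) = (\<Sum>i\<in>{1..k}. f i) + (\<Sum>i\<in>{Suc k..n}. f i)"
proof -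
  have "{1..n} = {1..k} \<union> {Suc k..n}" using assms by auto
  then show ?thesis by (simp add: sum.union_disjoint)
qed

text \<open>Either the northwest or the southeast part of an antichain at \<open>(i, j)\<close> is empty, which
  makes the northwest sum the truncated difference below.\<close>

lemma antichain_northwest_sum:
  assumes ac: "antichain (Poly_Mapping.keys T)" and le: "i \<le> n" "j \<le> n"
  shows "(\<Sum>a\<in>{1..i}. \<Sum>b\<in>{1..j}. Poly_Mapping.lookup T (a, b))
    = (\<Sum>a\<in>{1..i}. rowsum n T a) + (\<Sum>b\<in>{1..j}. colsum n T b) - (\<Sum>a\<in>{1..n}. rowsum n T a)"
proof -
  let ?f = "\<lambda>a b. Poly_Mapping.lookup T (a, b)"
  define NW where "NW = (\<Sum>a\<in>{1..i}. \<Sum>b\<in>{1..j}. ?f a b)"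
  define NE where "NE = (\<Sum>a\<in>{1..i}. \<Sum>b\<in>{Suc j..n}. ?f a b)"
  define SW where "SW = (\<Sum>a\<in>{Suc i..n}. \<Sum>b\<in>{1..j}. ?f a b)"
  define SE where "SE = (\<Sum>a\<in>{Suc i..n}. \<Sum>b\<in>{Suc j..n}. ?f a b)"
  have R: "(\<Sum>a\<in>{1..i}. rowsum n T a) = NW + NE"
    by (simp only: rowsum_def sum_split_at[OF le(2)] sum.distrib NW_def NE_def)
  have "(\<Sum>b\<in>{1..j}. colsum n T b) = (\<Sum>b\<in>{1..j}. \<Sum>a\<in>{1..i}. ?f a b) + (\<Sum>b\<in>{1..j}. \<Sum>a\<in>{Suc i..n}. ?f a b)"
    by (simp only: colsum_def sum_split_at[OF le(1)] sum.distrib)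
  also have "(\<Sum>b\<in>{1..j}. \<Sum>a\<in>{1..i}. ?f a b) = NW" unfolding NW_def by (rule sum.swap)
  also have "(\<Sum>b\<in>{1..j}. \<Sum>a\<in>{Suc i..n}. ?f a b) = SW" unfolding SW_def by (rule sum.swap)
  finally have K: "(\<Sum>b\<in>{1..j}. colsum n T b) = NW + SW" .
  have "(\<Sum>a\<in>{Suc i..n}. rowsum n T a) = SW + SE"
    by (simp only: rowsum_def sum_split_at[OF le(2)] sum.distrib SW_def SE_def)
  then have tot: "(\<Sum>a\<in>{1..n}. rowsum n T a) = NW + NE + SW + SE"
    using sum_split_at[OF le(1), of "rowsum n T"] R by simp
  have "NW = 0 \<or> SE = 0"
  proof (rule ccontr)
    assume "\<not> (NW = 0 \<or> SE = 0)"
    then have "NW \<noteq> 0" "SE \<noteq> 0" by auto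
    obtain a where a: "a \<in> {1..i}" "(\<Sum>b\<in>{1..j}. ?f a b) \<noteq> 0"
      using sum.not_neutral_contains_not_neutral[OF \<open>NW \<noteq> 0\<close>[unfolded NW_def]] by blast
    obtain b where b: "b \<in> {1..j}" "?f a b \<noteq> 0"
      using sum.not_neutral_contains_not_neutral[OF a(2)] by blast
    obtain a' where a': "a' \<in> {Suc i..n}" "(\<Sum>b\<in>{Suc j..n}. ?f a' b) \<noteq> 0"
      using sum.not_neutral_contains_not_neutral[OF \<open>SE \<noteq> 0\<close>[unfolded SE_def]] by blast
    obtain b' where b': "b' \<in> {Suc j..n}" "?f a' b' \<noteq> 0"
      using sum.not_neutral_contains_not_neutral[OF a'(2)] by blast
    have "(a, b) \<in> Poly_Mapping.keys T" "(a', b') \<in> Poly_Mapping.keys T" using b b' by (auto simp: in_keys_iff)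
    then have "\<not> (a < a' \<and> b < b')" using ac unfolding antichain_def by blast
    then show False using a(1) a'(1) b(1) b'(1) by auto
  qed
  then have "NW = (NW + NE) + (NW + SW) - (NW + NE + SW + SE)" by auto
  then show ?thesis unfolding R K tot NW_def[symmetric] .
qed

text \<open>The northwest sums depend on the row and column sums only, and the entries are their
  second differences.\<close>

lemma antichain_unique:
  assumes T: "T \<in> monoms n" "antichain (Poly_Mapping.keys T)"
    and U: "U \<in> monoms n" "antichain (Poly_Mapping.keys U)"
    and eq: "\<And>i. rowsum n T i = rowsum n U i" "\<And>j. colsum n T j = colsum n U j"
  shows "T = U"
proof (rule poly_mapping_eqI)
  fix v :: "nat \<times> nat"
  obtain i j where v: "v = (i, j)" by (cases v)
  let ?N = "\<lambda>T i j. \<Sum>a\<in>{1..i}. \<Sum>b\<in>{1..j}. Poly_Mapping.lookup T (a, b)"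
  have N: "?N T i j = ?N U i j" if "i \<le> n" "j \<le> n" for i j
    using antichain_northwest_sum[OF T(2) that] antichain_northwest_sum[OF U(2) that] eq by simp
  show "Poly_Mapping.lookup T v = Poly_Mapping.lookup U v"
  proof (cases "v \<in> {1..n} \<times> {1..n}")
    case False
    then have "v \<notin> Poly_Mapping.keys T" "v \<notin> Poly_Mapping.keys U" using T(1) U(1) by (auto simp: monoms_def)
    then show ?thesis by (simp add: in_keys_iff)
  next
    case True
    then obtain i' j' where ij: "i = Suc i'" "j = Suc j'" unfolding v by (cases i; cases j) auto
    have le: "Suc i' \<le> n" "Suc j' \<le> n" using True by (auto simp: v ij)
    have row: "?N T (Suc i') m = ?N T i' m + (\<Sum>b\<in>{1..m}. Poly_Mapping.lookup T (Suc i', b))" for T m by simp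
    have "(\<Sum>b\<in>{1..m}. Poly_Mapping.lookup T (Suc i', b)) = (\<Sum>b\<in>{1..m}. Poly_Mapping.lookup U (Suc i', b))"
      if "m \<le> n" for m
      using N[OF le(1) that] N[of i' m] that le(1) unfolding row by simp
    from this[of "Suc j'"] this[of j'] le show ?thesis unfolding v ij by simp
  qed
qed

text \<open>Row sums bound the entries. Finiteness is what lets a least monomial be chosen without a
  well-ordering argument.\<close>

lemma finite_margins:
  "finite {T \<in> monoms n. \<forall>i. rowsum n T i = rowsum n M i}"
proof -
  let ?B = "\<Sum>i\<in>{1..n}. rowsum n M i" and ?S = "{T \<in> monoms n. \<forall>i. rowsum n T i = rowsum n M i}"
  have "Poly_Mapping.lookup ` ?S \<subseteq> {f. \<forall>v. (v \<in> {1..n} \<times> {1..n} \<longrightarrow> f v \<in> {..?B}) \<and> (v \<notin> {1..n} \<times> {1..n} \<longrightarrow> f v = 0)}"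
  proof (rule image_subsetI, rule CollectI, intro allI conjI impI)
    fix T v assume T: "T \<in> ?S" and v: "v \<in> {1..n} \<times> {1..n}"
    have "Poly_Mapping.lookup T v = Poly_Mapping.lookup T (fst v, snd v)" by simp
    also have "\<dots> \<le> rowsum n T (fst v)"
      unfolding rowsum_def using v by (intro member_le_sum[of "snd v" _ "\<lambda>j. Poly_Mapping.lookup T (fst v, j)"]) auto
    also have "\<dots> = rowsum n M (fst v)" using T by simp
    also have "\<dots> \<le> ?B" using v by (intro member_le_sum) auto
    finally show "Poly_Mapping.lookup T v \<in> {..?B}" by simp
  next
    fix T v assume T: "T \<in> ?S" and v: "v \<notin> {1..n} \<times> {1..n}"
    then have "v \<notin> Poly_Mapping.keys T" unfolding monoms_def by blast
    then show "Poly_Mapping.lookup T v = 0" by (simp add: in_keys_iff)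
  qed
  moreover have "finite {f. \<forall>v. (v \<in> {1..n} \<times> {1..n} \<longrightarrow> f v \<in> {..?B}) \<and> (v \<notin> {1..n} \<times> {1..n} \<longrightarrow> f v = (0::nat))}"
    by (rule finite_set_of_finite_funs) auto
  ultimately have fin: "finite (Poly_Mapping.lookup ` ?S)" by (rule finite_subset)
  have "inj_on Poly_Mapping.lookup ?S" by (rule inj_onI) (simp only: poly_mapping_eq_iff)
  then show ?thesis by (rule finite_imageD[OF fin])
qed

text \<open>The comparison of the two terms of each 2 by 2 minor, seen as an exchange that keeps all
  row and column sums.\<close>

definition swap_reducing :: "nat \<Rightarrow> (monom \<times> monom) set \<Rightarrow> bool" where
  "swap_reducing n r \<longleftrightarrow> (\<forall>i i' j j'. 1 \<le> i \<and> i < i' \<and> i' \<le> n \<and> 1 \<le> j \<and> j < j' \<and> j' \<le> n \<longrightarrow>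
     (Poly_Mapping.single (i, j') 1 + Poly_Mapping.single (i', j) 1,
      Poly_Mapping.single (i, j) 1 + Poly_Mapping.single (i', j') 1) \<in> r)"

lemma single_mem_monoms: "v \<in> {1..n} \<times> {1..n} \<Longrightarrow> Poly_Mapping.single v c \<in> monoms n"
  by (auto simp: monoms_def)

lemma remove_key:
  assumes "v \<in> Poly_Mapping.keys (T :: monom)"
  shows "T - Poly_Mapping.single v 1 + Poly_Mapping.single v 1 = T"
  by (rule poly_mapping_eqI) (use assms in \<open>auto simp: lookup_add lookup_minus lookup_single when_def in_keys_iff\<close>)

lemma keys_minus_subset: "Poly_Mapping.keys (T - U :: monom) \<subseteq> Poly_Mapping.keys T"
  by (auto simp: in_keys_iff lookup_minus)

context term_ord
begin

text \<open>Take a least monomial with these margins. Two cells of its support in strict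
  northwest-southeast position could be exchanged for the antidiagonal pair, giving a smaller
  monomial; so its support is an antichain, and the margins identify it with
  \<open>M\<close>.\<close>

lemma antichain_least:
  assumes swap: "swap_reducing n r"
    and M: "M \<in> monoms n" "antichain (Poly_Mapping.keys M)"
    and T: "T \<in> monoms n" "\<And>i. rowsum n T i = rowsum n M i" "\<And>j. colsum n T j = colsum n M j"
  shows "(M, T) \<in> r"
proof -
  let ?S = "{T \<in> monoms n. (\<forall>i. rowsum n T i = rowsum n M i) \<and> (\<forall>j. colsum n T j = colsum n M j)}"
  have "finite ?S" by (rule finite_subset[OF _ finite_margins[of n M]]) auto
  moreover have "T \<in> ?S" using T by auto
  ultimately obtain U where U: "U \<in> ?S" "\<And>V. V \<in> ?S \<Longrightarrow> (U, V) \<in> r"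
    using exists_min[of ?S] by auto
  have "antichain (Poly_Mapping.keys U)"
  proof (rule ccontr)
    assume "\<not> antichain (Poly_Mapping.keys U)"
    then obtain i j i' j' where k: "(i, j) \<in> Poly_Mapping.keys U" "(i', j') \<in> Poly_Mapping.keys U" "i < i'" "j < j'"
      unfolding antichain_def by auto
    have "Poly_Mapping.keys U \<subseteq> {1..n} \<times> {1..n}" using U(1) by (auto simp: monoms_def)
    then have b: "i \<in> {1..n}" "j \<in> {1..n}" "i' \<in> {1..n}" "j' \<in> {1..n}" using k by auto
    define W where "W = U - Poly_Mapping.single (i, j) 1 - Poly_Mapping.single (i', j') 1"
    define D where "D = Poly_Mapping.single (i, j) 1 + Poly_Mapping.single (i', j') (1::nat)"
    define A where "A = Poly_Mapping.single (i, j') 1 + Poly_Mapping.single (i', j) (1::nat)"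
    have "(i', j') \<in> Poly_Mapping.keys (U - Poly_Mapping.single (i, j) 1)"
      using k by (auto simp: in_keys_iff lookup_minus lookup_single when_def)
    then have "U = W + Poly_Mapping.single (i', j') 1 + Poly_Mapping.single (i, j) 1"
      unfolding W_def by (simp only: remove_key k(1))
    then have WD: "U = W + D" unfolding D_def by (simp only: add_ac)
    have W: "W \<in> monoms n"
      using U(1) keys_minus_subset unfolding W_def monoms_def by blast
    have A: "A \<in> monoms n" unfolding A_def using b by (intro monoms_add single_mem_monoms) auto
    have "(A, D) \<in> r" using swap k b unfolding swap_reducing_def A_def D_def by auto
    then have "(A + W, D + W) \<in> r" using W by (rule r_add)
    then have AW: "(A + W, U) \<in> r" unfolding WD by (simp add: add.commute)
    have "A + W \<in> ?S"
    proof -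
      have "rowsum n A x = rowsum n D x" "colsum n A x = colsum n D x" for x
        unfolding A_def D_def rowsum_add colsum_add using b by (simp_all add: rowsum_single colsum_single)
      then have "rowsum n (A + W) x = rowsum n U x" "colsum n (A + W) x = colsum n U x" for x
        unfolding WD rowsum_add colsum_add by simp_all
      then show ?thesis using U(1) monoms_add[OF A W] by simp
    qed
    then have "A + W = U" using U(2) AW r_antisym by blast
    then have "A = D" unfolding WD by (simp add: add.commute)
    then have "Poly_Mapping.lookup A (i, j) = Poly_Mapping.lookup D (i, j)" by simp
    then show False using k unfolding A_def D_def by (simp add: lookup_add lookup_single when_def)
  qed
  then have "U = M" using U(1) M by (intro antichain_unique[of U n M]) auto
  then show ?thesis using U(2) \<open>T \<in> ?S\<close> by blast
qed

end

section \<open>Polynomial matrices with prescribed ranks\<close>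

type_synonym expo = "(nat \<times> nat + nat \<times> nat) \<Rightarrow>\<^sub>0 nat"

definition bexp :: "nat \<Rightarrow> nat \<times> nat \<Rightarrow> expo" where
  "bexp s v = Poly_Mapping.single (Inl (s, fst v)) 1 + Poly_Mapping.single (Inr (s, snd v)) 1"

text \<open>A sum over \<open>s\<close> of matrices of rank 1 with entries \<open>\<alpha> (s, i) * \<beta> (s, j)\<close>, where the
  \<open>\<alpha>\<close>'s and \<open>\<beta>\<close>'s are the variables \<open>Inl\<close> and \<open>Inr\<close>, each truncated to 0 in the region \<open>D s\<close>.\<close>

definition param :: "nat \<Rightarrow> (nat \<Rightarrow> (nat \<times> nat) set) \<Rightarrow> nat \<times> nat \<Rightarrow> expo \<Rightarrow>\<^sub>0 'k::field" where
  "param n D v = (\<Sum>s\<in>{s \<in> {1..n}. v \<notin> D s}. Poly_Mapping.single (bexp s v) 1)"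

section \<open>Expansion of monomials at the parametrized matrix\<close>

lemma lookup_bexp:
  "Poly_Mapping.lookup (bexp s v) (Inl (t, i)) = (if t = s \<and> i = fst v then 1 else 0)"
  "Poly_Mapping.lookup (bexp s v) (Inr (t, i)) = (if t = s \<and> i = snd v then 1 else 0)"
  by (auto simp: bexp_def lookup_add lookup_single when_def)

lemma monoms_induct [consumes 1, case_names zero add]:
  assumes "m \<in> monoms n" "P 0"
    and step: "\<And>m v. m \<in> monoms n \<Longrightarrow> v \<in> {1..n} \<times> {1..n} \<Longrightarrow> P m \<Longrightarrow> P (m + Poly_Mapping.single v 1)"
  shows "P m"
  using assms(1)
proof (induction "\<Sum>v\<in>Poly_Mapping.keys m. Poly_Mapping.lookup m v" arbitrary: m rule: less_induct)
  case less
  show ?case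
  proof (cases "m = 0")
    case True
    then show ?thesis using assms(2) by simp
  next
    case False
    then obtain v where v: "v \<in> Poly_Mapping.keys m"
      by (metis ex_in_conv keys_eq_empty)
    let ?m = "m - Poly_Mapping.single v 1"
    have eq: "?m + Poly_Mapping.single v 1 = m" using remove_key[OF v] .
    have mem: "?m \<in> monoms n" using less.prems keys_minus_subset[of m] unfolding monoms_def by blast
    have "(\<Sum>u\<in>Poly_Mapping.keys ?m. Poly_Mapping.lookup ?m u) = (\<Sum>u\<in>Poly_Mapping.keys m. Poly_Mapping.lookup ?m u)"
      using keys_minus_subset[of m] by (intro sum.mono_neutral_left) (auto simp: in_keys_iff)
    also have "\<dots> < (\<Sum>u\<in>Poly_Mapping.keys m. Poly_Mapping.lookup m u)"
      using v by (intro sum_strict_mono2[where b = v] sum_strict_mono_ex1)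
        (auto simp: lookup_minus lookup_single when_def in_keys_iff intro!: bexI[of _ v])
    finally have "P ?m" using less.hyps mem by blast
    moreover have "v \<in> {1..n} \<times> {1..n}" using v less.prems by (auto simp: monoms_def)
    ultimately show ?thesis using step[OF mem] eq by metis
  qed
qed

text \<open>A term of the expanded product chooses a summand \<open>s\<close> of the matrix entry
  for every variable factor of \<open>m\<close>. \<open>T s\<close> collects the factors that chose
  \<open>s\<close>; the exponent \<open>E\<close> remembers only the row and column sums of each
  \<open>T s\<close>.\<close>

definition splits :: "nat \<Rightarrow> monom \<Rightarrow> expo \<Rightarrow> (nat \<Rightarrow> monom) \<Rightarrow> bool" where
  "splits n m E T \<longleftrightarrow> (\<forall>s. T s \<in> monoms n) \<and> m = (\<Sum>s\<in>{1..n}. T s) \<and>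
    (\<forall>s\<in>{1..n}. \<forall>i. Poly_Mapping.lookup E (Inl (s, i)) = rowsum n (T s) i \<and>
       Poly_Mapping.lookup E (Inr (s, i)) = colsum n (T s) i)"

lemma zero_mem_monoms: "0 \<in> monoms n"
  by (simp add: monoms_def)

lemma splits_add:
  assumes T: "splits n m E T" and s: "s \<in> {1..n}" and v: "v \<in> {1..n} \<times> {1..n}"
  shows "splits n (m + Poly_Mapping.single v 1) (E + bexp s v)
    (\<lambda>t. T t + (if t = s then Poly_Mapping.single v 1 else 0))"
  unfolding splits_def
proof (intro conjI allI ballI)
  let ?T = "\<lambda>t. T t + (if t = s then Poly_Mapping.single v 1 else 0)"
  show "?T t \<in> monoms n" for t
    using T single_mem_monoms[OF v] zero_mem_monoms by (auto simp: splits_def intro: monoms_add)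
  have "(\<Sum>t\<in>{1..n}. ?T t) = (\<Sum>t\<in>{1..n}. T t) + Poly_Mapping.single v 1"
    using s by (simp add: sum.distrib)
  moreover have "m = (\<Sum>t\<in>{1..n}. T t)" using T unfolding splits_def by blast
  ultimately show "m + Poly_Mapping.single v 1 = (\<Sum>t\<in>{1..n}. ?T t)" by simp
  fix t i assume "t \<in> {1..n}"
  then have E: "Poly_Mapping.lookup E (Inl (t, i)) = rowsum n (T t) i"
    "Poly_Mapping.lookup E (Inr (t, i)) = colsum n (T t) i" using T unfolding splits_def by blast+
  have z: "rowsum n 0 i = 0" "colsum n 0 i = 0" by (simp_all add: rowsum_def colsum_def)
  show "Poly_Mapping.lookup (E + bexp s v) (Inl (t, i)) = rowsum n (?T t) i"
    by (cases "t = s") (use E in \<open>simp_all add: lookup_add lookup_bexp rowsum_add rowsum_single[OF v] z del: One_nat_def\<close>)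
  show "Poly_Mapping.lookup (E + bexp s v) (Inr (t, i)) = colsum n (?T t) i"
    by (cases "t = s") (use E in \<open>simp_all add: lookup_add lookup_bexp colsum_add colsum_single[OF v] z del: One_nat_def\<close>)
qed

lemma keys_param:
  assumes "E \<in> Poly_Mapping.keys (param n D v :: expo \<Rightarrow>\<^sub>0 'k::field)"
  shows "\<exists>s\<in>{1..n}. E = bexp s v"
proof -
  have "E \<in> (\<Union>s\<in>{s \<in> {1..n}. v \<notin> D s}. Poly_Mapping.keys (Poly_Mapping.single (bexp s v) (1::'k)))"
    by (rule subsetD[OF Poly_Mapping.keys_sum assms[unfolded param_def]])
  then show ?thesis by auto
qed

lemma keys_meval_param:
  assumes "m \<in> monoms n" "E \<in> Poly_Mapping.keys (meval (param n D :: _ \<Rightarrow> expo \<Rightarrow>\<^sub>0 'k::field) m)"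
  shows "\<exists>T. splits n m E T"
  using assms
proof (induction m arbitrary: E rule: monoms_induct)
  case zero
  then have "E = 0" by simp
  then have "splits n 0 E (\<lambda>_. 0)" by (simp add: splits_def zero_mem_monoms rowsum_def colsum_def)
  then show ?case by blast
next
  case (add m v)
  let ?x = "param n D :: _ \<Rightarrow> expo \<Rightarrow>\<^sub>0 'k"
  have "E \<in> Poly_Mapping.keys (meval ?x m * ?x v)" using add.prems by (simp add: meval_add)
  then obtain E1 E2 where E: "E1 \<in> Poly_Mapping.keys (meval ?x m)" "E2 \<in> Poly_Mapping.keys (?x v)" "E = E1 + E2"
    using Poly_Mapping.keys_mult by blast
  obtain s where s: "s \<in> {1..n}" "E2 = bexp s v" using keys_param[OF E(2)] by blast
  obtain T where "splits n m E1 T" using add.IH[OF E(1)] by blast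
  from splits_add[OF this s(1) add.hyps(2)] show ?case unfolding E(3) s(2) by blast
qed

definition level :: "(nat \<times> nat \<Rightarrow> nat) \<Rightarrow> monom \<Rightarrow> nat \<Rightarrow> monom" where
  "level h m s = (\<Sum>v\<in>{v \<in> Poly_Mapping.keys m. h v = s}. Poly_Mapping.single v (Poly_Mapping.lookup m v))"

lemma lookup_level: "Poly_Mapping.lookup (level h m s) v = (if h v = s then Poly_Mapping.lookup m v else 0)"
proof -
  have "Poly_Mapping.lookup (level h m s) v =
      (\<Sum>u\<in>{u \<in> Poly_Mapping.keys m. h u = s}. if u = v then Poly_Mapping.lookup m v else 0)"
    unfolding level_def lookup_sum by (rule sum.cong) (auto simp: lookup_single when_def)
  then show ?thesis by (auto simp: in_keys_iff)
qed

lemma keys_level: "Poly_Mapping.keys (level h m s) = {v \<in> Poly_Mapping.keys m. h v = s}"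
  by (auto simp: in_keys_iff lookup_level split: if_splits)

lemma sum_level:
  assumes "\<And>v. v \<in> Poly_Mapping.keys m \<Longrightarrow> h v \<in> {1..n}"
  shows "(\<Sum>s\<in>{1..n}. level h m s) = m"
proof (rule poly_mapping_eqI)
  fix v
  have "Poly_Mapping.lookup (\<Sum>s\<in>{1..n}. level h m s) v
      = (\<Sum>s\<in>{1..n}. if s = h v then Poly_Mapping.lookup m v else 0)"
    unfolding lookup_sum lookup_level by (rule sum.cong) auto
  also have "\<dots> = (if h v \<in> {1..n} then Poly_Mapping.lookup m v else 0)" by simp
  also have "\<dots> = Poly_Mapping.lookup m v"
    using assms[of v] by (cases "v \<in> Poly_Mapping.keys m") (auto simp: in_keys_iff)
  finally show "Poly_Mapping.lookup (\<Sum>s\<in>{1..n}. level h m s) v = Poly_Mapping.lookup m v" .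
qed

text \<open>The exponent of the term in which every cell \<open>v\<close> chooses the summand
  \<open>h v\<close>.\<close>

definition hexp :: "nat \<Rightarrow> (nat \<times> nat \<Rightarrow> nat) \<Rightarrow> monom \<Rightarrow> expo" where
  "hexp n h m = (\<Sum>v\<in>{1..n} \<times> {1..n}. Poly_Mapping.single (Inl (h v, fst v)) (Poly_Mapping.lookup m v)
     + Poly_Mapping.single (Inr (h v, snd v)) (Poly_Mapping.lookup m v))"

lemma hexp_0: "hexp n h 0 = 0"
  by (simp add: hexp_def)

lemma hexp_add_single:
  assumes "v \<in> {1..n} \<times> {1..n}"
  shows "hexp n h (m + Poly_Mapping.single v 1) = hexp n h m + bexp (h v) v"
proof -
  let ?f = "\<lambda>u c. Poly_Mapping.single (Inl (h u, fst u)) c + Poly_Mapping.single (Inr (h u, snd u)) (c::nat)"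
  have "hexp n h (m + Poly_Mapping.single v 1)
      = (\<Sum>u\<in>{1..n} \<times> {1..n}. ?f u (Poly_Mapping.lookup m u) + (if u = v then bexp (h v) v else 0))"
    unfolding hexp_def
    by (rule sum.cong) (auto simp: lookup_add single_add lookup_single when_def bexp_def add_ac)
  also have "\<dots> = hexp n h m + bexp (h v) v"
    using assms by (simp add: sum.distrib hexp_def)
  finally show ?thesis .
qed

lemma lookup_hexp:
  assumes "m \<in> monoms n"
  shows "Poly_Mapping.lookup (hexp n h m) (Inl (s, i)) = rowsum n (level h m s) i"
    and "Poly_Mapping.lookup (hexp n h m) (Inr (s, i)) = colsum n (level h m s) i"
proof -
  have out: "Poly_Mapping.lookup m v = 0" if "v \<notin> {1..n} \<times> {1..n}" for v
    using assms that unfolding monoms_def by (metis (no_types, lifting) in_keys_iff mem_Collect_eq subsetD)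
  let ?c = "\<lambda>a b. if h (a, b) = s then Poly_Mapping.lookup m (a, b) else 0"
  have "Poly_Mapping.lookup (hexp n h m) (Inl (s, i)) = (\<Sum>(a, b)\<in>{1..n} \<times> {1..n}. if a = i then ?c a b else 0)"
    unfolding hexp_def lookup_sum by (rule sum.cong) (auto simp: lookup_add lookup_single when_def)
  also have "\<dots> = (\<Sum>a\<in>{1..n}. \<Sum>b\<in>{1..n}. if a = i then ?c a b else 0)"
    by (rule sum.cartesian_product[symmetric])
  also have "\<dots> = (\<Sum>a\<in>{1..n}. if a = i then (\<Sum>b\<in>{1..n}. ?c i b) else 0)"
    by (intro sum.cong) auto
  also have "\<dots> = (if i \<in> {1..n} then (\<Sum>b\<in>{1..n}. ?c i b) else 0)" by simp
  also have "\<dots> = rowsum n (level h m s) i"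
    unfolding rowsum_def lookup_level using out by (auto intro!: sum.neutral[symmetric])
  finally show "Poly_Mapping.lookup (hexp n h m) (Inl (s, i)) = rowsum n (level h m s) i" .
  have "Poly_Mapping.lookup (hexp n h m) (Inr (s, i)) = (\<Sum>(a, b)\<in>{1..n} \<times> {1..n}. if b = i then ?c a b else 0)"
    unfolding hexp_def lookup_sum by (rule sum.cong) (auto simp: lookup_add lookup_single when_def)
  also have "\<dots> = (\<Sum>a\<in>{1..n}. \<Sum>b\<in>{1..n}. if b = i then ?c a b else 0)"
    by (rule sum.cartesian_product[symmetric])
  also have "\<dots> = (\<Sum>a\<in>{1..n}. if i \<in> {1..n} then ?c a i else 0)"
    by (intro sum.cong refl) simp
  also have "\<dots> = colsum n (level h m s) i"
    unfolding colsum_def lookup_level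
  proof (rule sum.cong[OF refl])
    fix a
    show "(if i \<in> {1..n} then ?c a i else 0) = ?c a i" using out[of "(a, i)"] by auto
  qed
  finally show "Poly_Mapping.lookup (hexp n h m) (Inr (s, i)) = colsum n (level h m s) i" .
qed

lemma lookup_times_single:
  fixes p :: "'a::cancel_comm_monoid_add \<Rightarrow>\<^sub>0 'k::comm_ring_1"
  shows "Poly_Mapping.lookup (p * Poly_Mapping.single e 1) (E + e) = Poly_Mapping.lookup p E"
proof -
  have p: "p = (\<Sum>k\<in>Poly_Mapping.keys p. Poly_Mapping.single k (Poly_Mapping.lookup p k))"
    by (rule poly_mapping_sum_single)
  have "p * Poly_Mapping.single e 1 = (\<Sum>k\<in>Poly_Mapping.keys p. Poly_Mapping.single (k + e) (Poly_Mapping.lookup p k))"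
    by (subst p) (simp add: sum_distrib_right mult_single)
  then have "Poly_Mapping.lookup (p * Poly_Mapping.single e 1) (E + e)
      = (\<Sum>k\<in>Poly_Mapping.keys p. if k = E then Poly_Mapping.lookup p E else 0)"
    by (simp only: lookup_sum) (rule sum.cong, auto simp: lookup_single when_def)
  then show ?thesis by (simp add: in_keys_iff)
qed

lemma lookup_const_times:
  "Poly_Mapping.lookup (Poly_Mapping.single 0 c * p) E = c * Poly_Mapping.lookup p E"
  by (simp flip: mult_map_scale_conv_mult add: map.rep_eq when_def)

lemma antichain_subset: "antichain S \<Longrightarrow> S' \<subseteq> S \<Longrightarrow> antichain S'"
  unfolding antichain_def by blast

context term_ord
begin

text \<open>Each level of \<open>m\<close> is supported on an antichain and so is least among the
  monomials with its margins. Adding the levels gives the comparison, and the equality case of the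
  sum fixes every level.\<close>

lemma splits_hexp:
  assumes swap: "swap_reducing n r" and m: "m \<in> monoms n"
    and h: "\<And>v. v \<in> Poly_Mapping.keys m \<Longrightarrow> h v \<in> {1..n}"
    and ac: "\<And>s. antichain {v \<in> Poly_Mapping.keys m. h v = s}"
    and T: "splits n m' (hexp n h m) T"
  shows "(m, m') \<in> r" and "m' = m \<Longrightarrow> s \<in> {1..n} \<Longrightarrow> T s = level h m s"
proof -
  have lev: "level h m s \<in> monoms n" for s
    using m unfolding monoms_def mem_Collect_eq keys_level by blast
  have le: "(level h m s, T s) \<in> r" if "s \<in> {1..n}" for s
  proof (rule antichain_least[OF swap lev])
    show "antichain (Poly_Mapping.keys (level h m s))" unfolding keys_level by (rule ac)
    show "T s \<in> monoms n" using T by (simp add: splits_def)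
    show "rowsum n (T s) i = rowsum n (level h m s) i" "colsum n (T s) i = colsum n (level h m s) i" for i
      using T that lookup_hexp[OF m, of h s i] by (simp_all add: splits_def)
  qed
  have m': "m' = (\<Sum>s\<in>{1..n}. T s)" using T by (simp add: splits_def)
  have sl: "(\<Sum>s\<in>{1..n}. level h m s) = m" by (rule sum_level) (rule h)
  have "(\<Sum>s\<in>{1..n}. level h m s, \<Sum>s\<in>{1..n}. T s) \<in> r" by (rule r_sum_mono) (rule le)
  then show "(m, m') \<in> r" unfolding sl m' .
  show "T s = level h m s" if "m' = m" "s \<in> {1..n}"
    using r_sum_eq[of "{1..n}" "level h m" T s] le sl m' that by simp
qed

text \<open>Induction on the factors: if the factor \<open>v\<close> chose a summand
  \<open>s\<close> other than \<open>h v\<close>, the result would be a split of the same monomial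
  with the same exponent, hence the level decomposition, although its part \<open>s\<close> contains
  \<open>v\<close>. Only one choice is left.\<close>

lemma coeff_hexp:
  assumes swap: "swap_reducing n r" and "m \<in> monoms n"
    and "\<And>v. v \<in> Poly_Mapping.keys m \<Longrightarrow> h v \<in> {1..n} \<and> v \<notin> D (h v)"
    and "\<And>s. antichain {v \<in> Poly_Mapping.keys m. h v = s}"
  shows "Poly_Mapping.lookup (meval (param n D :: _ \<Rightarrow> expo \<Rightarrow>\<^sub>0 'k::field) m) (hexp n h m) = 1"
  using assms(2-)
proof (induction m rule: monoms_induct)
  case zero
  then show ?case by (simp add: hexp_0 lookup_one)
next
  case (add m v)
  let ?x = "param n D :: _ \<Rightarrow> expo \<Rightarrow>\<^sub>0 'k" and ?m = "m + Poly_Mapping.single v 1"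
  let ?S = "{s \<in> {1..n}. v \<notin> D s}" and ?E = "hexp n h ?m"
  have keys: "Poly_Mapping.keys m \<subseteq> Poly_Mapping.keys ?m" "v \<in> Poly_Mapping.keys ?m"
    by (auto simp: in_keys_iff lookup_add)
  have IH: "Poly_Mapping.lookup (meval ?x m) (hexp n h m) = 1"
  proof (rule add.IH)
    show "h u \<in> {1..n} \<and> u \<notin> D (h u)" if "u \<in> Poly_Mapping.keys m" for u
      using add.prems(1) keys that by blast
    show "antichain {u \<in> Poly_Mapping.keys m. h u = s}" for s
      by (rule antichain_subset[OF add.prems(2)[of s]]) (use keys in blast)
  qed
  have hv: "h v \<in> {1..n}" "v \<notin> D (h v)" using add.prems(1)[OF keys(2)] by auto
  have E: "?E = hexp n h m + bexp (h v) v" by (rule hexp_add_single) (rule add.hyps)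
  have mem: "?m \<in> monoms n" using add.hyps by (intro monoms_add single_mem_monoms)
  have other: "Poly_Mapping.lookup (meval ?x m * Poly_Mapping.single (bexp s v) 1) ?E = 0"
    if s: "s \<in> {1..n}" "s \<noteq> h v" for s
  proof (rule ccontr)
    assume "Poly_Mapping.lookup (meval ?x m * Poly_Mapping.single (bexp s v) 1) ?E \<noteq> 0"
    then have "?E \<in> Poly_Mapping.keys (meval ?x m * Poly_Mapping.single (bexp s v) 1)" by (simp add: in_keys_iff)
    then obtain E1 E2 where E1: "E1 \<in> Poly_Mapping.keys (meval ?x m)"
        "E2 \<in> Poly_Mapping.keys (Poly_Mapping.single (bexp s v) (1::'k))" "?E = E1 + E2"
      using Poly_Mapping.keys_mult by blast
    then have eq: "?E = E1 + bexp s v" by (simp split: if_splits)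
    obtain T where T: "splits n m E1 T" using keys_meval_param[OF add.hyps(1) E1(1)] by blast
    let ?T = "\<lambda>t. T t + (if t = s then Poly_Mapping.single v 1 else 0)"
    have "splits n ?m ?E ?T" unfolding eq by (rule splits_add[OF T s(1) add.hyps(2)])
    then have "?T s = level h ?m s"
      using s add.prems by (intro splits_hexp(2)[OF swap mem]) auto
    then have "Poly_Mapping.lookup (?T s) v = Poly_Mapping.lookup (level h ?m s) v" by simp
    then show False using s(2) by (simp add: lookup_add lookup_level)
  qed
  have "meval ?x ?m = (\<Sum>s\<in>?S. meval ?x m * Poly_Mapping.single (bexp s v) 1)"
    by (simp add: meval_add param_def sum_distrib_left)
  then have "Poly_Mapping.lookup (meval ?x ?m) ?E
      = (\<Sum>s\<in>?S. Poly_Mapping.lookup (meval ?x m * Poly_Mapping.single (bexp s v) 1) ?E)"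
    by (simp only: lookup_sum)
  also have "\<dots> = (\<Sum>s\<in>?S. if s = h v then 1 else 0)"
  proof (rule sum.cong[OF refl])
    fix s assume "s \<in> ?S"
    then show "Poly_Mapping.lookup (meval ?x m * Poly_Mapping.single (bexp s v) 1) ?E = (if s = h v then 1 else 0)"
      using other[of s] IH unfolding E by (auto simp: lookup_times_single)
  qed
  \<comment> \<open>The summand \<open>h v\<close> is present because \<open>v\<close> lies outside
    \<open>D (h v)\<close>.\<close>
  also have "\<dots> = 1" using hv by simp
  finally show ?case .
qed

text \<open>The exponent \<open>hexp n h m\<close> occurs in the expansion of a monomial
  \<open>u\<close> only if \<open>m\<close> is at most \<open>u\<close>, whereas all monomials of
  \<open>f\<close> are at most \<open>m\<close>. So only the leading monomial contributes.\<close>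

lemma peval_param_nonzero:
  fixes f :: "'k::field mpol"
  assumes swap: "swap_reducing n r" and f: "f \<noteq> 0" "Poly_Mapping.keys f \<subseteq> monoms n"
    and m: "m = leading_monom r f"
    and h: "\<And>v. v \<in> Poly_Mapping.keys m \<Longrightarrow> h v \<in> {1..n} \<and> v \<notin> D (h v)"
    and ac: "\<And>s. antichain {v \<in> Poly_Mapping.keys m. h v = s}"
  shows "peval (Poly_Mapping.single 0) (param n D) f \<noteq> 0"
proof -
  let ?x = "param n D :: _ \<Rightarrow> expo \<Rightarrow>\<^sub>0 'k" and ?E = "hexp n h m"
  note lm = leading_monom[OF f, folded m]
  have mem: "m \<in> monoms n" using lm(1) f(2) by blast
  have "Poly_Mapping.lookup (peval (Poly_Mapping.single 0) ?x f) ?E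
      = (\<Sum>u\<in>Poly_Mapping.keys f. Poly_Mapping.lookup f u * Poly_Mapping.lookup (meval ?x u) ?E)"
    by (simp add: peval_def lookup_sum lookup_const_times)
  also have "\<dots> = (\<Sum>u\<in>Poly_Mapping.keys f. if u = m then Poly_Mapping.lookup f m else 0)"
  proof (rule sum.cong[OF refl])
    fix u assume u: "u \<in> Poly_Mapping.keys f"
    show "Poly_Mapping.lookup f u * Poly_Mapping.lookup (meval ?x u) ?E = (if u = m then Poly_Mapping.lookup f m else 0)"
    proof (cases "u = m")
      case True
      have "Poly_Mapping.lookup (meval ?x m) ?E = 1" by (rule coeff_hexp[OF swap mem]) (use h ac in auto)
      then show ?thesis using True by simp
    next
      case False
      have "?E \<notin> Poly_Mapping.keys (meval ?x u)"
      proof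
        assume "?E \<in> Poly_Mapping.keys (meval ?x u)"
        then obtain T where T: "splits n u ?E T" using keys_meval_param u f(2) by blast
        have "(m, u) \<in> r" by (rule splits_hexp(1)[OF swap mem _ ac T]) (use h in blast)
        then show False using lm(2)[OF u] r_antisym False by blast
      qed
      then show ?thesis using False by (simp add: in_keys_iff)
    qed
  qed
  also have "\<dots> = Poly_Mapping.lookup f m" using lm(1) by simp
  finally have "Poly_Mapping.lookup (peval (Poly_Mapping.single 0) ?x f) ?E \<noteq> 0"
    using lm(1) by (simp add: in_keys_iff)
  then show ?thesis by auto
qed

end

section \<open>Ideals of polynomials\<close>

lemma keys_zvar_monoms:
  "v \<in> {1..n} \<times> {1..n} \<Longrightarrow> Poly_Mapping.keys (zvar v :: 'k::field mpol) \<subseteq> monoms n"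
  using single_mem_monoms[of v n 1] by (simp add: zvar_def)

lemma keys_add_monoms:
  "Poly_Mapping.keys f \<subseteq> monoms n \<Longrightarrow> Poly_Mapping.keys g \<subseteq> monoms n \<Longrightarrow>
    Poly_Mapping.keys (f + g :: 'k::field mpol) \<subseteq> monoms n"
  using Poly_Mapping.keys_add[of f g] by blast

lemma keys_mult_monoms:
  assumes "Poly_Mapping.keys f \<subseteq> monoms n" "Poly_Mapping.keys g \<subseteq> monoms n"
  shows "Poly_Mapping.keys (f * g :: 'k::field mpol) \<subseteq> monoms n"
proof
  fix m assume "m \<in> Poly_Mapping.keys (f * g)"
  then obtain u v where "m = u + v" "u \<in> Poly_Mapping.keys f" "v \<in> Poly_Mapping.keys g"
    using Poly_Mapping.keys_mult[of f g] by blast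
  then show "m \<in> monoms n" using assms monoms_add[of u n v] by blast
qed

lemma keys_one_monoms: "Poly_Mapping.keys (1 :: 'k::field mpol) \<subseteq> monoms n"
  by (simp add: zero_mem_monoms)

lemma keys_uminus_monoms:
  "Poly_Mapping.keys f \<subseteq> monoms n \<Longrightarrow> Poly_Mapping.keys (- f :: 'k::field mpol) \<subseteq> monoms n"
  by (auto simp: in_keys_iff)

lemma keys_prod_subset_monoms:
  fixes f :: "'i \<Rightarrow> 'k::field mpol"
  assumes "\<And>i. i \<in> I \<Longrightarrow> Poly_Mapping.keys (f i) \<subseteq> monoms n"
  shows "Poly_Mapping.keys (prod f I) \<subseteq> monoms n"
  using assms by (induction I rule: infinite_finite_induct)
    (simp_all add: keys_mult_monoms zero_mem_monoms)

lemma keys_sum_subset_monoms: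
  fixes f :: "'i \<Rightarrow> 'k::field mpol"
  assumes "\<And>i. i \<in> I \<Longrightarrow> Poly_Mapping.keys (f i) \<subseteq> monoms n"
  shows "Poly_Mapping.keys (sum f I) \<subseteq> monoms n"
  using assms by (induction I rule: infinite_finite_induct)
    (simp_all add: keys_add_monoms)

lemma index_seq_mem: "index_seq s p a \<Longrightarrow> i < s \<Longrightarrow> a i \<in> {1..p}"
  by (auto simp: index_seq_def)

lemma keys_minor:
  assumes "index_seq s n a" "index_seq s n b"
  shows "Poly_Mapping.keys (minor s a b :: 'k::field mpol) \<subseteq> monoms n"
proof -
  let ?M = "mat s s (\<lambda>(i, j). zvar (a i, b j)) :: 'k mpol mat"
  have summand: "Poly_Mapping.keys (signof p * (\<Prod>i = 0..<s. ?M $$ (i, p i)) :: 'k mpol) \<subseteq> monoms n"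
    if p: "p permutes {0..<s}" for p
  proof (rule keys_mult_monoms)
    show "Poly_Mapping.keys (signof p :: 'k mpol) \<subseteq> monoms n"
      by (cases p rule: sign_cases) (simp_all add: keys_one_monoms keys_uminus_monoms zero_mem_monoms)
    show "Poly_Mapping.keys (\<Prod>i = 0..<s. ?M $$ (i, p i)) \<subseteq> monoms n"
    proof (rule keys_prod_subset_monoms)
      fix i assume "i \<in> {0..<s}"
      then have i: "i < s" "p i < s" using permutes_in_image[OF p, of i] by auto
      then show "Poly_Mapping.keys (?M $$ (i, p i)) \<subseteq> monoms n"
        using index_seq_mem[OF assms(1)] index_seq_mem[OF assms(2)]
        by (simp, intro keys_zvar_monoms) auto
    qed
  qed
  have det: "det ?M = (\<Sum>p\<in>{p. p permutes {0..<s}}. signof p * (\<Prod>i = 0..<s. ?M $$ (i, p i)))"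
    by (rule det_def') simp
  show ?thesis unfolding minor_def det by (rule keys_sum_subset_monoms) (rule summand, simp)
qed

lemma prod_zvar: "(\<Prod>i\<in>I. zvar (f i)) = (Poly_Mapping.single (\<Sum>i\<in>I. Poly_Mapping.single (f i) 1) 1 :: 'k::field mpol)"
  by (induction I rule: infinite_finite_induct) (simp_all add: zvar_def mult_single)

lemma zring_simps:
  "carrier (zring n) = {f. Poly_Mapping.keys f \<subseteq> monoms n}"
  "x \<otimes>\<^bsub>zring n\<^esub> y = x * y" "x \<oplus>\<^bsub>zring n\<^esub> y = x + y" "\<zero>\<^bsub>zring n\<^esub> = 0" "\<one>\<^bsub>zring n\<^esub> = 1"
  by (simp_all add: zring_def)

lemma nw_minors_carrier:
  assumes "p \<le> n" "q \<le> n"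
  shows "(nw_minors s p q :: 'k::field mpol set) \<subseteq> carrier (zring n)"
  using keys_minor index_seq_mono[OF _ assms(1)] index_seq_mono[OF _ assms(2)]
  unfolding nw_minors_def zring_simps by blast

text \<open>Since the kernel is an ideal, vanishing on the Schubert ideal has to be checked on the
  generating minors only.\<close>

lemma peval_kernel_ideal:
  fixes C :: "'k::field \<Rightarrow> 'r::comm_ring_1"
  assumes C: "C 0 = 0" "C 1 = 1" "\<And>c d. C (c + d) = C c + C d" "\<And>c d. C (c * d) = C c * C d"
  shows "ideal {f \<in> carrier (zring n). peval C x f = 0} (zring n)"
proof -
  interpret R: cring "zring n :: 'k mpol ring" by (rule cring_zring)
  note hom = peval_0[OF C] peval_add[OF C] peval_mult[OF C]
  show ?thesis
  proof (rule idealI)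
    show "ring (zring n :: 'k mpol ring)" by (rule R.ring_axioms)
    show "subgroup {f \<in> carrier (zring n). peval C x f = 0} (add_monoid (zring n))"
    proof (rule R.add.subgroupI)
      fix f :: "'k mpol" assume f: "f \<in> {f \<in> carrier (zring n). peval C x f = 0}"
      then have f': "f \<in> carrier (zring n)" "peval C x f = 0" by auto
      have "\<ominus>\<^bsub>zring n\<^esub> f + f = 0" using R.l_neg[OF f'(1)] by (simp add: zring_simps)
      then have "peval C x (\<ominus>\<^bsub>zring n\<^esub> f) + peval C x f = 0" using hom by metis
      then show "\<ominus>\<^bsub>zring n\<^esub> f \<in> {f \<in> carrier (zring n). peval C x f = 0}"
        using f' R.a_inv_closed[OF f'(1)] by simp
    next
      fix f g :: "'k mpol"
      assume "f \<in> {f \<in> carrier (zring n). peval C x f = 0}" "g \<in> {f \<in> carrier (zring n). peval C x f = 0}"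
      then show "f \<oplus>\<^bsub>zring n\<^esub> g \<in> {f \<in> carrier (zring n). peval C x f = 0}"
        using R.a_closed[of f g] by (simp add: zring_simps hom)
    qed (use hom(1) R.zero_closed in \<open>auto simp: zring_simps intro!: exI[of _ 0]\<close>)
    fix f g :: "'k mpol"
    assume f: "f \<in> {f \<in> carrier (zring n). peval C x f = 0}" and g: "g \<in> carrier (zring n)"
    show "g \<otimes>\<^bsub>zring n\<^esub> f \<in> {f \<in> carrier (zring n). peval C x f = 0}"
      using f g R.m_closed[of g f] by (simp add: zring_simps hom)
    show "f \<otimes>\<^bsub>zring n\<^esub> g \<in> {f \<in> carrier (zring n). peval C x f = 0}"
      using f g R.m_closed[of f g] by (simp add: zring_simps hom)
  qed
qed

lemma const_hom:
  "Poly_Mapping.single 0 0 = (0 :: expo \<Rightarrow>\<^sub>0 'k::field)"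
  "Poly_Mapping.single 0 1 = (1 :: expo \<Rightarrow>\<^sub>0 'k)"
  "Poly_Mapping.single 0 (c + d) = (Poly_Mapping.single 0 c + Poly_Mapping.single 0 d :: expo \<Rightarrow>\<^sub>0 'k)"
  "Poly_Mapping.single 0 (c * d) = (Poly_Mapping.single 0 c * Poly_Mapping.single 0 d :: expo \<Rightarrow>\<^sub>0 'k)"
  by (simp_all add: single_add mult_single)

section \<open>Rank conditions at the essential set\<close>

lemma rank_fn_Suc: "rank_fn \<pi> (Suc p) q = rank_fn \<pi> p q + (if \<pi> (Suc p) \<le> q then 1 else 0)"
proof -
  have "{i \<in> {1..Suc p}. \<pi> i \<le> q} = (if \<pi> (Suc p) \<le> q then insert (Suc p) {i \<in> {1..p}. \<pi> i \<le> q} else {i \<in> {1..p}. \<pi> i \<le> q})"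
    by (auto simp: le_Suc_eq)
  then show ?thesis by (simp add: rank_fn_def)
qed

lemma rank_fn_Suc_right:
  assumes "bij \<pi>" "\<pi> 0 = 0"
  shows "rank_fn \<pi> p (Suc q) = rank_fn \<pi> p q + (if inv_into UNIV \<pi> (Suc q) \<le> p then 1 else 0)"
  using rank_fn_Suc[of "inv_into UNIV \<pi>" q p] rank_fn_inv[OF assms] by simp

text \<open>Fulton's reduction: off the diagram a rank condition follows from one on a smaller
  rectangle, and on the diagram from one at an essential box further southeast.\<close>

lemma rank_le_diagram:
  assumes \<pi>: "\<pi> permutes {1..n}" and ess: "\<And>p q. (p, q) \<in> ess \<pi> \<Longrightarrow> rank_le x p q (rank_fn \<pi> p q)"
    and d: "(p, q) \<in> diagram \<pi>"
  shows "rank_le x p q (rank_fn \<pi> p q)"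
  using d
proof (induction "2 * n - (p + q)" arbitrary: p q rule: less_induct)
  case less
  have bij: "bij \<pi>" and 0: "\<pi> 0 = 0" using \<pi> by (simp_all add: permutes_bij permutes_not_in)
  have in_n: "p' \<le> n \<and> q' \<le> n" if "(p', q') \<in> diagram \<pi>" for p' q' using diagram_subset[OF \<pi>] that by auto
  have pq: "q < \<pi> p" "p < inv_into UNIV \<pi> q" using less.prems by (auto simp: diagram_def)
  consider "(p, q) \<in> ess \<pi>" | "(Suc p, q) \<in> diagram \<pi>" | "(p, Suc q) \<in> diagram \<pi>"
    using less.prems by (auto simp: ess_def)
  then show ?case
  proof cases
    case 1
    then show ?thesis by (rule ess)
  next
    case 2
    have "2 * n - (Suc p + q) < 2 * n - (p + q)" using in_n[OF 2] by linarith
    then have "rank_le x (Suc p) q (rank_fn \<pi> (Suc p) q)" by (rule less.hyps[OF _ 2])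
    moreover have "rank_fn \<pi> (Suc p) q = rank_fn \<pi> p q" using 2 by (simp add: rank_fn_Suc diagram_def)
    ultimately show ?thesis by (auto intro: rank_le_mono)
  next
    case 3
    have "2 * n - (p + Suc q) < 2 * n - (p + q)" using in_n[OF 3] by linarith
    then have "rank_le x p (Suc q) (rank_fn \<pi> p (Suc q))" by (rule less.hyps[OF _ 3])
    moreover have "rank_fn \<pi> p (Suc q) = rank_fn \<pi> p q" using 3 by (simp add: rank_fn_Suc_right[OF bij 0] diagram_def)
    ultimately show ?thesis by (auto intro: rank_le_mono)
  qed
qed

lemma rank_le_all:
  assumes \<pi>: "\<pi> permutes {1..n}" and ess: "\<And>p q. (p, q) \<in> ess \<pi> \<Longrightarrow> rank_le x p q (rank_fn \<pi> p q)"
  shows "rank_le x p q (rank_fn \<pi> p q)"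
proof (induction "p + q" arbitrary: p q rule: less_induct)
  case less
  have bij: "bij \<pi>" and 0: "\<pi> 0 = 0" using \<pi> by (simp_all add: permutes_bij permutes_not_in)
  show ?case
  proof (cases "p = 0 \<or> q = 0")
    case True
    then show ?thesis by (auto simp: rank_le_def dest: index_seq_le)
  next
    case False
    then obtain p' q' where pq: "p = Suc p'" "q = Suc q'" by (metis not0_implies_Suc)
    have "(p, q) \<in> diagram \<pi> \<or> \<pi> p \<le> q \<or> inv_into UNIV \<pi> q \<le> p" by (auto simp: diagram_def not_less)
    then consider "(p, q) \<in> diagram \<pi>" | "\<pi> p \<le> q" | "inv_into UNIV \<pi> q \<le> p" by blast
    then show ?thesis
    proof cases
      case 1
      show ?thesis by (rule rank_le_diagram[OF \<pi> _ 1]) (rule ess)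
    next
      case 2
      \<comment> \<open>Row \<open>p\<close> raises the prescribed rank by 1, as much as one more
        row can raise the rank of a matrix.\<close>
      have "rank_le x p' q (rank_fn \<pi> p' q)" by (rule less) (simp add: pq)
      from rank_le_add_row[OF this] show ?thesis using 2 unfolding pq rank_fn_Suc by simp
    next
      case 3
      have "rank_le x p q' (rank_fn \<pi> p q')" by (rule less) (simp add: pq)
      from rank_le_add_col[OF this] show ?thesis using 3 unfolding pq rank_fn_Suc_right[OF bij 0] by simp
    qed
  qed
qed

definition low_rank_region :: "(nat \<Rightarrow> nat) \<Rightarrow> nat \<Rightarrow> (nat \<times> nat) set" where
  "low_rank_region \<pi> s = {(i, j). \<exists>(p, q)\<in>ess \<pi>. rank_fn \<pi> p q < s \<and> i \<le> p \<and> j \<le> q}"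

text \<open>Since no essential box lies strictly northwest of \<open>(p0, q0)\<close>, removing \<open>low_rank_region\<close>
  from the rectangle of \<open>(p0, q0)\<close> removes entire rows and columns and so keeps the rank 1.\<close>

lemma rank_le_param_ess:
  assumes \<pi>: "\<pi> permutes {1..n}" and vex: "vexillary \<pi>" and e: "(p0, q0) \<in> ess \<pi>"
  shows "rank_le (param n (low_rank_region \<pi>) :: _ \<Rightarrow> expo \<Rightarrow>\<^sub>0 'k::field) p0 q0 (rank_fn \<pi> p0 q0)"
  unfolding rank_le_def
proof (intro allI impI)
  let ?x = "param n (low_rank_region \<pi>) :: _ \<Rightarrow> expo \<Rightarrow>\<^sub>0 'k" and ?r = "rank_fn \<pi> p0 q0"
  fix a b assume ab: "index_seq (Suc ?r) p0 a \<and> index_seq (Suc ?r) q0 b"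
  have bij: "bij \<pi>" and 0: "\<pi> 0 = 0" using \<pi> by (simp_all add: permutes_bij permutes_not_in)
  \<comment> \<open>\<open>P s i\<close> says that row \<open>i\<close> survives in the summand
    \<open>s\<close>: it is below every essential rectangle of rank less than \<open>s\<close> that
    covers all columns up to \<open>q0\<close>. \<open>Q\<close> is the analogue for
    columns.\<close>
  define P where "P s i \<longleftrightarrow> (\<forall>(p, q)\<in>ess \<pi>. rank_fn \<pi> p q < s \<and> q0 \<le> q \<longrightarrow> p < i)" for s i
  define Q where "Q s j \<longleftrightarrow> (\<forall>(p, q)\<in>ess \<pi>. rank_fn \<pi> p q < s \<and> p0 \<le> p \<longrightarrow> q < j)" for s j
  define A where "A i t = (if P (Suc t) (a i) then Poly_Mapping.single (Poly_Mapping.single (Inl (Suc t, a i)) 1) 1 else 0 :: expo \<Rightarrow>\<^sub>0 'k)" for i t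
  define B where "B t j = (if Q (Suc t) (b j) then Poly_Mapping.single (Poly_Mapping.single (Inr (Suc t, b j)) 1) 1 else 0 :: expo \<Rightarrow>\<^sub>0 'k)" for t j
  have "?r < p0" using ess_rank_less[OF e bij 0] by simp
  moreover have "p0 \<le> n" using diagram_subset[OF \<pi>] ess_diagram[OF e] by auto
  ultimately have rn: "?r \<le> n" by simp
  have region: "(i, j) \<notin> low_rank_region \<pi> s \<longleftrightarrow> P s i \<and> Q s j" if "i \<le> p0" "j \<le> q0" for i j s
  proof
    assume "(i, j) \<notin> low_rank_region \<pi> s"
    then have n: "\<not> (i \<le> p \<and> j \<le> q)" if "(p, q) \<in> ess \<pi>" "rank_fn \<pi> p q < s" for p q
      using that unfolding low_rank_region_def by blast
    have "p < i" if "(p, q) \<in> ess \<pi>" "rank_fn \<pi> p q < s" "q0 \<le> q" for p q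
      using n[OF that(1,2)] that(3) \<open>j \<le> q0\<close> by linarith
    moreover have "q < j" if "(p, q) \<in> ess \<pi>" "rank_fn \<pi> p q < s" "p0 \<le> p" for p q
      using n[OF that(1,2)] that(3) \<open>i \<le> p0\<close> by linarith
    ultimately show "P s i \<and> Q s j" unfolding P_def Q_def by blast
  next
    assume PQ: "P s i \<and> Q s j"
    show "(i, j) \<notin> low_rank_region \<pi> s"
    proof
      assume "(i, j) \<in> low_rank_region \<pi> s"
      then obtain p q where pq: "(p, q) \<in> ess \<pi>" "rank_fn \<pi> p q < s" "i \<le> p" "j \<le> q"
        unfolding low_rank_region_def by blast
      have "p0 \<le> p \<or> q0 \<le> q" using vexillary_ess[OF vex bij pq(1) e] by linarith
      moreover have "q0 \<le> q \<Longrightarrow> p < i" using PQ pq(1,2) unfolding P_def by blast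
      moreover have "p0 \<le> p \<Longrightarrow> q < j" using PQ pq(1,2) unfolding Q_def by blast
      ultimately show False using pq(3,4) by linarith
    qed
  qed
  have entry: "?x (a i, b j) = (\<Sum>t<?r. A i t * B t j)" if "i < Suc ?r" "j < Suc ?r" for i j
  proof -
    have le: "a i \<le> p0" "b j \<le> q0" using index_seq_mem[of _ _ a i] index_seq_mem[of _ _ b j] ab that by force+
    \<comment> \<open>For \<open>s\<close> above the rank, the region contains the whole rectangle
      of \<open>(p0, q0)\<close>, so only the first \<open>?r\<close> summands remain.\<close>
    have sub: "s \<in> Suc ` {..<?r}" if "s \<in> {1..n}" "(a i, b j) \<notin> low_rank_region \<pi> s" for s
    proof -
      have "\<not> ?r < s" using that(2) e le unfolding low_rank_region_def by blast
      then have "s = Suc (s - 1)" "s - 1 < ?r" using that(1) by auto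
      then show ?thesis by blast
    qed
    let ?g = "\<lambda>s. if P s (a i) \<and> Q s (b j) then Poly_Mapping.single (bexp s (a i, b j)) 1 else 0 :: expo \<Rightarrow>\<^sub>0 'k"
    have "?x (a i, b j) = (\<Sum>s\<in>{s \<in> {1..n}. (a i, b j) \<notin> low_rank_region \<pi> s}. ?g s)"
      unfolding param_def using region[OF le] by (intro sum.cong) auto
    also have "\<dots> = (\<Sum>s\<in>Suc ` {..<?r}. ?g s)"
    proof (rule sum.mono_neutral_left)
      show "{s \<in> {1..n}. (a i, b j) \<notin> low_rank_region \<pi> s} \<subseteq> Suc ` {..<?r}" using sub by blast
      show "\<forall>s\<in>Suc ` {..<?r} - {s \<in> {1..n}. (a i, b j) \<notin> low_rank_region \<pi> s}. ?g s = 0"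
        using region[OF le] rn by auto
    qed simp
    also have "\<dots> = (\<Sum>t<?r. ?g (Suc t))" by (subst sum.reindex) auto
    also have "\<dots> = (\<Sum>t<?r. A i t * B t j)"
      by (rule sum.cong) (auto simp: A_def B_def mult_single bexp_def)
    finally show ?thesis .
  qed
  have "mat (Suc ?r) (Suc ?r) (\<lambda>(i, j). ?x (a i, b j)) = mat (Suc ?r) (Suc ?r) (\<lambda>(i, j). \<Sum>t<?r. A i t * B t j)"
    by (rule eq_matI) (use entry in auto)
  then show "det (mat (Suc ?r) (Suc ?r) (\<lambda>(i, j). ?x (a i, b j))) = 0"
    using det_sum_of_products[of ?r "Suc ?r" A B] by simp
qed

lemma schubert_ideal_vanishes:
  assumes \<pi>: "\<pi> permutes {1..n}" and vex: "vexillary \<pi>" and f: "f \<in> (schubert_ideal n \<pi> :: 'k::field mpol set)"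
  shows "peval (Poly_Mapping.single 0) (param n (low_rank_region \<pi>)) f = 0"
    and "Poly_Mapping.keys f \<subseteq> monoms n"
proof -
  let ?x = "param n (low_rank_region \<pi>) :: _ \<Rightarrow> expo \<Rightarrow>\<^sub>0 'k"
  let ?K = "{f \<in> carrier (zring n). peval (Poly_Mapping.single 0) ?x f = 0}"
  interpret R: cring "zring n :: 'k mpol ring" by (rule cring_zring)
  have K: "ideal ?K (zring n)" by (rule peval_kernel_ideal) (rule const_hom)+
  have rank: "rank_le ?x p q (rank_fn \<pi> p q)" for p q
    by (rule rank_le_all[OF \<pi> rank_le_param_ess[OF \<pi> vex]])
  have "nw_minors (1 + rank_fn \<pi> p q) p q \<subseteq> ?K" if "p \<in> {1..n}" "q \<in> {1..n}" for p q
  proof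
    fix g :: "'k mpol" assume g: "g \<in> nw_minors (1 + rank_fn \<pi> p q) p q"
    then obtain a b where ab: "g = minor (Suc (rank_fn \<pi> p q)) a b"
        "index_seq (Suc (rank_fn \<pi> p q)) p a" "index_seq (Suc (rank_fn \<pi> p q)) q b"
      unfolding nw_minors_def by auto
    have "peval (Poly_Mapping.single 0) ?x g = 0"
      unfolding ab(1) peval_minor[OF const_hom] using rank[of p q] ab(2,3) unfolding rank_le_def by blast
    moreover have "g \<in> carrier (zring n)" using nw_minors_carrier[of p n q] that g by auto
    ultimately show "g \<in> ?K" by simp
  qed
  then have "schubert_ideal n \<pi> \<subseteq> ?K" unfolding schubert_ideal_def by (intro R.genideal_minimal[OF K]) blast
  then show "peval (Poly_Mapping.single 0) ?x f = 0" "Poly_Mapping.keys f \<subseteq> monoms n"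
    using f by (auto simp: zring_simps)
qed

section \<open>The initial ideal\<close>

text \<open>A 2 by 2 minor has exactly two monomials, and its leading term is the diagonal
  one.\<close>

lemma diagonal_swap_reducing:
  assumes "diagonal_term_order TYPE('k::field) n r"
  shows "swap_reducing n r"
  unfolding swap_reducing_def
proof (intro allI impI)
  interpret term_ord n r using assms by unfold_locales (simp add: diagonal_term_order_def)
  fix i i' j j' assume b: "1 \<le> i \<and> i < i' \<and> i' \<le> n \<and> 1 \<le> j \<and> j < j' \<and> j' \<le> n"
  let ?a = "\<lambda>t. if t = 0 then i else i'" and ?b = "\<lambda>t. if t = 0 then j else j'"
  let ?D = "Poly_Mapping.single (i, j) 1 + Poly_Mapping.single (i', j') 1 :: monom"
  let ?A = "Poly_Mapping.single (i, j') 1 + Poly_Mapping.single (i', j) 1 :: monom"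
  let ?M = "mat 2 2 (\<lambda>(s, t). zvar (?a s, ?b t)) :: 'k mpol mat"
  have ab: "index_seq 2 n ?a" "index_seq 2 n ?b"
    using b by (auto simp: index_seq_def strict_mono_on_def)
  have "Poly_Mapping.lookup ?D (i, j) \<noteq> Poly_Mapping.lookup ?A (i, j)"
    using b by (simp add: lookup_add lookup_single when_def)
  then have ne: "?D \<noteq> ?A" by metis
  have del: "mat_delete ?M 0 0 = mat 1 1 (\<lambda>_. zvar (i', j'))" "mat_delete ?M 0 1 = mat 1 1 (\<lambda>_. zvar (i', j))"
    by (rule eq_matI; simp add: mat_delete_def)+
  have "det ?M = (\<Sum>t<2. ?M $$ (0, t) * cofactor ?M 0 t)"
    by (rule laplace_expansion_row) auto
  also have "\<dots> = ?M $$ (0, 0) * cofactor ?M 0 0 + ?M $$ (0, 1) * cofactor ?M 0 1"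
    by (simp add: numeral_2_eq_2)
  also have "\<dots> = zvar (i, j) * zvar (i', j') - zvar (i, j') * zvar (i', j)"
    unfolding cofactor_def del by (simp add: det_single)
  finally have minor: "minor 2 ?a ?b = (Poly_Mapping.single ?D 1 - Poly_Mapping.single ?A 1 :: 'k mpol)"
    by (simp add: minor_def zvar_def mult_single)
  let ?m = "minor 2 ?a ?b :: 'k mpol"
  have lookup: "Poly_Mapping.lookup ?m u = (if u = ?D then 1 else if u = ?A then - 1 else 0)" for u
    unfolding minor using ne by (auto simp: lookup_minus lookup_single when_def)
  have keys: "Poly_Mapping.keys ?m \<subseteq> monoms n" by (rule keys_minor) (rule ab)+
  have "Poly_Mapping.lookup ?m ?D \<noteq> Poly_Mapping.lookup 0 ?D" using lookup[of ?D] by simp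
  then have "?m \<noteq> 0" by metis
  note lm = leading_monom[OF this keys]
  have "leading_term r ?m = diagonal_term 2 ?a ?b"
    using assms ab unfolding diagonal_term_order_def by blast
  also have "\<dots> = Poly_Mapping.single ?D 1"
    by (simp add: diagonal_term_def numeral_2_eq_2 zvar_def mult_single)
  finally have "Poly_Mapping.single (leading_monom r ?m) (Poly_Mapping.lookup ?m (leading_monom r ?m)) = Poly_Mapping.single ?D 1"
    unfolding leading_term_def .
  then have "Poly_Mapping.lookup (Poly_Mapping.single (leading_monom r ?m) (Poly_Mapping.lookup ?m (leading_monom r ?m))) ?D = 1"
    by simp
  then have "leading_monom r ?m = ?D" by (simp add: lookup_single when_def split: if_splits)
  moreover have "?A \<in> Poly_Mapping.keys ?m" using lookup[of ?A] ne by (simp add: in_keys_iff)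
  ultimately show "(?A, ?D) \<in> r" using lm(2)[of ?A] by simp
qed

lemma lc_le: "lc F p q \<le> p"
proof (induction p)
  case (Suc p)
  then show ?case using lc_Suc_left_le[of F p q] by simp
qed simp

text \<open>Decompose the support of the leading monomial into antichains by height.\<close>

lemma leading_monom_nonface:
  assumes \<pi>: "\<pi> permutes {1..n}" and vex: "vexillary \<pi>"
    and ord: "diagonal_term_order TYPE('k::field) n r"
    and f: "f \<in> (schubert_ideal n \<pi> :: 'k mpol set)" "f \<noteq> 0"
  shows "Poly_Mapping.keys (leading_monom r f) \<inter> shape \<pi> \<notin> Gamma_complex \<pi>"
proof
  interpret term_ord n r using ord by unfold_locales (simp add: diagonal_term_order_def)
  let ?S = "Poly_Mapping.keys (leading_monom r f)"
  assume "?S \<inter> shape \<pi> \<in> Gamma_complex \<pi>"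
  then have "\<forall>(p, q)\<in>ess \<pi>. lc (?S \<inter> shape \<pi>) p q \<le> rank_fn \<pi> p q"
    using face_iff[OF \<pi> vex, of "?S \<inter> shape \<pi>"] by blast
  then have face: "lc ?S p q \<le> rank_fn \<pi> p q" if "(p, q) \<in> ess \<pi>" for p q
  proof -
    \<comment> \<open>Cells of the support outside the shape do not affect chains in essential
      rectangles.\<close>
    have "{1..p} \<times> {1..q} \<subseteq> shape \<pi>" using that unfolding shape_def by blast
    then have "lc ?S p q = lc (?S \<inter> shape \<pi>) p q" by (intro lc_cong) blast
    then show ?thesis using \<open>\<forall>(p, q)\<in>ess \<pi>. _ p q\<close> that by fastforce
  qed
  note keys = schubert_ideal_vanishes(2)[OF \<pi> vex f(1)]
  have "leading_monom r f \<in> monoms n" using leading_monom(1)[OF f(2) keys] keys by blast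
  then have S: "?S \<subseteq> {1..n} \<times> {1..n}" by (simp add: monoms_def)
  \<comment> \<open>One more than the length of a longest chain strictly northwest of the cell; a
    cell of the support with height \<open>s\<close> thus ends a chain of length
    \<open>s\<close>.\<close>
  define h where "h = (\<lambda>(i, j). Suc (lc ?S (i - 1) (j - 1)))"
  have h_le: "h (i, j) \<le> lc ?S p q" if ij: "(i, j) \<in> ?S" "i \<le> p" "j \<le> q" for i j p q
  proof -
    obtain i' j' where s: "i = Suc i'" "j = Suc j'"
      using S ij(1) by (cases i; cases j) auto
    have "h (i, j) \<le> lc ?S i j" using ij(1) by (simp add: s h_def)
    also have "\<dots> \<le> lc ?S p q" using ij by (intro lc_mono)
    finally show ?thesis .
  qed
  have "h v \<in> {1..n} \<and> v \<notin> low_rank_region \<pi> (h v)" if v: "v \<in> ?S" for v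
  proof -
    obtain i j where ij: "v = (i, j)" by (cases v)
    have "h (i, j) \<le> lc ?S i j" using h_le v ij by simp
    also have "\<dots> \<le> i" by (rule lc_le)
    also have "\<dots> \<le> n" using S v ij by auto
    finally have "h v \<in> {1..n}" by (simp add: ij h_def)
    \<comment> \<open>Otherwise a chain ending at \<open>v\<close> would exceed the rank of an
      essential rectangle that contains it.\<close>
    moreover have "v \<notin> low_rank_region \<pi> (h v)"
    proof
      assume "v \<in> low_rank_region \<pi> (h v)"
      then obtain p q where pq: "(p, q) \<in> ess \<pi>" "rank_fn \<pi> p q < h v" "i \<le> p" "j \<le> q"
        unfolding low_rank_region_def ij by blast
      then show False using h_le[of i j p q] face[OF pq(1)] v unfolding ij by simp
    qed
    ultimately show ?thesis ..
  qed
  moreover have "antichain {v \<in> ?S. h v = s}" for s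
  proof -
    have "h (i, j) < h (i', j')" if "(i, j) \<in> ?S" "i < i'" "j < j'" for i j i' j'
    proof -
      have "i \<le> i' - 1" "j \<le> j' - 1" using that by auto
      from h_le[OF that(1) this] show ?thesis by (simp add: h_def)
    qed
    then show ?thesis unfolding antichain_def by fastforce
  qed
  ultimately have "peval (Poly_Mapping.single 0) (param n (low_rank_region \<pi>)) f \<noteq> 0"
    by (intro peval_param_nonzero[OF diagonal_swap_reducing[OF ord] f(2) keys refl, of h]) blast+
  then show False using schubert_ideal_vanishes(1)[OF \<pi> vex f(1)] by contradiction
qed

theorem theorem4p4:
  fixes n :: nat and \<pi> :: "nat \<Rightarrow> nat" and r :: "(monom \<times> monom) set"
  assumes "\<pi> permutes {1..n}"
    and "vexillary \<pi>"
    and "diagonal_term_order TYPE('k::field) n r"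
  shows "initial_ideal n r (schubert_ideal n \<pi> :: 'k mpol set) =
         stanley_reisner_ideal n (shape \<pi>) (Gamma_complex \<pi>)"
proof -
  interpret R: cring "zring n :: 'k mpol ring" by (rule cring_zring)
  interpret term_ord n r using assms(3) by unfold_locales (simp add: diagonal_term_order_def)
  let ?I = "schubert_ideal n \<pi> :: 'k mpol set"
  let ?L = "{leading_term r f | f. f \<in> ?I \<and> f \<noteq> 0}"
  let ?G = "{\<Prod>x\<in>F. zvar x | F. F \<subseteq> shape \<pi> \<and> F \<notin> Gamma_complex \<pi>} :: 'k mpol set"
  note keysI = schubert_ideal_vanishes(2)[OF assms(1,2)]
  have shape: "shape \<pi> \<subseteq> {1..n} \<times> {1..n}" by (rule shape_ferrers(2)[OF assms(1)])
  have L_carrier: "?L \<subseteq> carrier (zring n)"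
  proof safe
    fix f assume f: "f \<in> ?I" "f \<noteq> 0"
    have "leading_monom r f \<in> monoms n" using leading_monom(1)[OF f(2) keysI[OF f(1)]] keysI[OF f(1)] by blast
    then show "leading_term r f \<in> carrier (zring n)" by (simp add: leading_term_def zring_simps)
  qed
  have G_carrier: "?G \<subseteq> carrier (zring n)"
  proof safe
    fix F assume "F \<subseteq> shape \<pi>"
    then have "F \<subseteq> {1..n} \<times> {1..n}" using shape by blast
    then show "(\<Prod>x\<in>F. zvar x) \<in> carrier (zring n :: 'k mpol ring)"
      unfolding zring_simps by (intro CollectI keys_prod_subset_monoms keys_zvar_monoms) blast
  qed
  have GI: "ideal (Idl\<^bsub>zring n\<^esub> ?G) (zring n)" by (rule R.genideal_ideal[OF G_carrier])
  have LI: "ideal (Idl\<^bsub>zring n\<^esub> ?L) (zring n)" by (rule R.genideal_ideal[OF L_carrier])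
  have mult: "x * y \<in> J" if "ideal J (zring n)" "x \<in> J" "Poly_Mapping.keys y \<subseteq> monoms n" for J and x y :: "'k mpol"
    using ideal.I_r_closed[OF that(1,2), of y] that(3) by (simp add: zring_simps)
  have "?L \<subseteq> Idl\<^bsub>zring n\<^esub> ?G"
  proof safe
    fix f assume f: "f \<in> ?I" "f \<noteq> 0"
    let ?m = "leading_monom r f"
    let ?F = "Poly_Mapping.keys ?m \<inter> shape \<pi>"
    \<comment> \<open>The squarefree monomial of the nonface divides the leading monomial; the
      cofactor carries the leading coefficient.\<close>
    let ?e = "\<Sum>x\<in>?F. Poly_Mapping.single x (1::nat)"
    have m: "?m \<in> monoms n" using leading_monom(1)[OF f(2) keysI[OF f(1)]] keysI[OF f(1)] by blast
    have "?F \<notin> Gamma_complex \<pi>" by (rule leading_monom_nonface[OF assms f])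
    then have g: "(\<Prod>x\<in>?F. zvar x) \<in> Idl\<^bsub>zring n\<^esub> ?G" using R.genideal_self[OF G_carrier] by blast
    have "?e + (?m - ?e) = ?m"
    proof (rule poly_mapping_eqI)
      fix x
      have "Poly_Mapping.lookup ?e x = (\<Sum>y\<in>?F. if y = x then 1 else 0)"
        unfolding lookup_sum by (rule sum.cong) (auto simp: lookup_single when_def)
      then have "Poly_Mapping.lookup ?e x = (if x \<in> ?F then 1 else 0)" by simp
      then show "Poly_Mapping.lookup (?e + (?m - ?e)) x = Poly_Mapping.lookup ?m x"
        by (auto simp: lookup_add lookup_minus in_keys_iff)
    qed
    then have "leading_term r f = (\<Prod>x\<in>?F. zvar x) * Poly_Mapping.single (?m - ?e) (Poly_Mapping.lookup f ?m)"
      unfolding prod_zvar leading_term_def by (simp add: mult_single)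
    moreover have "Poly_Mapping.keys (Poly_Mapping.single (?m - ?e) (Poly_Mapping.lookup f ?m)) \<subseteq> monoms n"
      using m keys_minus_subset[of ?m ?e] by (auto simp: monoms_def)
    ultimately show "leading_term r f \<in> Idl\<^bsub>zring n\<^esub> ?G" using mult[OF GI g] by simp
  qed
  moreover have "?G \<subseteq> Idl\<^bsub>zring n\<^esub> ?L"
  proof safe
    fix F assume F: "F \<subseteq> shape \<pi>" "F \<notin> Gamma_complex \<pi>"
    then have "\<exists>p q. (p, q) \<in> ess \<pi> \<and> \<not> lc F p q \<le> rank_fn \<pi> p q"
      using face_iff[OF assms(1,2) F(1)] by blast
    then obtain p q where pq: "(p, q) \<in> ess \<pi>" "Suc (rank_fn \<pi> p q) \<le> lc F p q"
      by (auto simp: not_le Suc_le_eq)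
    let ?s = "Suc (rank_fn \<pi> p q)"
    obtain a b where ab: "index_seq ?s p a" "index_seq ?s q b" "\<And>i. i < ?s \<Longrightarrow> (a i, b i) \<in> F"
      using lc_chain[OF pq(2)] by blast
    have pqn: "p \<in> {1..n}" "q \<in> {1..n}" using diagram_subset[OF assms(1)] ess_diagram[OF pq(1)] by auto
    have abn: "index_seq ?s n a" "index_seq ?s n b"
      using index_seq_mono[OF ab(1), of n] index_seq_mono[OF ab(2), of n] pqn by auto
    let ?f = "minor ?s a b :: 'k mpol"
    have diag: "leading_term r ?f = diagonal_term ?s a b"
      using assms(3) abn unfolding diagonal_term_order_def by blast
    \<comment> \<open>By definition the leading term of 0 is 0, whereas a diagonal term is a
      monomial with coefficient 1.\<close>
    have "?f \<noteq> 0"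
    proof
      assume "?f = 0"
      then have "diagonal_term ?s a b = (0 :: 'k mpol)" using diag by (simp add: leading_term_def)
      then have "Poly_Mapping.single (\<Sum>i<?s. Poly_Mapping.single (a i, b i) (1::nat)) (1::'k) = 0"
        unfolding diagonal_term_def prod_zvar .
      from arg_cong[OF this, of "\<lambda>f. Poly_Mapping.lookup f (\<Sum>i<?s. Poly_Mapping.single (a i, b i) (1::nat))"]
      show False by simp
    qed
    moreover have "?f \<in> ?I"
    proof -
      have "?f \<in> (\<Union>p\<in>{1..n}. \<Union>q\<in>{1..n}. nw_minors (1 + rank_fn \<pi> p q) p q)"
        using pqn ab(1,2) by (intro UN_I[of p] UN_I[of q]) (auto simp: nw_minors_def)
      moreover have "(\<Union>p\<in>{1..n}. \<Union>q\<in>{1..n}. nw_minors (1 + rank_fn \<pi> p q) p q) \<subseteq> carrier (zring n :: 'k mpol ring)"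
        using nw_minors_carrier by fastforce
      ultimately show ?thesis unfolding schubert_ideal_def using R.genideal_self by blast
    qed
    ultimately have "diagonal_term ?s a b \<in> ?L" unfolding diag[symmetric] by blast
    then have d: "diagonal_term ?s a b \<in> Idl\<^bsub>zring n\<^esub> ?L" using R.genideal_self[OF L_carrier] by blast
    \<comment> \<open>The cells of the chain are distinct, so the diagonal term is the squarefree
      monomial of a subset of \<open>F\<close>.\<close>
    have inj: "inj_on (\<lambda>i. (a i, b i)) {..<?s}"
      using ab(1) by (auto simp: index_seq_def inj_on_def dest: strict_mono_on_imp_inj_on)
    let ?C = "(\<lambda>i. (a i, b i)) ` {..<?s}"
    have C: "?C \<subseteq> F" using ab(3) by auto
    have finF: "finite F" by (rule finite_subset[OF order.trans[OF F(1) shape]]) simp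
    have "(\<Prod>x\<in>F. zvar x) = (\<Prod>x\<in>?C. zvar x) * (\<Prod>x\<in>F - ?C. zvar x :: 'k mpol)"
      using prod.subset_diff[OF C finF, of zvar] by (simp add: mult.commute)
    also have "(\<Prod>x\<in>?C. zvar x) = (diagonal_term ?s a b :: 'k mpol)"
      unfolding diagonal_term_def by (subst prod.reindex[OF inj]) (simp add: o_def)
    finally have "(\<Prod>x\<in>F. zvar x) = diagonal_term ?s a b * (\<Prod>x\<in>F - ?C. zvar x :: 'k mpol)" .
    moreover have "Poly_Mapping.keys (\<Prod>x\<in>F - ?C. zvar x :: 'k mpol) \<subseteq> monoms n"
      using F(1) shape by (intro keys_prod_subset_monoms keys_zvar_monoms) blast
    ultimately show "(\<Prod>x\<in>F. zvar x :: 'k mpol) \<in> Idl\<^bsub>zring n\<^esub> ?L" using mult[OF LI d] by simp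
  qed
  ultimately show ?thesis unfolding initial_ideal_def stanley_reisner_ideal_def
    using R.genideal_minimal[OF GI] R.genideal_minimal[OF LI] by (intro antisym) blast+
qed

end
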